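(* Let $p>1$ be a real number and let $\mu,\kappa$ be partitions such that $\kappa$ is strict and $l(\kappa)=r$. Then for all $\alpha\in\mathcal A_r$, $\tilde P^{\mathrm{Sym},\kappa}_{p,\alpha}$ is a measure (i.e., $\tilde P^{\mathrm{Sym},\kappa}_{p,\alpha}(\lambda)\ge0$ for all partitions $\lambda$) such that $$M_{p,\mu}\big(\tilde P^{\mathrm{Sym},\kappa}_{p,\alpha}\big)=M_{p,\mu}\big(\tilde P^{\mathrm{Sym},\kappa}_{p}\big).$$ Furthermore, if $\tilde P^{\mathrm{Sym},\kappa}_{p,\alpha}=\tilde P^{\mathrm{Sym},\kappa}_{p,\beta}$ for $\alpha,\beta\in\mathcal A_r$, then $\alpha=\beta$.
   Context: Partitions: a partition $\lambda=(\lambda_1,\lambda_2,\dots)$ is a weakly decreasing sequence of nonnegative integers with finite sum $|\lambda|$; $l(\lambda)$ is its number of positive parts; $\lambda'$ is the conjugate partition ($\lambda'_i=\#\{j:\lambda_j\ge i\}$); $m_i(\lambda)=\lambda'_i-\lambda'_{i+1}$ is the number of parts equal to $i$. $\lambda$ is strict if $m_i(\lambda)\le 1$ for all $i\ge1$. $n(\lambda):=\sum_{i\ge1}\binom{\lambda'_i}{2}$. Throughout $q:=1/p\in(0,1)$, $(x;q)_\infty=\prod_{i\ge1}(1-xq^{i-1})$, $(x;q)_n=\prod_{i=1}^n(1-xq^{i-1})$ for $n\ge0$. Let $[r]=\{1,\dots,r\}$ and let $[r]_{\mathrm{odd}}$ be the set of all subsets of $[r]$ of odd size. The polytope $\mathcal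 A_r\subseteq\mathbb R^{[r]_{\mathrm{odd}}}$ is the set of functions $\alpha:[r]_{\mathrm{odd}}\to\mathbb R$ with $\sum_{S\in[r]_{\mathrm{odd}}}(-1)^{|S\cap T|}\alpha(S)\le1$ for every $T\subseteq[r]$. Functions on the set of partitions: $$P^{\mathrm{Sym}}_{\infty,p}(\lambda):=\frac{q^{n(\lambda)+|\lambda|}(q;q^2)_\infty}{\prod_{i\ge1}(q^2;q^2)_{\lfloor m_i(\lambda)/2\rfloor}},\qquad \tilde P^{\mathrm{Sym},\kappa}_{p}(\lambda):=p^{\sum_{i\ge1}\kappa_i\lambda'_i}\,P^{\mathrm{Sym}}_{\infty,p}(\lambda),$$ $$\tilde P^{\mathrm{Sym},\kappa}_{p,S}(\lambda):=\Big(1+(-1)^{\sum_{i\in S}\lambda'_i}\Big)\tilde P^{\mathrm{Sym},\kappa}_{p}(\lambda)\quad(S\subseteq[r]),$$ $$\tilde P^{\mathrm{Sym},\kappa}_{p,\alpha}:=\sum_{S\in[r]_{\mathrm{odd}}}\alpha(S)\,\tilde P^{\mathrm{Sym},\kappa}_{p,S}+\Big(1-\sum_{S\in[r]_{\mathrm{odd}}}\alpha(S)\Big)\tilde P^{\mathrm{Sym},\kappa}_{p}\quad(\alpha\in\mathcal A_r).$$ Hall–Littlewood functions: for $l(\lambda)\le n$, $$P_\lambda(x_1,\dots,x_n;q)=\frac1{v_\lambda(q)}\sum_{w\in S_n}w\Big(x_1^{\lambda_1}\cdots x_n^{\lambda_n}\prod_{i<j}\frac{x_i-qx_j}{x_i-x_j}\Big),\quad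 v_\lambda(q)=\frac{(q;q)_{n-l(\lambda)}}{(1-q)^{n-l(\lambda)}}\prod_{i\ge1}\frac{(q;q)_{m_i(\lambda)}}{(1-q)^{m_i(\lambda)}},$$ where $S_n$ permutes the variables, extended by stability to symmetric functions in countably many variables; $Q_\lambda=b_\lambda(q)P_\lambda$ with $b_\lambda(q)=\prod_{i\ge1}(q;q)_{m_i(\lambda)}$. Define $g^\lambda_{\mu\nu}(q)$ by $Q_\mu Q_\nu=\sum_\lambda g^\lambda_{\mu\nu}(q)Q_\lambda$ and the skew function $P_{\lambda/\mu}:=\sum_\nu g^\lambda_{\mu\nu}(q)P_\nu$ (zero unless $\mu_i\le\lambda_i$ for all $i$). For real $p>1$ put $$|\mathrm{Sur}_p(\lambda,\mu)|:=\frac{P_{\lambda/\mu}(q,q^2,\dots;q)}{P_\lambda(q,q^2,\dots;q)\,Q_\mu(1,q,q^2,\dots;q)};$$ when $p$ is prime this is the number of surjective homomorphisms $\bigoplus_i\mathbb Z/p^{\lambda_i}\mathbb{Z}\to\bigoplus_i\mathbb Z/p^{\mu_i}\mathbb{Z}$. The $\mu$-moment of a measure $\nu$ on partitions is $M_{p,\mu}(\nu):=\sum_\lambda\nu(\lambda)\,|\mathrm{Sur}_p(\lambda,\mu)|$. *)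

theory Defs
  imports "HOL-Analysis.Analysis" "HOL-Combinatorics.Permutations"
begin

section \<open>Partitions\<close>

text \<open>
  A partition is a sequence of natural numbers, indexed from \<open>0\<close>: the part written
  \<open>lam\<^sub>i\<close> with \<open>i \<ge> 1\<close> on paper is \<open>lam (i - 1)\<close>, so the largest part is \<open>lam 0\<close>.
  The conjugate parts \<open>lam'\<^sub>i\<close>, the multiplicities \<open>m\<^sub>i\<close> and the subsets of
  \<open>{1..r}\<close> below keep their usual indices \<open>i \<ge> 1\<close>.
\<close>

definition partitions :: "(nat \<Rightarrow> nat) set" where
  "partitions = {lam. antimono lam \<and> finite {i. lam i \<noteq> 0}}"

definition part_length :: "(nat \<Rightarrow> nat) \<Rightarrow> nat" where
  "part_length lam = card {i. lam i \<noteq> 0}"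

definition part_size :: "(nat \<Rightarrow> nat) \<Rightarrow> nat" where
  "part_size lam = (\<Sum>i | lam i \<noteq> 0. lam i)"

definition conj_part :: "(nat \<Rightarrow> nat) \<Rightarrow> nat \<Rightarrow> nat" where
  "conj_part lam i = card {j. i \<le> lam j}"

definition part_mult :: "(nat \<Rightarrow> nat) \<Rightarrow> nat \<Rightarrow> nat" where
  "part_mult lam i = card {j. lam j = i}"

definition strict_partition :: "(nat \<Rightarrow> nat) \<Rightarrow> bool" where
  "strict_partition lam \<longleftrightarrow> (\<forall>i\<ge>1. part_mult lam i \<le> 1)"

text \<open>
  Sums and products over all \<open>i \<ge> 1\<close> of expressions in \<open>lam'\<^sub>i\<close> or \<open>m\<^sub>i\<close> are
  cut off at the largest part, beyond which \<open>lam'\<^sub>i = m\<^sub>i = 0\<close>.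
\<close>

definition part_n :: "(nat \<Rightarrow> nat) \<Rightarrow> nat" where
  "part_n lam = (\<Sum>i=1..lam 0. conj_part lam i choose 2)"


section \<open>Shifted \<open>q\<close>-factorials\<close>

definition qpoch :: "real \<Rightarrow> real \<Rightarrow> nat \<Rightarrow> real" where
  "qpoch x q n = (\<Prod>i<n. 1 - x * q ^ i)"

definition qpoch_inf :: "real \<Rightarrow> real \<Rightarrow> real" where
  "qpoch_inf x q = (\<Prod>i. 1 - x * q ^ i)"


section \<open>Hall--Littlewood functions\<close>

text \<open>
  A sequence \<open>x\<close> supplies the variables: \<open>x\<^sub>1, \<dots>, x\<^sub>n\<close> are \<open>x 0, \<dots>, x (n - 1)\<close>.
  The symmetrisation formula contains denominators \<open>x\<^sub>i - x\<^sub>j\<close>, so the functions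
  in \<open>n\<close> variables are to be evaluated only at pairwise distinct reals.  These points
  determine the polynomial.
\<close>

definition hl_v :: "real \<Rightarrow> nat \<Rightarrow> (nat \<Rightarrow> nat) \<Rightarrow> real" where
  "hl_v q n lam =
     qpoch q q (n - part_length lam) / (1 - q) ^ (n - part_length lam) *
     (\<Prod>i=1..lam 0. qpoch q q (part_mult lam i) / (1 - q) ^ part_mult lam i)"

definition hl_b :: "real \<Rightarrow> (nat \<Rightarrow> nat) \<Rightarrow> real" where
  "hl_b q lam = (\<Prod>i=1..lam 0. qpoch q q (part_mult lam i))"

text \<open>
  A function indexed by a partition with more than \<open>n\<close> parts restricts to \<open>0\<close> in
  \<open>n\<close> variables.
\<close>

definition hl_P :: "real \<Rightarrow> nat \<Rightarrow> (nat \<Rightarrow> nat) \<Rightarrow> (nat \<Rightarrow> real) \<Rightarrow> real" where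
  "hl_P q n lam x =
     (if part_length lam \<le> n then
        1 / hl_v q n lam *
        (\<Sum>w | w permutes {..<n}.
           (\<Prod>i<n. x (w i) ^ lam i) *
           (\<Prod>j<n. \<Prod>i<j. (x (w i) - q * x (w j)) / (x (w i) - x (w j))))
      else 0)"

definition hl_Q :: "real \<Rightarrow> nat \<Rightarrow> (nat \<Rightarrow> nat) \<Rightarrow> (nat \<Rightarrow> real) \<Rightarrow> real" where
  "hl_Q q n lam x = hl_b q lam * hl_P q n lam x"

text \<open>
  Value of the symmetric function in countably many variables at a sequence of distinct
  reals such as \<open>1, q, q\<^sup>2, \<dots>\<close>.
\<close>

definition hl_P_inf :: "real \<Rightarrow> (nat \<Rightarrow> nat) \<Rightarrow> (nat \<Rightarrow> real) \<Rightarrow> real" where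
  "hl_P_inf q lam x = lim (\<lambda>n. hl_P q n lam x)"

definition hl_Q_inf :: "real \<Rightarrow> (nat \<Rightarrow> nat) \<Rightarrow> (nat \<Rightarrow> real) \<Rightarrow> real" where
  "hl_Q_inf q lam x = hl_b q lam * hl_P_inf q lam x"

text \<open>
  \<open>hl_coeff q mu nu lam\<close> is the coefficient of \<open>Q\<^bsub>lam\<^esub>\<close> in
  \<open>Q\<^bsub>mu\<^esub> Q\<^bsub>nu\<^esub>\<close>.  An identity of symmetric functions is an identity in
  \<open>n\<close> variables for every \<open>n\<close>.  The coefficients are unique because the functions
  \<open>Q\<^bsub>lam\<^esub>\<close> are linearly independent (for \<open>0 < q < 1\<close>).
\<close>

definition hl_coeff ::
    "real \<Rightarrow> (nat \<Rightarrow> nat) \<Rightarrow> (nat \<Rightarrow> nat) \<Rightarrow> (nat \<Rightarrow> nat) \<Rightarrow> real" where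
  "hl_coeff q mu nu =
     (THE g. {lam. g lam \<noteq> 0} \<subseteq> partitions \<and> finite {lam. g lam \<noteq> 0} \<and>
        (\<forall>n. \<forall>x :: nat \<Rightarrow> real. inj_on x {..<n} \<longrightarrow>
           hl_Q q n mu x * hl_Q q n nu x = (\<Sum>lam | g lam \<noteq> 0. g lam * hl_Q q n lam x)))"

text \<open>
  Only finitely many \<open>nu\<close> contribute to \<open>P\<^bsub>lam/mu\<^esub>\<close>, since nonzero coefficients
  have \<open>part_size mu + part_size nu = part_size lam\<close>.
\<close>

definition hl_skew_P_inf ::
    "real \<Rightarrow> (nat \<Rightarrow> nat) \<Rightarrow> (nat \<Rightarrow> nat) \<Rightarrow> (nat \<Rightarrow> real) \<Rightarrow> real" where
  "hl_skew_P_inf q lam mu x =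
     (\<Sum>nu | nu \<in> partitions \<and> hl_coeff q mu nu lam \<noteq> 0.
        hl_coeff q mu nu lam * hl_P_inf q nu x)"


section \<open>Moments\<close>

definition sur :: "real \<Rightarrow> (nat \<Rightarrow> nat) \<Rightarrow> (nat \<Rightarrow> nat) \<Rightarrow> real" where
  "sur p lam mu =
     (let q = 1 / p in
        hl_skew_P_inf q lam mu (\<lambda>i. q ^ Suc i) /
        (hl_P_inf q lam (\<lambda>i. q ^ Suc i) * hl_Q_inf q mu (\<lambda>i. q ^ i)))"

definition moment :: "real \<Rightarrow> (nat \<Rightarrow> nat) \<Rightarrow> ((nat \<Rightarrow> nat) \<Rightarrow> real) \<Rightarrow> real" where
  "moment p mu f = (\<Sum>\<^sub>\<infinity>lam\<in>partitions. f lam * sur p lam mu)"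

definition has_moment :: "real \<Rightarrow> (nat \<Rightarrow> nat) \<Rightarrow> ((nat \<Rightarrow> nat) \<Rightarrow> real) \<Rightarrow> bool" where
  "has_moment p mu f \<longleftrightarrow> (\<lambda>lam. f lam * sur p lam mu) summable_on partitions"


section \<open>The polytope and the measures\<close>

definition odd_subsets :: "nat \<Rightarrow> nat set set" where
  "odd_subsets r = {S. S \<subseteq> {1..r} \<and> odd (card S)}"

definition polytope_A :: "nat \<Rightarrow> (nat set \<Rightarrow> real) set" where
  "polytope_A r =
     {\<alpha> \<in> extensional (odd_subsets r).
        \<forall>T\<subseteq>{1..r}. (\<Sum>S\<in>odd_subsets r. (-1) ^ card (S \<inter> T) * \<alpha> S) \<le> 1}"

definition P_Sym_inf :: "real \<Rightarrow> (nat \<Rightarrow> nat) \<Rightarrow> real" where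
  "P_Sym_inf p lam =
     (let q = 1 / p in
        q ^ (part_n lam + part_size lam) * qpoch_inf q (q\<^sup>2) /
        (\<Prod>i=1..lam 0. qpoch (q\<^sup>2) (q\<^sup>2) (part_mult lam i div 2)))"

definition P_Sym :: "real \<Rightarrow> (nat \<Rightarrow> nat) \<Rightarrow> (nat \<Rightarrow> nat) \<Rightarrow> real" where
  "P_Sym p \<kappa> lam =
     p ^ (\<Sum>i=1..lam 0. \<kappa> (i - 1) * conj_part lam i) * P_Sym_inf p lam"

definition P_Sym_S ::
    "real \<Rightarrow> (nat \<Rightarrow> nat) \<Rightarrow> nat set \<Rightarrow> (nat \<Rightarrow> nat) \<Rightarrow> real" where
  "P_Sym_S p \<kappa> S lam = (1 + (-1) ^ (\<Sum>i\<in>S. conj_part lam i)) * P_Sym p \<kappa> lam"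

definition P_Sym_alpha ::
    "real \<Rightarrow> nat \<Rightarrow> (nat \<Rightarrow> nat) \<Rightarrow> (nat set \<Rightarrow> real) \<Rightarrow> (nat \<Rightarrow> nat) \<Rightarrow> real" where
  "P_Sym_alpha p r \<kappa> \<alpha> lam =
     (\<Sum>S\<in>odd_subsets r. \<alpha> S * P_Sym_S p \<kappa> S lam) +
     (1 - (\<Sum>S\<in>odd_subsets r. \<alpha> S)) * P_Sym p \<kappa> lam"

end

theory Submission
  imports Defs "HOL-Combinatorics.Multiset_Permutations" "HOL-Computational_Algebra.Polynomial"
    "HOL-Computational_Algebra.Formal_Power_Series" "HOL-Real_Asymp.Real_Asymp"
begin

text \<open>
  With \<open>a\<^sub>i = \<mu>'\<^sub>i\<close>, the Pieri rules and the linear independence of the Hall--Littlewood polynomials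
  give \<open>|Sur(\<lambda>, \<mu>)| = K \<Prod>\<^sub>i f\<^sub>i(\<lambda>'\<^sub>i)\<close>, where \<open>K\<close> depends only on \<open>\<mu>\<close> and
  \<open>f\<^sub>i(c) = p\<^bsup>a\<^sub>i c\<^esup> \<Prod> (1 - p\<^sup>j q\<^sup>c)\<close> over \<open>a\<^bsub>i+1\<^esub> \<le> j < a\<^sub>i\<close>. Hence the moments are
  sums over the columns of \<open>\<lambda>\<close> in which only neighbouring columns interact, through
  \<open>1 / (q\<^sup>2; q\<^sup>2)\<close> with index \<open>\<lfloor>(\<lambda>'\<^sub>i - \<lambda>'\<^bsub>i+1\<^esub>) / 2\<rfloor>\<close>.

  For \<open>S\<close> of odd size, the sum signed by the parity of \<open>\<Sum>\<^sub>S \<lambda>'\<^sub>i\<close> is zero. The columns beyond \<open>r\<close>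
  sum to a multiple of \<open>1 / (q; q)\<close> with index \<open>\<lambda>'\<^sub>r - a\<^bsub>r+1\<^esub>\<close>. By Euler's identity the
  weight of column \<open>r\<close> that results, taken with alternating sign, has vanishing sums against
  all \<open>p\<^bsup>j c\<^esup>\<close>, \<open>j \<ge> 0\<close>. This property passes from column \<open>i + 1\<close> to column \<open>i\<close>: expanding
  \<open>1 / (q\<^sup>2; q\<^sup>2)\<close> by Euler's identity turns the sum over \<open>\<lambda>'\<^sub>i\<close> into theta functions, whose values do
  not depend on the parity of \<open>\<lambda>'\<^bsub>i+1\<^esub>\<close>, so that only powers \<open>p\<^bsup>j c\<^esup>\<close> with
  \<open>j \<ge> 0\<close> and a sign survive, where \<open>c = \<lambda>'\<^bsub>i+1\<^esub>\<close>. Strictness of \<open>\<kappa>\<close> makes the double sums converge absolutely.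

  Nonnegativity is the inequality of the polytope for the set of even columns, and uniqueness is
  Fourier inversion on the subsets of \<open>{1..r}\<close>, since every parity pattern of the columns occurs.
\<close>

section \<open>Columns of a partition\<close>

text \<open>The coefficients \<open>hl_coeff\<close> are a definite description, so they carry no
  information until the expansion of a product is shown to exist and to be unique. Single
  coefficients stay unknown even then. What enters \<open>sur\<close> is their sum over
  \<open>nu\<close>, weighted by the specialisation of \<open>P_nu\<close>, and this sum is a
  coefficient in the product with a complete symmetric function, which is explicit.

  The analytic half is shaped by convergence. After the theta sums, an inner column of length
  \<open>s\<close> and an index \<open>j\<close> of Euler's series are coupled by the exponent
  \<open>(s - j)^2 / 2\<close>, which does not grow along \<open>s = j\<close>. Only a linear term
  is left there; it decays exactly when the power of \<open>p\<close> attached to the outer column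
  exceeds the growth of the inner weight.

  Odd size enters through one sign. Collected from all columns of \<open>S\<close> it is -1, so that
  the innermost signed column produces the series of \<open>(x; q)_inf\<close> at points among
  \<open>x = 1, p, p^2, ...\<close>, the zeros of that function.\<close>

definition cj :: "(nat \<Rightarrow> nat) \<Rightarrow> nat \<Rightarrow> nat" where
  "cj lam i = conj_part lam (Suc i)"

lemma partitions_antimono: "lam \<in> partitions \<Longrightarrow> i \<le> j \<Longrightarrow> lam j \<le> lam i"
  by (auto simp: partitions_def antimono_def)

lemma down_closed_lessThan:
  assumes "finite (A :: nat set)" "\<And>i j. i \<le> j \<Longrightarrow> j \<in> A \<Longrightarrow> i \<in> A"
  shows "A = {..<card A}"
proof (cases "A = {}")
  case False
  define m where "m = Max A"
  have "A = {..m}"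
  proof
    show "A \<subseteq> {..m}" using assms(1) by (auto simp: m_def)
    have "m \<in> A" using False assms(1) by (simp add: m_def)
    then show "{..m} \<subseteq> A" using assms(2) by auto
  qed
  then show ?thesis by (metis card_atMost lessThan_Suc_atMost)
qed simp

lemma partitions_support:
  assumes "lam \<in> partitions"
  shows "{i. lam i \<noteq> 0} = {..<part_length lam}"
  unfolding part_length_def
  by (rule down_closed_lessThan)
    (use assms partitions_antimono[OF assms] in \<open>force simp: partitions_def\<close>)+

lemma part_nonzero_iff: "lam \<in> partitions \<Longrightarrow> lam i \<noteq> 0 \<longleftrightarrow> i < part_length lam"
  using partitions_support by blast

lemma part_zero_iff: "lam \<in> partitions \<Longrightarrow> lam i = 0 \<longleftrightarrow> part_length lam \<le> i"
  using part_nonzero_iff[of lam i] by auto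

lemma part_ge_set:
  assumes "lam \<in> partitions" "1 \<le> j"
  shows "{i. j \<le> lam i} = {..<conj_part lam j}"
  unfolding conj_part_def
proof (rule down_closed_lessThan)
  have "{i. j \<le> lam i} \<subseteq> {i. lam i \<noteq> 0}" using assms(2) by auto
  then show "finite {i. j \<le> lam i}"
    using assms(1) by (auto simp: partitions_def intro: finite_subset)
qed (use partitions_antimono[OF assms(1)] in \<open>auto intro: le_trans\<close>)

lemma conj_part_less_iff:
  "lam \<in> partitions \<Longrightarrow> 1 \<le> j \<Longrightarrow> i < conj_part lam j \<longleftrightarrow> j \<le> lam i"
  using part_ge_set by blast

lemma cj_less_iff: "lam \<in> partitions \<Longrightarrow> i < cj lam j \<longleftrightarrow> j < lam i"
  by (simp add: cj_def conj_part_less_iff Suc_le_eq)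

lemma cj_partitions:
  assumes "lam \<in> partitions" shows "cj lam \<in> partitions"
proof -
  have "antimono (cj lam)"
  proof (rule antimonoI, rule ccontr)
    fix i j :: nat assume "i \<le> j" "\<not> cj lam j \<le> cj lam i"
    then have "cj lam i < cj lam j" by simp
    then have "j < lam (cj lam i)" using cj_less_iff[OF assms] by blast
    with \<open>i \<le> j\<close> have "i < lam (cj lam i)" by simp
    then have "cj lam i < cj lam i" using cj_less_iff[OF assms] by blast
    then show False by simp
  qed
  moreover have "{i. cj lam i \<noteq> 0} \<subseteq> {..<lam 0}"
    using cj_less_iff[OF assms, of 0] by auto
  ultimately show ?thesis by (auto simp: partitions_def intro: finite_subset)
qed

lemma cj_cj: "lam \<in> partitions \<Longrightarrow> cj (cj lam) = lam"
proof (rule ext)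
  fix i assume l: "lam \<in> partitions"
  have "k < cj (cj lam) i \<longleftrightarrow> k < lam i" for k
    using cj_less_iff[OF cj_partitions[OF l]] cj_less_iff[OF l] by blast
  then show "cj (cj lam) i = lam i" by (meson linorder_neqE_nat less_irrefl)
qed

lemma part_length_eq:
  assumes "lam \<in> partitions" shows "part_length lam = cj lam 0"
  by (simp add: part_length_def cj_def conj_part_def Suc_le_eq)

lemma part_length_cj: "lam \<in> partitions \<Longrightarrow> part_length (cj lam) = lam 0"
  using part_length_eq[OF cj_partitions] cj_cj by metis

text \<open>With indices from 0, conjugation is an involution on one set of sequences. It reindexes
  the sums over partitions in the moments, so that the summation variable becomes the sequence of
  columns.\<close>

lemma bij_betw_cj: "bij_betw cj partitions partitions"
  by (rule bij_betw_byWitness[where f' = cj]) (auto simp: cj_cj cj_partitions)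

lemma part_mult_eq:
  assumes "lam \<in> partitions"
  shows "part_mult lam (Suc i) = cj lam i - cj lam (Suc i)"
proof -
  have "{j. lam j = Suc i} = {j. Suc i \<le> lam j} - {j. Suc (Suc i) \<le> lam j}" by auto
  also have "\<dots> = {cj lam (Suc i)..<cj lam i}"
    using part_ge_set[OF assms] by (auto simp: cj_def)
  finally show ?thesis by (simp add: part_mult_def)
qed

lemma part_size_eq_sum:
  assumes "lam \<in> partitions" "part_length lam \<le> N"
  shows "part_size lam = (\<Sum>i<N. lam i)"
  unfolding part_size_def partitions_support[OF assms(1)]
  by (rule sum.mono_neutral_left) (use assms part_zero_iff in auto)

text \<open>Double counting of the cells of the diagram, weighted by the row index.\<close>

lemma sum_rows_eq_sum_cols:
  fixes f :: "nat \<Rightarrow> nat"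
  assumes "lam \<in> partitions" "part_length lam \<le> n" "lam 0 \<le> N"
  shows "(\<Sum>i<n. f i * lam i) = (\<Sum>j<N. \<Sum>i<cj lam j. f i)"
proof -
  have "(\<Sum>i<n. f i * lam i) = (\<Sum>i<n. \<Sum>j\<in>{j\<in>{..<N}. i < cj lam j}. f i)"
  proof (rule sum.cong[OF refl])
    fix i
    have "lam i \<le> N" using partitions_antimono[OF assms(1), of 0 i] assms(3) by simp
    then have "{j\<in>{..<N}. i < cj lam j} = {..<lam i}" using cj_less_iff[OF assms(1)] by auto
    then show "f i * lam i = (\<Sum>j\<in>{j\<in>{..<N}. i < cj lam j}. f i)" by simp
  qed
  also have "\<dots> = (\<Sum>j<N. \<Sum>i\<in>{i\<in>{..<n}. i < cj lam j}. f i)"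
    by (rule sum.swap_restrict) auto
  also have "\<dots> = (\<Sum>j<N. \<Sum>i<cj lam j. f i)"
  proof (rule sum.cong[OF refl])
    fix j
    have "cj lam j \<le> n"
      using partitions_antimono[OF cj_partitions[OF assms(1)], of 0 j] part_length_eq[OF assms(1)] assms(2)
      by simp
    then have "{i\<in>{..<n}. i < cj lam j} = {..<cj lam j}" by auto
    then show "(\<Sum>i\<in>{i\<in>{..<n}. i < cj lam j}. f i) = (\<Sum>i<cj lam j. f i)" by simp
  qed
  finally show ?thesis .
qed

lemma part_size_cj:
  assumes "lam \<in> partitions" shows "part_size (cj lam) = part_size lam"
proof -
  have "part_size lam = (\<Sum>j<lam 0. \<Sum>i<cj lam j. 1)"
    using part_size_eq_sum[OF assms order_refl]
      sum_rows_eq_sum_cols[OF assms order_refl order_refl, where f = "\<lambda>_. 1"] by simp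
  also have "\<dots> = part_size (cj lam)"
    using part_size_eq_sum[OF cj_partitions[OF assms], of "lam 0"] part_length_cj[OF assms] by simp
  finally show ?thesis by simp
qed

lemma part_n_eq:
  assumes "lam \<in> partitions" "lam 0 \<le> N"
  shows "part_n lam = (\<Sum>i<N. cj lam i choose 2)"
proof -
  have "part_n lam = (\<Sum>i<lam 0. cj lam i choose 2)"
    unfolding part_n_def cj_def
    by (rule sum.reindex_bij_witness[where j = "\<lambda>i. i - 1" and i = Suc]) auto
  also have "\<dots> = (\<Sum>i<N. cj lam i choose 2)"
  proof (rule sum.mono_neutral_left)
    show "\<forall>i\<in>{..<N} - {..<lam 0}. (cj lam i choose 2) = 0"
    proof
      fix i assume "i \<in> {..<N} - {..<lam 0}"
      then have "cj lam i = 0"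
        using part_zero_iff[OF cj_partitions[OF assms(1)]] part_length_cj[OF assms(1)] by auto
      then show "(cj lam i choose 2) = 0" by simp
    qed
  qed (use assms in auto)
  finally show ?thesis .
qed

text \<open>Row \<open>i\<close> weighted by \<open>i\<close> is what the monomial of
  \<open>lam\<close> gives at the point \<open>1, q, q^2, ...\<close>; counted by columns, the same
  weights add up to the binomials of \<open>part_n\<close>.\<close>

lemma part_n_eq_rows:
  assumes "lam \<in> partitions" "part_length lam \<le> n"
  shows "part_n lam = (\<Sum>i<n. i * lam i)"
proof -
  have "(\<Sum>i<k. i) = k choose 2" for k :: nat
    by (induction k) (auto simp: numeral_2_eq_2)
  then show ?thesis
    using sum_rows_eq_sum_cols[OF assms order_refl, where f = "\<lambda>i. i"] part_n_eq[OF assms(1) order_refl]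
    by simp
qed

lemma zero_partition [simp]: "(\<lambda>_. 0) \<in> partitions"
  by (simp add: partitions_def antimono_def)

lemma zero_partition_simps [simp]:
  "part_length (\<lambda>_. 0) = 0" "part_size (\<lambda>_. 0) = 0" "cj (\<lambda>_. 0) = (\<lambda>_. 0)"
  by (auto simp: part_length_def part_size_def cj_def conj_part_def)

lemma part_tl_partition: "lam \<in> partitions \<Longrightarrow> (\<lambda>i. lam (Suc i)) \<in> partitions"
proof -
  assume l: "lam \<in> partitions"
  then have "finite {i. lam i \<noteq> 0}" by (simp add: partitions_def)
  then have "finite (Suc -` {i. lam i \<noteq> 0})" by (rule finite_vimageI) simp
  then have "finite {i. lam (Suc i) \<noteq> 0}" by (simp add: vimage_def)
  with l show ?thesis by (auto simp: partitions_def antimono_def)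
qed

lemma part_tl_length:
  assumes "lam \<in> partitions" shows "part_length (\<lambda>i. lam (Suc i)) = part_length lam - 1"
proof -
  have "{..<part_length (\<lambda>i. lam (Suc i))} = {i. Suc i < part_length lam}"
    using partitions_support[OF part_tl_partition[OF assms]] part_nonzero_iff[OF assms] by auto
  also have "\<dots> = {..<part_length lam - 1}" by auto
  finally show ?thesis by (metis card_lessThan)
qed

lemma part_tl_size:
  assumes "lam \<in> partitions" shows "part_size lam = lam 0 + part_size (\<lambda>i. lam (Suc i))"
proof -
  have "part_size lam = (\<Sum>i<Suc (part_length lam). lam i)"
    by (rule part_size_eq_sum[OF assms]) simp
  also have "\<dots> = lam 0 + (\<Sum>i<part_length lam. lam (Suc i))"
    by (rule sum.lessThan_Suc_shift)
  also have "(\<Sum>i<part_length lam. lam (Suc i)) = part_size (\<lambda>i. lam (Suc i))"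
    using part_size_eq_sum[OF part_tl_partition[OF assms], of "part_length lam"] part_tl_length[OF assms]
    by simp
  finally show ?thesis .
qed

lemma finite_partitions_size: "finite {lam \<in> partitions. part_size lam \<le> n}"
proof -
  have "{lam \<in> partitions. part_size lam \<le> n} \<subseteq>
      {f. \<forall>x. (x \<in> {..<n} \<longrightarrow> f x \<in> {..n}) \<and> (x \<notin> {..<n} \<longrightarrow> f x = 0)}"
  proof
    fix lam assume "lam \<in> {lam \<in> partitions. part_size lam \<le> n}"
    then have l: "lam \<in> partitions" "part_size lam \<le> n" by auto
    have s: "part_size lam = (\<Sum>i<part_length lam. lam i)" by (rule part_size_eq_sum) (use l in auto)
    have "part_length lam = (\<Sum>i<part_length lam. 1)" by simp
    also have "\<dots> \<le> (\<Sum>i<part_length lam. lam i)"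
      using part_nonzero_iff[OF l(1)] by (intro sum_mono) (simp add: Suc_leI)
    finally have len: "part_length lam \<le> n" using s l(2) by simp
    have "lam x \<le> part_size lam" for x
    proof (cases "lam x = 0")
      case False
      then show ?thesis unfolding s using part_nonzero_iff[OF l(1)] by (intro member_le_sum) auto
    qed simp
    then have "lam x \<le> n" for x using l(2) le_trans by blast
    then show "lam \<in> {f. \<forall>x. (x \<in> {..<n} \<longrightarrow> f x \<in> {..n}) \<and> (x \<notin> {..<n} \<longrightarrow> f x = 0)}"
      using part_zero_iff[OF l(1)] len by auto
  qed
  then show ?thesis by (rule finite_subset) (rule finite_set_of_finite_funs; simp)
qed

section \<open>q-factorials and Gaussian binomial coefficients\<close>

lemma qpoch_0 [simp]: "qpoch x q 0 = 1"
  by (simp add: qpoch_def)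

lemma qpoch_Suc: "qpoch x q (Suc n) = qpoch x q n * (1 - x * q ^ n)"
  by (simp add: qpoch_def)

text \<open>Euler's identity is needed in base \<open>q\<close> and in base
  \<open>q\<^sup>2\<close>, the latter because of the denominators of \<open>P_Sym_inf\<close>. In a
  locale the second case is an instance, see \<open>qpar_sq\<close>.\<close>

locale qpar =
  fixes q :: real
  assumes q_pos: "0 < q" and q_less_1: "q < 1"
begin

abbreviation qf :: "nat \<Rightarrow> real" where "qf n \<equiv> qpoch q q n"

lemma qf_Suc: "qf (Suc n) = qf n * (1 - q ^ Suc n)"
  by (simp add: qpoch_Suc)

lemma pow_less_1: "0 < n \<Longrightarrow> q ^ n < 1"
  using q_pos q_less_1 by (simp add: power_less_one_iff)

lemma qf_pos: "qf n > 0"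
proof (induction n)
  case (Suc n)
  then show ?case unfolding qf_Suc by (intro mult_pos_pos) (use pow_less_1[of "Suc n"] in auto)
qed simp

lemma qf_neq_0 [simp]: "qf n \<noteq> 0"
  using qf_pos[of n] by simp

text \<open>The Gaussian binomial coefficient. The value 0 for \<open>k > n\<close> frees the Pascal
  rule of side conditions and allows sums over \<open>k\<close> to be extended by one term.\<close>

definition qb :: "nat \<Rightarrow> nat \<Rightarrow> real" where
  "qb n k = (if k \<le> n then qf n / (qf k * qf (n - k)) else 0)"

lemma qb_0 [simp]: "qb n 0 = 1" and qb_self [simp]: "qb n n = 1" and qb_gt: "n < k \<Longrightarrow> qb n k = 0"
  by (auto simp: qb_def)

lemma qb_Suc: "qb (Suc n) (Suc k) = qb n k + q ^ Suc k * qb n (Suc k)"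
proof -
  consider "n < k" | "n = k" | d where "n = Suc (k + d)"
    by (metis less_iff_Suc_add linorder_neqE_nat)
  then show ?thesis
  proof cases
    case 3
    have nz: "1 - q ^ Suc k \<noteq> 0" "1 - q ^ Suc d \<noteq> 0"
      using pow_less_1[of "Suc k"] pow_less_1[of "Suc d"] by auto
    have e: "1 - q ^ (Suc (Suc (k + d))) = (1 - q ^ Suc k) + q ^ Suc k * (1 - q ^ Suc d)"
      by (simp add: algebra_simps power_add)
    have "qb (Suc n) (Suc k) = qf n * (1 - q ^ (Suc (Suc (k + d)))) / (qf (Suc k) * qf (Suc d))"
      using 3 by (simp add: qb_def qf_Suc)
    also have "\<dots> = qf n / (qf k * qf (Suc d)) + q ^ Suc k * (qf n / (qf (Suc k) * qf d))"
      unfolding e using nz by (simp only: qf_Suc) (simp add: divide_simps del: power_Suc, simp add: algebra_simps)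
    also have "\<dots> = qb n k + q ^ Suc k * qb n (Suc k)"
      using 3 by (simp add: qb_def)
    finally show ?thesis .
  qed (auto simp: qb_def)
qed

lemma qb_sym: "k \<le> n \<Longrightarrow> qb n (n - k) = qb n k"
  by (auto simp: qb_def mult.commute)

text \<open>The two parts of the Pascal rule cancel in the alternating sum.\<close>

lemma qb_alternating_aux:
  "(\<Sum>k\<le>Suc n. (-1) ^ k * q ^ (k choose 2) * qb (Suc n) k) = 0"
proof -
  define g where "g k = (-1) ^ k * q ^ (Suc k choose 2) * qb n k" for k
  have ch: "(Suc k choose 2) = (k choose 2) + k" for k :: nat by (simp add: numeral_2_eq_2)
  have "(\<Sum>k\<le>Suc n. (-1) ^ k * q ^ (k choose 2) * qb (Suc n) k) =
      1 + (\<Sum>k\<le>n. (-1) ^ Suc k * q ^ (Suc k choose 2) * qb (Suc n) (Suc k))"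
    by (subst sum.atMost_Suc_shift) (simp add: numeral_2_eq_2)
  also have "(\<Sum>k\<le>n. (-1) ^ Suc k * q ^ (Suc k choose 2) * qb (Suc n) (Suc k)) =
      (\<Sum>k\<le>n. g (Suc k) - g k)"
    by (rule sum.cong) (simp_all add: g_def qb_Suc ch power_add algebra_simps)
  also have "\<dots> = g (Suc n) - g 0"
  proof -
    have "(\<Sum>k\<le>m. g (Suc k) - g k) = g (Suc m) - g 0" for m by (induction m) auto
    then show ?thesis .
  qed
  also have "\<dots> = -1" by (simp add: g_def qb_gt numeral_2_eq_2)
  finally show ?thesis by simp
qed

lemma qb_alternating:
  assumes "0 < n"
  shows "(\<Sum>k\<le>n. (-1) ^ k * q ^ ((n - k) choose 2) * qb n k) = 0"
proof -
  have "(\<Sum>k\<le>n. (-1) ^ k * q ^ ((n - k) choose 2) * qb n k) =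
     (\<Sum>k\<le>n. (-1) ^ (n - k) * q ^ (k choose 2) * qb n k)"
    by (rule sum.reindex_bij_witness[where i = "\<lambda>k. n - k" and j = "\<lambda>k. n - k"]) (auto simp: qb_sym)
  also have "\<dots> = (\<Sum>k\<le>n. (-1) ^ n * ((-1) ^ k * q ^ (k choose 2) * qb n k))"
    by (rule sum.cong) (auto simp: minus_one_power_iff)
  also have "\<dots> = 0"
    unfolding sum_distrib_left[symmetric] using qb_alternating_aux[of "n - 1"] assms by simp
  finally show ?thesis .
qed

section \<open>Hall--Littlewood polynomials as iterated symmetrisations\<close>

text \<open>Passing from sequences to finite sets of reals builds distinctness and symmetry of the
  variables into the argument. \<open>psi x A\<close> collects the factors of the symmetrisation in
  which \<open>x\<close> precedes all other variables of \<open>A\<close>.\<close>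

definition psi :: "real \<Rightarrow> real set \<Rightarrow> real" where
  "psi x A = (\<Prod>y\<in>A - {x}. (x - q * y) / (x - y))"

text \<open>
  \<open>hlsym as h A\<close> is the symmetrisation over the ways of taking the first variables
  \<open>x\<^sub>1, x\<^sub>2, \<dots>\<close> out of \<open>A\<close>, with exponents \<open>as\<close>, and
  applying \<open>h\<close> to the set of variables that remain.
\<close>

primrec hlsym :: "nat list \<Rightarrow> (real set \<Rightarrow> real) \<Rightarrow> real set \<Rightarrow> real" where
  "hlsym [] h A = h A"
| "hlsym (a # as) h A = (\<Sum>x\<in>A. x ^ a * psi x A * hlsym as h (A - {x}))"

lemma hlsym_append: "hlsym (as @ bs) h A = hlsym as (hlsym bs h) A"
  by (induction as arbitrary: A) auto

lemma hlsym_cong: "(\<And>B. B \<subseteq> A \<Longrightarrow> h B = h' B) \<Longrightarrow> hlsym as h A = hlsym as h' A"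
proof (induction as arbitrary: A)
  case (Cons a as)
  have "hlsym as h (A - {x}) = hlsym as h' (A - {x})" for x by (rule Cons.IH) (use Cons.prems in auto)
  then show ?case by simp
qed simp

lemma hlsym_sum: "hlsym as (\<lambda>A. \<Sum>i\<in>I. c i * h i A) A = (\<Sum>i\<in>I. c i * hlsym as (h i) A)"
proof (induction as arbitrary: A)
  case (Cons a as)
  have "hlsym (a # as) (\<lambda>A. \<Sum>i\<in>I. c i * h i A) A =
      (\<Sum>x\<in>A. \<Sum>i\<in>I. c i * (x ^ a * psi x A * hlsym as (h i) (A - {x})))"
    by (simp add: Cons sum_distrib_left mult.assoc mult.left_commute)
  also have "\<dots> = (\<Sum>i\<in>I. c i * hlsym (a # as) (h i) A)"
    by (subst sum.swap) (simp add: sum_distrib_left)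
  finally show ?case .
qed simp

text \<open>For two variables, \<open>(y - q x) (x - q y) / (x - y)\<close> is antisymmetric.\<close>

lemma hlsym_swap:
  assumes fin: "finite A"
  shows "hlsym (s # Suc s # as) h A = q * hlsym (Suc s # s # as) h A"
proof -
  define D where "D = Sigma A (\<lambda>x. A - {x})"
  define C where "C = (\<lambda>(x, y). x ^ s * y ^ s * (\<Prod>z\<in>A - {x, y}. (x - q * z) / (x - z))
     * (\<Prod>z\<in>A - {x, y}. (y - q * z) / (y - z)) * hlsym as h (A - {x, y}))"
  define T where "T = (\<lambda>(x, y). (x - q * y) / (x - y) * C (x, y))"
  have expand: "hlsym (a # b # as) h A = (\<Sum>(x, y)\<in>D. x ^ a * y ^ b * psi x A * psi y (A - {x}) * hlsym as h (A - {x, y}))"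
    for a b
  proof -
    have d: "A - {x} - {y} = A - {x, y}" for x y by auto
    have "hlsym (a # b # as) h A =
        (\<Sum>x\<in>A. \<Sum>y\<in>A - {x}. x ^ a * y ^ b * psi x A * psi y (A - {x}) * hlsym as h (A - {x, y}))"
      by (simp add: sum_distrib_left d mult_ac)
    also have "\<dots> = (\<Sum>(x, y)\<in>D. x ^ a * y ^ b * psi x A * psi y (A - {x}) * hlsym as h (A - {x, y}))"
      unfolding D_def by (rule sum.Sigma) (use fin in auto)
    finally show ?thesis .
  qed
  have psi2: "x ^ s * y ^ s * psi x A * psi y (A - {x}) * hlsym as h (A - {x, y}) = T (x, y)"
    if "(x, y) \<in> D" for x y
  proof -
    from that have xy: "x \<in> A" "y \<in> A" "x \<noteq> y" by (auto simp: D_def)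
    have "A - {x} = insert y (A - {x, y})" using xy by auto
    then have "psi x A = (x - q * y) / (x - y) * (\<Prod>z\<in>A - {x, y}. (x - q * z) / (x - z))"
      using fin by (simp add: psi_def)
    moreover have "psi y (A - {x}) = (\<Prod>z\<in>A - {x, y}. (y - q * z) / (y - z))"
      by (auto simp: psi_def intro!: prod.cong)
    ultimately show ?thesis by (simp add: T_def C_def mult_ac)
  qed
  have 1: "hlsym (s # Suc s # as) h A = (\<Sum>(x, y)\<in>D. y * T (x, y))"
    unfolding expand by (rule sum.cong) (auto simp: psi2[symmetric] mult_ac)
  have 2: "hlsym (Suc s # s # as) h A = (\<Sum>(x, y)\<in>D. x * T (x, y))"
    unfolding expand by (rule sum.cong) (auto simp: psi2[symmetric] mult_ac)
  define f where "f = (\<lambda>(x, y). (y - q * x) * T (x, y))"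
  have C_sym: "C (y, x) = C (x, y)" for x y
    by (simp add: C_def insert_commute mult_ac)
  have anti: "f (y, x) = - f (x, y)" if "(x, y) \<in> D" for x y
  proof -
    from that have "x \<noteq> y" by (auto simp: D_def)
    then show ?thesis by (simp add: f_def T_def C_sym divide_simps) (simp add: algebra_simps)
  qed
  have "(\<Sum>d\<in>D. f d) = (\<Sum>d\<in>D. f (prod.swap d))"
    by (rule sum.reindex_bij_witness[where i = prod.swap and j = prod.swap]) (auto simp: D_def)
  also have "\<dots> = (\<Sum>d\<in>D. - f d)"
    by (rule sum.cong) (auto simp: anti)
  finally have "(\<Sum>d\<in>D. f d) = 0" by (simp add: sum_negf)
  then have "(\<Sum>(x, y)\<in>D. y * T (x, y)) = q * (\<Sum>(x, y)\<in>D. x * T (x, y))"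
    by (simp add: f_def sum_distrib_left case_prod_unfold algebra_simps sum_subtractf)
  then show ?thesis using 1 2 by simp
qed

text \<open>Each exponent \<open>Suc s\<close> that overtakes \<open>s\<close> costs one factor
  \<open>q\<close>; these factors become the powers of \<open>q\<close> in the Pascal rule.\<close>

lemma hlsym_move:
  "finite A \<Longrightarrow> hlsym (s # replicate k (Suc s) @ as) h A = q ^ k * hlsym (replicate k (Suc s) @ s # as) h A"
proof (induction k arbitrary: A)
  case (Suc k)
  have "hlsym (s # replicate (Suc k) (Suc s) @ as) h A = q * hlsym (Suc s # s # replicate k (Suc s) @ as) h A"
    using hlsym_swap[OF Suc.prems] by simp
  also have "hlsym (Suc s # s # replicate k (Suc s) @ as) h A =
      (\<Sum>x\<in>A. x ^ Suc s * psi x A * (q ^ k * hlsym (replicate k (Suc s) @ s # as) h (A - {x})))"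
    unfolding hlsym.simps(2)[of "Suc s"] using Suc.IH Suc.prems by (intro sum.cong refl) (simp only: finite_Diff)
  also have "\<dots> = q ^ k * hlsym (replicate (Suc k) (Suc s) @ s # as) h A"
    by (simp add: sum_distrib_left mult_ac)
  finally show ?case by simp
qed simp

section \<open>Multiplication by the generating function of the elementary symmetric
  functions\<close>

definition egen :: "real \<Rightarrow> real set \<Rightarrow> real" where
  "egen z A = (\<Prod>x\<in>A. 1 + z * x)"

lemma egen_hlsym1:
  assumes "finite A"
  shows "egen z A * hlsym [a] h A = hlsym [a] (\<lambda>B. egen z B * h B) A + z * hlsym [Suc a] (\<lambda>B. egen z B * h B) A"
proof -
  have "egen z A * hlsym [a] h A = (\<Sum>x\<in>A. egen z (A - {x}) * (1 + z * x) * (x ^ a * psi x A * h (A - {x})))"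
    unfolding hlsym.simps sum_distrib_left
    by (rule sum.cong) (use assms in \<open>auto simp: egen_def prod.remove mult.commute\<close>)
  then show ?thesis by (simp add: sum_distrib_left sum.distrib[symmetric] algebra_simps)
qed

text \<open>Every one of the \<open>m\<close> rows of length \<open>s\<close> is either kept or
  lengthened by one cell. Moving a kept first row behind \<open>k\<close> lengthened ones costs
  \<open>q ^ k\<close>, and the two cases for the first row are the two terms of the Pascal
  rule.\<close>

lemma egen_hlsym_block:
  "finite A \<Longrightarrow> egen z A * hlsym (replicate m s) h A =
     (\<Sum>k\<le>m. z ^ k * qb m k * hlsym (replicate k (Suc s) @ replicate (m - k) s) (\<lambda>B. egen z B * h B) A)"
proof (induction m arbitrary: A)
  case (Suc m)
  let ?H = "\<lambda>B. egen z B * h B"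
  let ?R = "\<lambda>m k. hlsym (replicate k (Suc s) @ replicate (m - k) s) ?H"
  have inner: "hlsym [a] (\<lambda>B. egen z B * hlsym (replicate m s) h B) A = (\<Sum>k\<le>m. z ^ k * qb m k * hlsym [a] (?R m k) A)" for a
    unfolding hlsym_sum[symmetric] by (rule hlsym_cong) (use Suc finite_subset in blast)
  have s0: "hlsym [s] (?R m k) A = q ^ k * ?R (Suc m) k A" if "k \<le> m" for k
    using hlsym_move[OF Suc.prems, of s k "replicate (m - k) s" ?H] that by (simp add: Suc_diff_le)
  have s1: "hlsym [Suc s] (?R m k) A = ?R (Suc m) (Suc k) A" for k
    by simp
  have "egen z A * hlsym (replicate (Suc m) s) h A = egen z A * hlsym [s] (hlsym (replicate m s) h) A"
    by (simp only: replicate_Suc hlsym_append[symmetric] append_Cons append_Nil)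
  also have "\<dots> = (\<Sum>k\<le>m. z ^ k * qb m k * (q ^ k * ?R (Suc m) k A))
      + z * (\<Sum>k\<le>m. z ^ k * qb m k * ?R (Suc m) (Suc k) A)"
    unfolding egen_hlsym1[OF Suc.prems] inner by (simp only: s1) (simp add: s0 del: hlsym.simps)
  also have "(\<Sum>k\<le>m. z ^ k * qb m k * (q ^ k * ?R (Suc m) k A)) =
     ?R (Suc m) 0 A + (\<Sum>k\<le>m. z ^ Suc k * qb m (Suc k) * (q ^ Suc k * ?R (Suc m) (Suc k) A))"
  proof -
    have "(\<Sum>k\<le>m. z ^ k * qb m k * (q ^ k * ?R (Suc m) k A)) =
       (\<Sum>k\<le>Suc m. z ^ k * qb m k * (q ^ k * ?R (Suc m) k A))"
      by (simp add: qb_gt)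
    then show ?thesis by (simp only: sum.atMost_Suc_shift) simp
  qed
  also have "\<dots> + z * (\<Sum>k\<le>m. z ^ k * qb m k * ?R (Suc m) (Suc k) A) =
     ?R (Suc m) 0 A + (\<Sum>k\<le>m. z ^ Suc k * qb (Suc m) (Suc k) * ?R (Suc m) (Suc k) A)"
    unfolding sum_distrib_left add.assoc sum.distrib[symmetric]
    by (intro arg_cong2[where f = "(+)"] refl sum.cong) (simp add: qb_Suc algebra_simps)
  also have "\<dots> = (\<Sum>k\<le>Suc m. z ^ k * qb (Suc m) k * ?R (Suc m) k A)"
    by (subst sum.atMost_Suc_shift) simp
  finally show ?case .
qed simp

text \<open>As innermost function of \<open>hlsym\<close> it demands that all variables have been
  used up, which gives the full symmetrisation. Since \<open>egen z\<close> is 1 on the empty set,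
  multiplication by it stops here.\<close>

definition empty_ind :: "real set \<Rightarrow> real" where
  "empty_ind B = (if B = {} then 1 else 0)"

lemma egen_empty_ind: "egen z B * empty_ind B = empty_ind B"
  by (simp add: empty_ind_def egen_def)

text \<open>
  The partition with columns \<open>c 1 \<ge> c 2 \<ge> \<dots>\<close> in \<open>c 0\<close> variables; the block of
  rows of length \<open>j\<close> has \<open>c j - c (Suc j)\<close> elements.
\<close>

primrec hlblocks :: "(nat \<Rightarrow> nat) \<Rightarrow> nat \<Rightarrow> real set \<Rightarrow> real" where
  "hlblocks c 0 A = hlsym (replicate (c 0 - c 1) 0) empty_ind A"
| "hlblocks c (Suc j) A = hlsym (replicate (c (Suc j) - c (Suc (Suc j))) (Suc j)) (hlblocks c j) A"

lemma hlblocks_cong: "(\<And>i. i \<le> Suc j \<Longrightarrow> c i = d i) \<Longrightarrow> hlblocks c j A = hlblocks d j A"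
proof (induction j arbitrary: A)
  case (Suc j)
  then have "hlblocks c j = hlblocks d j" by auto
  with Suc.prems show ?case by simp
qed simp

text \<open>The columns of the diagrams that arise from \<open>c\<close> by adding a vertical strip:
  \<open>d (Suc i) - c (Suc i)\<close> of the \<open>c i - c (Suc i)\<close> rows of length
  \<open>i\<close> are lengthened. Index 0 holds the number of variables, which stays fixed.\<close>

definition VS :: "(nat \<Rightarrow> nat) \<Rightarrow> nat \<Rightarrow> (nat \<Rightarrow> nat) set" where
  "VS c j = {d. d 0 = c 0 \<and> (\<forall>i\<le>j. c (Suc i) \<le> d (Suc i) \<and> d (Suc i) \<le> c i) \<and> (\<forall>i>Suc j. d i = 0)}"

definition vw :: "real \<Rightarrow> (nat \<Rightarrow> nat) \<Rightarrow> (nat \<Rightarrow> nat) \<Rightarrow> nat \<Rightarrow> real" where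
  "vw z c d j = (\<Prod>i\<le>j. z ^ (d (Suc i) - c (Suc i)) * qb (c i - c (Suc i)) (d (Suc i) - c (Suc i)))"

text \<open>The rows lengthened in the top block have length \<open>Suc j\<close> and no partner
  yet, so they stay in front as a separate \<open>replicate\<close>. In the induction step they join
  the rows of length \<open>Suc j\<close> that are kept.\<close>

lemma egen_hlblocks:
  assumes c: "\<And>i. c (Suc i) \<le> c i" and "finite A"
  shows "egen z A * hlblocks c j A = (\<Sum>d\<in>VS c j. vw z c d j * hlsym (replicate (d (Suc j) - c (Suc j)) (Suc j)) (hlblocks d j) A)"
  using assms(2)
proof (induction j arbitrary: A)
  case 0
  define m where "m = c 0 - c 1"
  define D where "D k = (\<lambda>i :: nat. if i = 0 then c 0 else if i = 1 then c 1 + k else 0 :: nat)" for k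
  have "egen z A * hlblocks c 0 A = (\<Sum>k\<le>m. z ^ k * qb m k * hlsym (replicate k (Suc 0) @ replicate (m - k) 0) empty_ind A)"
    using egen_hlsym_block[OF 0] by (simp add: m_def egen_empty_ind)
  also have "\<dots> = (\<Sum>k\<le>m. vw z c (D k) 0 * hlsym (replicate (D k (Suc 0) - c (Suc 0)) (Suc 0)) (hlblocks (D k) 0) A)"
  proof (rule sum.cong[OF refl])
    fix k
    have "hlblocks (D k) 0 = hlsym (replicate (m - k) 0) empty_ind" by (rule ext) (simp add: D_def m_def)
    then show "z ^ k * qb m k * hlsym (replicate k (Suc 0) @ replicate (m - k) 0) empty_ind A =
        vw z c (D k) 0 * hlsym (replicate (D k (Suc 0) - c (Suc 0)) (Suc 0)) (hlblocks (D k) 0) A"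
      unfolding hlsym_append by (simp add: vw_def m_def D_def)
  qed
  also have "\<dots> = (\<Sum>d\<in>VS c 0. vw z c d 0 * hlsym (replicate (d (Suc 0) - c (Suc 0)) (Suc 0)) (hlblocks d 0) A)"
    by (rule sum.reindex_bij_witness[where j = D and i = "\<lambda>d. d 1 - c 1"])
      (use c[of 0] in \<open>auto simp: VS_def D_def m_def fun_eq_iff\<close>)
  finally show ?case .
next
  case (Suc j)
  define m where "m = c (Suc j) - c (Suc (Suc j))"
  define D where "D = (\<lambda>(d :: nat \<Rightarrow> nat, k). d(Suc (Suc j) := c (Suc (Suc j)) + k))"
  have cS: "c (Suc (Suc j)) + m = c (Suc j)" using c[of "Suc j"] by (simp add: m_def)
  have "egen z A * hlblocks c (Suc j) A =
      (\<Sum>k\<le>m. z ^ k * qb m k * hlsym (replicate k (Suc (Suc j)) @ replicate (m - k) (Suc j)) (\<lambda>B. egen z B * hlblocks c j B) A)"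
    using egen_hlsym_block[OF Suc.prems] by (simp add: m_def)
  also have "\<dots> = (\<Sum>k\<le>m. \<Sum>d\<in>VS c j. vw z c (D (d, k)) (Suc j) *
      hlsym (replicate (D (d, k) (Suc (Suc j)) - c (Suc (Suc j))) (Suc (Suc j))) (hlblocks (D (d, k)) (Suc j)) A)"
  proof (rule sum.cong[OF refl])
    fix k assume k: "k \<in> {..m}"
    have "hlsym (replicate k (Suc (Suc j)) @ replicate (m - k) (Suc j)) (\<lambda>B. egen z B * hlblocks c j B) A =
      hlsym (replicate k (Suc (Suc j)) @ replicate (m - k) (Suc j))
        (\<lambda>B. \<Sum>d\<in>VS c j. vw z c d j * hlsym (replicate (d (Suc j) - c (Suc j)) (Suc j)) (hlblocks d j) B) A"
      by (rule hlsym_cong) (use Suc finite_subset in blast)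
    also have "\<dots> = (\<Sum>d\<in>VS c j. vw z c d j * hlsym (replicate k (Suc (Suc j)) @ replicate (m - k) (Suc j))
        (hlsym (replicate (d (Suc j) - c (Suc j)) (Suc j)) (hlblocks d j)) A)"
      by (rule hlsym_sum)
    finally have 1: "z ^ k * qb m k * hlsym (replicate k (Suc (Suc j)) @ replicate (m - k) (Suc j)) (\<lambda>B. egen z B * hlblocks c j B) A =
       (\<Sum>d\<in>VS c j. z ^ k * qb m k * (vw z c d j * hlsym (replicate k (Suc (Suc j)) @ replicate (m - k) (Suc j))
        (hlsym (replicate (d (Suc j) - c (Suc j)) (Suc j)) (hlblocks d j)) A))"
      by (simp add: sum_distrib_left)
    show "z ^ k * qb m k * hlsym (replicate k (Suc (Suc j)) @ replicate (m - k) (Suc j)) (\<lambda>B. egen z B * hlblocks c j B) A =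
       (\<Sum>d\<in>VS c j. vw z c (D (d, k)) (Suc j) *
      hlsym (replicate (D (d, k) (Suc (Suc j)) - c (Suc (Suc j))) (Suc (Suc j))) (hlblocks (D (d, k)) (Suc j)) A)"
      unfolding 1
    proof (rule sum.cong[OF refl])
      fix d assume d: "d \<in> VS c j"
      let ?d = "D (d, k)"
      have v: "vw z c ?d (Suc j) = vw z c d j * (z ^ k * qb m k)"
        by (simp add: vw_def D_def m_def)
      have dj: "c (Suc j) \<le> d (Suc j)" using d by (simp add: VS_def)
      \<comment> \<open>The \<open>m - k\<close> rows of length \<open>Suc j\<close> that are kept
        and the rows lengthened from \<open>j\<close> to \<open>Suc j\<close> merge into one
        block.\<close>
      have "m - k + (d (Suc j) - c (Suc j)) = ?d (Suc j) - ?d (Suc (Suc j))"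
        using dj k cS by (simp add: D_def)
      moreover have "hlblocks d j = hlblocks ?d j" by (rule ext, rule hlblocks_cong) (simp add: D_def)
      ultimately have "hlsym (replicate (m - k) (Suc j)) (hlsym (replicate (d (Suc j) - c (Suc j)) (Suc j)) (hlblocks d j)) = hlblocks ?d (Suc j)"
        by (intro ext) (simp add: hlsym_append[symmetric] replicate_add[symmetric])
      then have "hlsym (replicate k (Suc (Suc j)) @ replicate (m - k) (Suc j))
          (hlsym (replicate (d (Suc j) - c (Suc j)) (Suc j)) (hlblocks d j)) A = hlsym (replicate k (Suc (Suc j))) (hlblocks ?d (Suc j)) A"
        by (simp add: hlsym_append)
      moreover have "?d (Suc (Suc j)) - c (Suc (Suc j)) = k" by (simp add: D_def)
      ultimately show "z ^ k * qb m k * (vw z c d j * hlsym (replicate k (Suc (Suc j)) @ replicate (m - k) (Suc j))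
        (hlsym (replicate (d (Suc j) - c (Suc j)) (Suc j)) (hlblocks d j)) A) =
        vw z c ?d (Suc j) * hlsym (replicate (?d (Suc (Suc j)) - c (Suc (Suc j))) (Suc (Suc j))) (hlblocks ?d (Suc j)) A"
        unfolding v by simp
    qed
  qed
  also have "\<dots> = (\<Sum>(k, d)\<in>{..m} \<times> VS c j. vw z c (D (d, k)) (Suc j) *
      hlsym (replicate (D (d, k) (Suc (Suc j)) - c (Suc (Suc j))) (Suc (Suc j))) (hlblocks (D (d, k)) (Suc j)) A)"
    by (simp add: sum.cartesian_product)
  also have "\<dots> = (\<Sum>d\<in>VS c (Suc j). vw z c d (Suc j) *
      hlsym (replicate (d (Suc (Suc j)) - c (Suc (Suc j))) (Suc (Suc j))) (hlblocks d (Suc j)) A)"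
  proof (rule sum.reindex_bij_witness[where j = "\<lambda>(k, d). D (d, k)"
        and i = "\<lambda>d. (d (Suc (Suc j)) - c (Suc (Suc j)), d(Suc (Suc j) := 0))"], goal_cases)
    case (1 a) then show ?case by (auto simp: D_def VS_def fun_eq_iff)
  next
    case (2 a) then show ?case using cS by (auto simp: D_def VS_def le_Suc_eq)
  next
    case (3 b) then show ?case by (auto simp: D_def VS_def fun_eq_iff)
  next
    case (4 b) then show ?case using cS by (auto simp: VS_def D_def fun_eq_iff)
  next
    case (5 a) then show ?case by auto
  qed
  finally show ?case .
qed

end

section \<open>From permutations of indices to orderings of a set of variables\<close>

lemma bij_betw_permutes_lists:
  assumes x: "inj_on x {..<n :: nat}"
  shows "bij_betw (\<lambda>w. map (\<lambda>i. x (w i)) [0..<n]) {w. w permutes {..<n}} (permutations_of_set (x ` {..<n}))"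
proof -
  let ?f = "\<lambda>w. map (\<lambda>i. x (w i)) [0..<n]"
  have inj: "inj_on ?f {w. w permutes {..<n}}"
  proof (rule inj_onI, rule ext)
    fix w w' i assume w: "w \<in> {w. w permutes {..<n}}" "w' \<in> {w. w permutes {..<n}}" and e: "?f w = ?f w'"
    show "w i = w' i"
    proof (cases "i < n")
      case True
      then have "x (w i) = x (w' i)" using e by (metis (no_types, lifting) map_eq_conv atLeast_upt lessThan_iff)
      moreover have "w i \<in> {..<n}" "w' i \<in> {..<n}" using w True permutes_in_image by fastforce+
      ultimately show ?thesis using x by (auto dest: inj_onD)
    next
      case False then show ?thesis using w by (simp add: permutes_def)
    qed
  qed
  have sub: "?f ` {w. w permutes {..<n}} \<subseteq> permutations_of_set (x ` {..<n})"
  proof clarify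
    fix w assume w: "w permutes {..<n}"
    have "(\<lambda>i. x (w i)) ` {..<n} = x ` {..<n}"
      using permutes_image[OF w] by (metis image_image)
    moreover have "inj_on (\<lambda>i. x (w i)) {..<n}"
    proof -
      have "inj_on w {..<n}" by (rule permutes_inj_on[OF w])
      then show ?thesis using comp_inj_on[of w "{..<n}" x] x permutes_image[OF w] by (simp add: comp_def)
    qed
    ultimately show "?f w \<in> permutations_of_set (x ` {..<n})"
      by (intro permutations_of_setI) (simp_all add: distinct_map atLeast0LessThan)
  qed
  have "card (?f ` {w. w permutes {..<n}}) = fact n"
    using card_image[OF inj] card_permutations[of "{..<n}" n] by simp
  moreover have "card (permutations_of_set (x ` {..<n})) = fact n"
    using card_image[OF x] by simp
  ultimately have "?f ` {w. w permutes {..<n}} = permutations_of_set (x ` {..<n})"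
    by (intro card_subset_eq sub) auto
  with inj show ?thesis by (simp add: bij_betw_def)
qed

context qpar
begin

primrec lw :: "nat list \<Rightarrow> real list \<Rightarrow> real" where
  "lw [] L = 1"
| "lw (a # as) L = hd L ^ a * (\<Prod>y\<in>set (tl L). (hd L - q * y) / (hd L - y)) * lw as (tl L)"

text \<open>Grouping the orderings of \<open>A\<close> by their first element reproduces the
  recursion of \<open>hlsym\<close>.\<close>

lemma hlsym_eq_sum_lw:
  "finite A \<Longrightarrow> length as = card A \<Longrightarrow> hlsym as empty_ind A = (\<Sum>L\<in>permutations_of_set A. lw as L)"
proof (induction as arbitrary: A)
  case Nil then show ?case by (simp add: empty_ind_def)
next
  case (Cons a as)
  then have ne: "A \<noteq> {}" by auto
  have "(\<Sum>L\<in>permutations_of_set A. lw (a # as) L) =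
     (\<Sum>x\<in>A. \<Sum>L\<in>(#) x ` permutations_of_set (A - {x}). lw (a # as) L)"
    unfolding permutations_of_set_nonempty[OF ne]
    by (rule sum.UNION_disjoint) (use Cons in auto)
  also have "\<dots> = (\<Sum>x\<in>A. x ^ a * psi x A * (\<Sum>L\<in>permutations_of_set (A - {x}). lw as L))"
    by (rule sum.cong[OF refl], subst sum.reindex)
      (auto simp: sum_distrib_left psi_def permutations_of_setD intro!: sum.cong)
  also have "\<dots> = hlsym (a # as) empty_ind A"
    using Cons by (auto intro!: sum.cong)
  finally show ?case by simp
qed

lemma lw_eq_prod:
  "distinct L \<Longrightarrow> (\<Prod>i<length L. (L ! i) ^ lam i) *
     (\<Prod>j<length L. \<Prod>i<j. (L ! i - q * L ! j) / (L ! i - L ! j)) = lw (map lam [0..<length L]) L"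
proof (induction L arbitrary: lam)
  case (Cons x L)
  let ?f = "\<lambda>i j. (L ! i - q * L ! j) / (L ! i - L ! j)"
  have m: "map lam [0..<length (x # L)] = lam 0 # map (\<lambda>i. lam (Suc i)) [0..<length L]"
    by (simp add: map_upt_Suc del: upt_Suc)
  have p: "(\<Prod>j<length L. (x - q * L ! j) / (x - L ! j)) = (\<Prod>y\<in>set L. (x - q * y) / (x - y))"
    using Cons.prems
    by (subst prod.reindex_bij_betw[OF bij_betw_nth[of L "{..<length L}" "set L"], symmetric]) auto
  have "(\<Prod>j<length (x # L). \<Prod>i<j. ((x # L) ! i - q * (x # L) ! j) / ((x # L) ! i - (x # L) ! j)) =
      (\<Prod>j<length L. (x - q * L ! j) / (x - L ! j) * (\<Prod>i<j. ?f i j))"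
    by (simp only: length_Cons prod.lessThan_Suc_shift) (simp add: comp_def del: prod.lessThan_Suc)
  also have "\<dots> = (\<Prod>y\<in>set L. (x - q * y) / (x - y)) * (\<Prod>j<length L. \<Prod>i<j. ?f i j)"
    by (simp only: prod.distrib p)
  finally show ?case
    unfolding m using Cons.IH[of "\<lambda>i. lam (Suc i)"] Cons.prems
    by (simp add: prod.lessThan_Suc_shift mult_ac del: prod.lessThan_Suc upt_Suc)
qed simp

text \<open>The polynomial \<open>P_lam\<close> as a function of the set of its variables, whose
  number is \<open>card A\<close>. Identities of symmetric functions become identities for all
  finite \<open>A\<close>.\<close>

definition PA :: "(nat \<Rightarrow> nat) \<Rightarrow> real set \<Rightarrow> real" where
  "PA lam A = (if part_length lam \<le> card A
     then hlsym (map lam [0..<card A]) empty_ind A / hl_v q (card A) lam else 0)"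

lemma hl_P_eq:
  assumes x: "inj_on x {..<n}"
  shows "hl_P q n lam x = PA lam (x ` {..<n})"
proof -
  have c: "card (x ` {..<n}) = n" using card_image[OF x] by simp
  have "(\<Sum>w | w permutes {..<n}. (\<Prod>i<n. x (w i) ^ lam i) *
           (\<Prod>j<n. \<Prod>i<j. (x (w i) - q * x (w j)) / (x (w i) - x (w j)))) =
        (\<Sum>w | w permutes {..<n}. lw (map lam [0..<n]) (map (\<lambda>i. x (w i)) [0..<n]))"
  proof (rule sum.cong[OF refl])
    fix w assume "w \<in> {w. w permutes {..<n}}"
    then have "map (\<lambda>i. x (w i)) [0..<n] \<in> permutations_of_set (x ` {..<n})"
      using bij_betw_permutes_lists[OF x] by (auto simp: bij_betw_def)
    then have "distinct (map (\<lambda>i. x (w i)) [0..<n])" by (rule permutations_of_setD)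
    from lw_eq_prod[OF this, of lam]
    show "(\<Prod>i<n. x (w i) ^ lam i) * (\<Prod>j<n. \<Prod>i<j. (x (w i) - q * x (w j)) / (x (w i) - x (w j)))
        = lw (map lam [0..<n]) (map (\<lambda>i. x (w i)) [0..<n])" by simp
  qed
  also have "\<dots> = (\<Sum>L\<in>permutations_of_set (x ` {..<n}). lw (map lam [0..<n]) L)"
    by (rule sum.reindex_bij_betw[OF bij_betw_permutes_lists[OF x]])
  also have "\<dots> = hlsym (map lam [0..<n]) empty_ind (x ` {..<n})"
    using hlsym_eq_sum_lw[of "x ` {..<n}" "map lam [0..<n]"] c by simp
  finally show ?thesis by (simp add: hl_P_def PA_def c)
qed

lemma exists_enumeration:
  assumes "finite (A :: real set)"
  obtains x where "inj_on x {..<card A}" "x ` {..<card A} = A"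
proof -
  obtain h where "bij_betw h {0..<card A} A" using ex_bij_betw_nat_finite[OF assms] by blast
  then show ?thesis using that by (auto simp: bij_betw_def atLeast0LessThan)
qed

text \<open>With the number of variables as column 0, the zero parts form one more block, of size
  \<open>n - part_length lam\<close>, and all blocks can be treated alike.\<close>

definition cc :: "nat \<Rightarrow> (nat \<Rightarrow> nat) \<Rightarrow> nat \<Rightarrow> nat" where
  "cc n lam i = (if i = 0 then n else cj lam (i - 1))"

lemma cc_simps [simp]: "cc n lam 0 = n" "cc n lam (Suc i) = cj lam i"
  by (simp_all add: cc_def)

lemma cj_antimono: "lam \<in> partitions \<Longrightarrow> i \<le> j \<Longrightarrow> cj lam j \<le> cj lam i"
  by (rule partitions_antimono[OF cj_partitions])

lemma cj_zero_iff: "lam \<in> partitions \<Longrightarrow> cj lam i = 0 \<longleftrightarrow> lam 0 \<le> i"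
  using part_zero_iff[OF cj_partitions] part_length_cj by metis

lemma cc_Suc_le: "lam \<in> partitions \<Longrightarrow> part_length lam \<le> n \<Longrightarrow> cc n lam (Suc i) \<le> cc n lam i"
  by (cases i) (auto simp: part_length_eq cj_antimono)

lemma hlsym_rows_hlblocks_aux:
  assumes "lam \<in> partitions" "part_length lam \<le> n"
  shows "hlblocks (cc n lam) j A = hlsym (map lam [cj lam j..<n]) empty_ind A"
proof (induction j arbitrary: A)
  case 0
  have "map lam [cj lam 0..<n] = replicate (n - cj lam 0) 0"
    using part_zero_iff[OF assms(1)] part_length_eq[OF assms(1)]
    by (intro replicate_eqI) auto
  then show ?case by simp
next
  case (Suc j)
  have m: "cj lam (Suc j) \<le> cj lam j" "cj lam j \<le> n"
    using cj_antimono[OF assms(1)] part_length_eq[OF assms(1)] assms(2)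
    by (auto intro: le_trans[OF cj_antimono[OF assms(1), of 0 j]])
  have "map lam [cj lam (Suc j)..<cj lam j] = replicate (cj lam j - cj lam (Suc j)) (Suc j)"
  proof (rule replicate_eqI)
    fix y assume "y \<in> set (map lam [cj lam (Suc j)..<cj lam j])"
    then obtain i where "y = lam i" "cj lam (Suc j) \<le> i" "i < cj lam j" by auto
    then show "y = Suc j" using cj_less_iff[OF assms(1), of i j] cj_less_iff[OF assms(1), of i "Suc j"] by simp
  qed simp
  moreover have "[cj lam (Suc j)..<n] = [cj lam (Suc j)..<cj lam j] @ [cj lam j..<n]"
    using m upt_add_eq_append[of "cj lam (Suc j)" "cj lam j" "n - cj lam j"] by simp
  moreover have "hlblocks (cc n lam) j = hlsym (map lam [cj lam j..<n]) empty_ind" by (rule ext) (rule Suc)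
  ultimately show ?case by (simp add: hlsym_append)
qed

lemma hlsym_rows_hlblocks:
  assumes "lam \<in> partitions" "part_length lam \<le> n" "lam 0 \<le> N"
  shows "hlsym (map lam [0..<n]) empty_ind A = hlblocks (cc n lam) N A"
  using hlsym_rows_hlblocks_aux[OF assms(1,2), of N A] cj_zero_iff[OF assms(1), of N] assms(3) by simp

lemma sum_telescope_antimono:
  fixes c :: "nat \<Rightarrow> nat"
  assumes "\<And>i. c (Suc i) \<le> c i" shows "(\<Sum>i\<le>N. c i - c (Suc i)) + c (Suc N) = c 0"
proof (induction N)
  case (Suc N) then show ?case using assms[of "Suc N"] by simp
qed (use assms[of 0] in simp)

section \<open>The Pieri rules\<close>

text \<open>The exponents of \<open>1 - q\<close> telescope to \<open>n\<close>, independently of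
  \<open>lam\<close>, so these powers cancel whenever two normalisations in the same variables are
  compared.\<close>

lemma hl_v_eq:
  assumes lam: "lam \<in> partitions" and "part_length lam \<le> n" "lam 0 \<le> N"
  shows "hl_v q n lam = (\<Prod>i\<le>N. qf (cc n lam i - cc n lam (Suc i))) / (1 - q) ^ n"
proof -
  let ?D = "\<lambda>i. cc n lam i - cc n lam (Suc i)"
  have "hl_v q n lam = qf (?D 0) / (1 - q) ^ (?D 0) * (\<Prod>i<lam 0. qf (?D (Suc i)) / (1 - q) ^ ?D (Suc i))"
    unfolding hl_v_def part_length_eq[OF lam]
    by (intro arg_cong2[where f = "(*)"] prod.reindex_bij_witness[where j = "\<lambda>i. i - 1" and i = Suc])
      (auto simp: part_mult_eq[OF lam] Suc_le_eq gr0_conv_Suc)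
  also have "\<dots> = (\<Prod>i<Suc (lam 0). qf (?D i) / (1 - q) ^ ?D i)"
    by (rule prod.lessThan_Suc_shift[symmetric])
  also have "\<dots> = (\<Prod>i\<le>N. qf (?D i) / (1 - q) ^ ?D i)"
  proof (rule prod.mono_neutral_left)
    show "\<forall>i\<in>{..N} - {..<Suc (lam 0)}. qf (?D i) / (1 - q) ^ ?D i = 1"
    proof
      fix i assume "i \<in> {..N} - {..<Suc (lam 0)}"
      then have "lam 0 < i" by auto
      then obtain k where k: "i = Suc k" "lam 0 \<le> k" by (cases i) auto
      then have "cj lam k = 0" using cj_zero_iff[OF lam] by simp
      then have "?D i = 0" using k by simp
      then show "qf (?D i) / (1 - q) ^ ?D i = 1" by simp
    qed
  qed (use assms in auto)
  also have "\<dots> = (\<Prod>i\<le>N. qf (?D i)) / (1 - q) ^ (\<Sum>i\<le>N. ?D i)"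
    by (simp add: prod_dividef power_sum)
  also have "(\<Sum>i\<le>N. ?D i) = n"
    using sum_telescope_antimono[of "cc n lam" N] cc_Suc_le[OF assms(1,2)] cj_zero_iff[OF lam, of N] assms(3) by simp
  finally show ?thesis .
qed

lemma hl_v_pos:
  assumes "lam \<in> partitions" "part_length lam \<le> n" shows "hl_v q n lam > 0"
  unfolding hl_v_eq[OF assms order_refl]
  by (intro divide_pos_pos prod_pos) (use q_less_1 qf_pos in auto)

lemma hl_b_eq:
  assumes lam: "lam \<in> partitions" and "lam 0 \<le> N"
  shows "hl_b q lam = (\<Prod>i<N. qf (cj lam i - cj lam (Suc i)))"
proof -
  have "hl_b q lam = (\<Prod>i<lam 0. qf (cj lam i - cj lam (Suc i)))"
    unfolding hl_b_def
    by (rule prod.reindex_bij_witness[where j = "\<lambda>i. i - 1" and i = Suc])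
      (auto simp: part_mult_eq[OF lam] Suc_le_eq gr0_conv_Suc)
  also have "\<dots> = (\<Prod>i<N. qf (cj lam i - cj lam (Suc i)))"
  proof (rule prod.mono_neutral_left)
    show "\<forall>i\<in>{..<N} - {..<lam 0}. qf (cj lam i - cj lam (Suc i)) = 1"
    proof
      fix i assume "i \<in> {..<N} - {..<lam 0}"
      then have "cj lam i = 0" using cj_zero_iff[OF lam] by auto
      then show "qf (cj lam i - cj lam (Suc i)) = 1" by simp
    qed
  qed (use assms in auto)
  finally show ?thesis .
qed

lemma hl_b_pos: "lam \<in> partitions \<Longrightarrow> hl_b q lam > 0"
  unfolding hl_b_eq[OF _ order_refl] by (intro prod_pos) (use qf_pos in auto)

definition VSP :: "(nat \<Rightarrow> nat) \<Rightarrow> (nat \<Rightarrow> nat) set" where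
  "VSP mu = {lam \<in> partitions. \<forall>i. cj mu i \<le> cj lam i \<and> cj lam (Suc i) \<le> cj mu i}"

text \<open>The classical coefficient of the Pieri rule for elementary symmetric functions: among
  the rows of \<open>lam\<close> of each length it counts, with weight in \<open>q\<close>, the
  choices of those that arose by lengthening.\<close>

definition vs :: "(nat \<Rightarrow> nat) \<Rightarrow> (nat \<Rightarrow> nat) \<Rightarrow> real" where
  "vs lam mu = (\<Prod>i<lam 0. qb (cj lam i - cj lam (Suc i)) (cj lam i - cj mu i))"

lemma vs_eq:
  assumes lam: "lam \<in> partitions" and "lam 0 \<le> N"
  shows "vs lam mu = (\<Prod>i<N. qb (cj lam i - cj lam (Suc i)) (cj lam i - cj mu i))"
  unfolding vs_def
proof (rule prod.mono_neutral_left)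
  show "\<forall>i\<in>{..<N} - {..<lam 0}. qb (cj lam i - cj lam (Suc i)) (cj lam i - cj mu i) = 1"
  proof
    fix i assume "i \<in> {..<N} - {..<lam 0}"
    then have "cj lam i = 0" using cj_zero_iff[OF lam] by auto
    then show "qb (cj lam i - cj lam (Suc i)) (cj lam i - cj mu i) = 1" by simp
  qed
qed (use assms in auto)

lemma VSP_0_le:
  assumes "mu \<in> partitions" "lam \<in> VSP mu" shows "lam 0 \<le> Suc (mu 0)"
proof -
  have "cj lam (Suc (mu 0)) \<le> cj mu (mu 0)" using assms by (simp add: VSP_def)
  also have "\<dots> = 0" using cj_zero_iff[OF assms(1)] by simp
  finally show ?thesis using cj_zero_iff[of lam "Suc (mu 0)"] assms(2) by (simp add: VSP_def)
qed

lemma part_size_eq_cj: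
  assumes "lam \<in> partitions" "lam 0 \<le> N" shows "part_size lam = (\<Sum>i<N. cj lam i)"
  using part_size_eq_sum[OF cj_partitions[OF assms(1)], of N] part_length_cj[OF assms(1)]
    part_size_cj[OF assms(1)] assms(2) by simp

lemma VSP_size:
  assumes "mu \<in> partitions" "lam \<in> VSP mu" shows "part_size mu \<le> part_size lam"
proof -
  have "part_size mu = (\<Sum>i<Suc (mu 0). cj mu i)" by (rule part_size_eq_cj[OF assms(1)]) simp
  also have "\<dots> \<le> (\<Sum>i<Suc (mu 0). cj lam i)" by (rule sum_mono) (use assms(2) in \<open>simp add: VSP_def\<close>)
  also have "\<dots> = part_size lam"
    by (rule part_size_eq_cj[symmetric]) (use assms VSP_0_le[OF assms] in \<open>auto simp: VSP_def\<close>)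
  finally show ?thesis .
qed

text \<open>Division by \<open>hl_v\<close> changes the point of view: the binomials of
  \<open>vw\<close> choose the rows of \<open>mu\<close> to be lengthened, and the ratio of the
  normalisations turns them into the binomials of \<open>vs\<close>, which choose among the rows of
  \<open>lam\<close>.\<close>

lemma Pieri_egen:
  assumes mu: "mu \<in> partitions" and fin: "finite A"
  shows "egen z A * PA mu A = (\<Sum>lam | lam \<in> VSP mu \<and> part_length lam \<le> card A.
     z ^ (part_size lam - part_size mu) * vs lam mu * PA lam A)"
proof (cases "part_length mu \<le> card A")
  case False
  have "{lam. lam \<in> VSP mu \<and> part_length lam \<le> card A} = {}"
  proof safe
    fix lam assume l: "lam \<in> VSP mu" "part_length lam \<le> card A"
    then have "cj mu 0 \<le> cj lam 0" by (simp add: VSP_def)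
    with l False show "lam \<in> {}" using part_length_eq[OF mu] part_length_eq[of lam] by (simp add: VSP_def)
  qed
  with False show ?thesis by (simp only: PA_def if_False sum.empty mult_zero_right)
next
  case len: True
  define n where "n = card A"
  define N where "N = mu 0"
  define c where "c = cc n mu"
  define cols where "cols d = cj (\<lambda>i. d (Suc i))" for d :: "nat \<Rightarrow> nat"
  have cdec: "c (Suc i) \<le> c i" for i unfolding c_def using cc_Suc_le[OF mu] len n_def by blast
  have cz: "c (Suc i) = 0" if "N \<le> i" for i using cj_zero_iff[OF mu] that by (simp add: c_def N_def)
  have dpart: "(\<lambda>i. d (Suc i)) \<in> partitions" if "d \<in> VS c N" for d
  proof -
    have d: "c (Suc i) \<le> d (Suc i)" "d (Suc i) \<le> c i" if "i \<le> N" for i using that \<open>d \<in> VS c N\<close> by (auto simp: VS_def)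
    have z: "d i = 0" if "i > Suc N" for i using that \<open>d \<in> VS c N\<close> by (auto simp: VS_def)
    have "d (Suc (Suc i)) \<le> d (Suc i)" for i
      using d(1)[of i] d(2)[of "Suc i"] z[of "Suc (Suc i)"] by (cases "Suc i \<le> N") auto
    then have "antimono (\<lambda>i. d (Suc i))" by (simp add: antimono_iff_le_Suc)
    moreover have "{i. d (Suc i) \<noteq> 0} \<subseteq> {..Suc N}" using z by (auto intro: ccontr)
    ultimately show ?thesis by (auto simp: partitions_def intro: finite_subset)
  qed
  have cjcols: "cj (cols d) i = d (Suc i)" if "d \<in> VS c N" for d i
    using cj_cj[OF dpart[OF that]] by (simp add: cols_def)
  have colsp: "cols d \<in> partitions" if "d \<in> VS c N" for d
    unfolding cols_def by (rule cj_partitions[OF dpart[OF that]])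
  have ccd: "cc n (cols d) = d" if "d \<in> VS c N" for d
  proof
    fix i show "cc n (cols d) i = d i" using cjcols[OF that] that by (cases i) (auto simp: VS_def c_def)
  qed
  have bij: "bij_betw cols (VS c N) {lam. lam \<in> VSP mu \<and> part_length lam \<le> n}"
  proof (rule bij_betw_byWitness[where f' = "cc n"])
    show "\<forall>d\<in>VS c N. cc n (cols d) = d" using ccd by blast
    show "\<forall>lam\<in>{lam. lam \<in> VSP mu \<and> part_length lam \<le> n}. cols (cc n lam) = lam"
      by (auto simp: cols_def VSP_def cj_cj)
    show "cols ` VS c N \<subseteq> {lam. lam \<in> VSP mu \<and> part_length lam \<le> n}"
    proof clarify
      fix d assume d: "d \<in> VS c N"
      have "cj mu i \<le> d (Suc i) \<and> d (Suc (Suc i)) \<le> cj mu i" for i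
      proof -
        have "c (Suc i) \<le> d (Suc i)"
          using d cz[of i] by (cases "i \<le> N") (auto simp: VS_def)
        moreover have "d (Suc (Suc i)) \<le> c (Suc i)"
          using d by (cases "Suc i \<le> N") (auto simp: VS_def)
        ultimately show ?thesis by (simp add: c_def)
      qed
      moreover have "d (Suc 0) \<le> n" using d by (auto simp: VS_def c_def)
      ultimately show "cols d \<in> VSP mu \<and> part_length (cols d) \<le> n"
        using d by (simp add: VSP_def colsp cjcols part_length_eq)
    qed
    show "cc n ` {lam. lam \<in> VSP mu \<and> part_length lam \<le> n} \<subseteq> VS c N"
    proof clarify
      fix lam assume l: "lam \<in> VSP mu" "part_length lam \<le> n"
      have "cc n lam (Suc i) \<le> c i" for i
        using l part_length_eq[of lam] by (cases i) (auto simp: VSP_def c_def)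
      moreover have "cc n lam i = 0" if "Suc N < i" for i
        using that cj_zero_iff[of lam "i - 1"] l VSP_0_le[OF mu, of lam] by (auto simp: VSP_def N_def cc_def)
      ultimately show "cc n lam \<in> VS c N"
        using l by (auto simp: VS_def c_def VSP_def)
    qed
  qed
  have v_mu: "hl_v q n mu = (\<Prod>i\<le>N. qf (c i - c (Suc i))) / (1 - q) ^ n"
    unfolding c_def by (rule hl_v_eq[OF mu]) (use len in \<open>auto simp: n_def N_def\<close>)
  have term_eq: "vw z c d N / hl_v q n mu * hlblocks d (Suc N) A =
      z ^ (part_size (cols d) - part_size mu) * vs (cols d) mu * PA (cols d) A" if d: "d \<in> VS c N" for d
  proof -
    have cl: "cols d \<in> VSP mu" "part_length (cols d) \<le> n" using bij d by (auto simp: bij_betw_def)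
    have l0: "cols d 0 \<le> Suc N" using VSP_0_le[OF mu cl(1)] by (simp add: N_def)
    have dd: "c (Suc i) \<le> d (Suc i)" "d (Suc i) \<le> c i" if "i \<le> N" for i using d that by (auto simp: VS_def)
    have d0: "d 0 = c 0" and dz: "d (Suc (Suc N)) = 0" using d by (auto simp: VS_def)
    have PAd: "PA (cols d) A = hlblocks d (Suc N) A / hl_v q n (cols d)"
      using hlsym_rows_hlblocks[OF colsp[OF d] cl(2) l0, of A] cl(2) ccd[OF d] by (simp add: PA_def n_def del: hlblocks.simps)
    have v_d: "hl_v q n (cols d) = (\<Prod>i\<le>Suc N. qf (d i - d (Suc i))) / (1 - q) ^ n"
      using hl_v_eq[OF colsp[OF d] cl(2) l0] ccd[OF d] by simp
    have vsd: "vs (cols d) mu = (\<Prod>i\<le>N. qb (d (Suc i) - d (Suc (Suc i))) (d (Suc i) - c (Suc i)))"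
      using vs_eq[OF colsp[OF d] l0, of mu] by (simp add: cjcols[OF d] c_def lessThan_Suc_atMost)
    have size: "(\<Sum>i\<le>N. d (Suc i) - c (Suc i)) = part_size (cols d) - part_size mu"
    proof -
      have "(\<Sum>i\<le>N. d (Suc i) - c (Suc i)) + (\<Sum>i\<le>N. c (Suc i)) = (\<Sum>i\<le>N. d (Suc i))"
        unfolding sum.distrib[symmetric] by (rule sum.cong) (use dd in auto)
      moreover have "part_size (cols d) = (\<Sum>i\<le>N. d (Suc i))"
        using part_size_eq_cj[OF colsp[OF d] l0] by (simp add: cjcols[OF d] lessThan_Suc_atMost)
      moreover have "part_size mu = (\<Sum>i\<le>N. c (Suc i))"
        using part_size_eq_cj[OF mu, of "Suc N"] by (simp add: N_def c_def lessThan_Suc_atMost)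
      ultimately show ?thesis by simp
    qed
    define k where "k i = d (Suc i) - c (Suc i)" for i
    \<comment> \<open>Both products of binomials have the same denominators up to the boundary
      factor: \<open>k i\<close> lengthened and \<open>c i - d (Suc i)\<close> kept rows of length
      \<open>i\<close>. Only the numerators differ, and these are the normalisations of
      \<open>mu\<close> and of \<open>cols d\<close>.\<close>
    have 1: "(\<Prod>i\<le>N. qb (c i - c (Suc i)) (k i)) =
       (\<Prod>i\<le>N. qf (c i - c (Suc i))) / ((\<Prod>i\<le>N. qf (k i)) * (\<Prod>i\<le>N. qf (c i - d (Suc i))))"
      unfolding prod_dividef[symmetric] prod.distrib[symmetric]
      by (rule prod.cong) (use dd in \<open>auto simp: qb_def k_def intro: diff_le_mono\<close>)
    have 2: "vs (cols d) mu = (\<Prod>i\<le>N. qf (d (Suc i) - d (Suc (Suc i)))) /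
        ((\<Prod>i\<le>N. qf (k i)) * (\<Prod>i\<le>N. qf (c (Suc i) - d (Suc (Suc i)))))"
      unfolding vsd prod_dividef[symmetric] prod.distrib[symmetric]
    proof (rule prod.cong[OF refl])
      fix i assume i: "i \<in> {..N}"
      have "d (Suc (Suc i)) \<le> c (Suc i)"
      proof (cases "i = N")
        case False then show ?thesis using dd(2)[of "Suc i"] i by simp
      qed (simp add: dz)
      moreover have "c (Suc i) \<le> d (Suc i)" using dd(1) i by simp
      ultimately show "qb (d (Suc i) - d (Suc (Suc i))) (d (Suc i) - c (Suc i)) =
         qf (d (Suc i) - d (Suc (Suc i))) / (qf (k i) * qf (c (Suc i) - d (Suc (Suc i))))"
        by (auto simp: qb_def k_def)
    qed
    have 3: "(\<Prod>i\<le>Suc N. qf (d i - d (Suc i))) = qf (d 0 - d 1) * (\<Prod>i\<le>N. qf (d (Suc i) - d (Suc (Suc i))))"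
      by (subst prod.atMost_Suc_shift) simp
    have 4: "(\<Prod>i\<le>N. qf (c i - d (Suc i))) = qf (d 0 - d 1) * (\<Prod>i\<le>N. qf (c (Suc i) - d (Suc (Suc i))))"
    proof -
      have "(\<Prod>i\<le>N. qf (c i - d (Suc i))) = (\<Prod>i\<le>Suc N. qf (c i - d (Suc i)))"
        using cz[of N] dz by simp
      then show ?thesis by (subst (asm) prod.atMost_Suc_shift) (simp add: d0)
    qed
    have vw_eq: "vw z c d N = z ^ (part_size (cols d) - part_size mu) * (\<Prod>i\<le>N. qb (c i - c (Suc i)) (k i))"
      by (simp add: vw_def prod.distrib k_def size[symmetric] power_sum)
    have nz: "(\<Prod>i\<in>I. qf (f i)) \<noteq> 0" if "finite I" for f and I :: "nat set"
      using that by simp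
    have "vw z c d N / hl_v q n mu = z ^ (part_size (cols d) - part_size mu) * vs (cols d) mu / hl_v q n (cols d)"
      unfolding vw_eq v_mu v_d 1 2 3 4 using nz q_less_1
      by (simp add: divide_simps)
    then show ?thesis unfolding PAd by (simp only: times_divide_eq_right times_divide_eq_left)
  qed
  have PAmu: "PA mu A = hlblocks c N A / hl_v q n mu"
    using hlsym_rows_hlblocks[OF mu, of n N A] len by (simp add: PA_def n_def N_def c_def)
  have "egen z A * hlblocks c N A = (\<Sum>d\<in>VS c N. vw z c d N * hlblocks d (Suc N) A)"
    unfolding egen_hlblocks[of c, OF cdec fin]
  proof (rule sum.cong[OF refl])
    fix d assume "d \<in> VS c N"
    then have "d (Suc (Suc N)) = 0" by (auto simp: VS_def)
    then show "vw z c d N * hlsym (replicate (d (Suc N) - c (Suc N)) (Suc N)) (hlblocks d N) A = vw z c d N * hlblocks d (Suc N) A"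
      using cz[of N] by simp
  qed
  then have "egen z A * PA mu A = (\<Sum>d\<in>VS c N. vw z c d N / hl_v q n mu * hlblocks d (Suc N) A)"
    unfolding PAmu by (simp add: sum_divide_distrib)
  also have "\<dots> = (\<Sum>d\<in>VS c N. z ^ (part_size (cols d) - part_size mu) * vs (cols d) mu * PA (cols d) A)"
    by (rule sum.cong) (use term_eq in auto)
  also have "\<dots> = (\<Sum>lam | lam \<in> VSP mu \<and> part_length lam \<le> n. z ^ (part_size lam - part_size mu) * vs lam mu * PA lam A)"
    by (rule sum.reindex_bij_betw[OF bij])
  finally show ?thesis by (simp add: n_def)
qed

text \<open>
  Lagrange interpolation of \<open>\<Prod>(t - q y) - \<Prod>(t - y)\<close> at the points of \<open>A\<close>,
  evaluated at \<open>t = 0\<close>.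
\<close>

lemma sum_psi_nonzero:
  assumes fin: "finite A" and "A \<noteq> {}" and A0: "0 \<notin> A"
  shows "(1 - q) * (\<Sum>x\<in>A. psi x A) = 1 - q ^ card A"
proof -
  define n where "n = card A"
  have n0: "n > 0" using assms by (simp add: n_def card_gt_0_iff)
  define p1 where "p1 = (\<Prod>y\<in>A. [:- (q * y), 1:])"
  define p2 where "p2 = (\<Prod>y\<in>A. [:- y, 1:])"
  define R where "R = (\<Sum>x\<in>A. smult ((1 - q) * x * psi x A) (\<Prod>y\<in>A - {x}. [:- y, 1:]))"
  have d1: "degree p1 = n" "coeff p1 n = 1" and d2: "degree p2 = n" "coeff p2 n = 1"
  proof -
    show *: "degree p1 = n" unfolding p1_def n_def by (subst degree_prod_eq_sum_degree) auto
    have "lead_coeff p1 = 1" unfolding p1_def by (simp add: lead_coeff_prod)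
    then show "coeff p1 n = 1" using * by simp
    show *: "degree p2 = n" unfolding p2_def n_def by (subst degree_prod_eq_sum_degree) auto
    have "lead_coeff p2 = 1" unfolding p2_def by (simp add: lead_coeff_prod)
    then show "coeff p2 n = 1" using * by simp
  qed
  have deg: "degree (p1 - p2) < n"
  proof (rule ccontr)
    assume "\<not> degree (p1 - p2) < n"
    moreover have "degree (p1 - p2) \<le> n" using d1 d2 by (intro degree_diff_le) auto
    ultimately have e: "degree (p1 - p2) = n" by simp
    have "coeff (p1 - p2) n = 0" using d1 d2 by simp
    then have "lead_coeff (p1 - p2) = 0" unfolding e .
    then have "p1 - p2 = 0" by (simp only: leading_coeff_0_iff)
    then show False using e n0 by (metis degree_0 less_irrefl)
  qed
  have degR: "degree R < n"
  proof -
    have "degree (\<Prod>y\<in>A - {x}. [:- y, 1:]) \<le> n - 1" if "x \<in> A" for x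
      by (subst degree_prod_eq_sum_degree) (use that fin in \<open>auto simp: n_def\<close>)
    then have "degree R \<le> n - 1"
      unfolding R_def using fin by (intro degree_sum_le) (auto intro: order_trans[OF degree_smult_le])
    then show ?thesis using n0 by simp
  qed
  have "p1 - p2 = R"
  proof (rule poly_eqI_degree)
    fix t assume t: "t \<in> A"
    have p2t: "poly p2 t = 0" using t fin by (simp add: p2_def poly_prod)
    have p1t: "poly p1 t = (1 - q) * t * (\<Prod>y\<in>A - {t}. t - q * y)"
      using t fin by (simp add: p1_def poly_prod prod.remove[of A t] algebra_simps)
    have z: "poly (\<Prod>y\<in>A - {x}. [:- y, 1:]) t = 0" if "x \<in> A - {t}" for x
      unfolding poly_prod using fin t that by (intro prod_zero) auto
    have "poly R t = (\<Sum>x\<in>A. (1 - q) * x * psi x A * poly (\<Prod>y\<in>A - {x}. [:- y, 1:]) t)"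
      by (simp add: R_def poly_sum)
    also have "\<dots> = (1 - q) * t * psi t A * (\<Prod>y\<in>A - {t}. t - y)"
    proof -
      have "(\<Sum>x\<in>A - {t}. (1 - q) * x * psi x A * poly (\<Prod>y\<in>A - {x}. [:- y, 1:]) t) = 0"
        by (rule sum.neutral) (use z in simp)
      moreover have "poly (\<Prod>y\<in>A - {t}. [:- y, 1:]) t = (\<Prod>y\<in>A - {t}. t - y)" by (simp add: poly_prod)
      ultimately show ?thesis by (simp only: sum.remove[OF fin t] add_0_right)
    qed
    also have "\<dots> = (1 - q) * t * (\<Prod>y\<in>A - {t}. t - q * y)"
      using fin by (simp add: psi_def prod_dividef)
    finally show "poly (p1 - p2) t = poly R t" by (simp add: p1t p2t)
  qed (use deg degR in \<open>auto simp: n_def\<close>)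
  then have "poly (p1 - p2) 0 = poly R 0" by simp
  moreover have "poly (p1 - p2) 0 = (q ^ n - 1) * (\<Prod>y\<in>A. - y)"
  proof -
    have "poly p1 0 = (\<Prod>y\<in>A. q * - y)" by (simp add: p1_def poly_prod)
    also have "\<dots> = q ^ n * (\<Prod>y\<in>A. - y)" by (simp only: prod.distrib prod_constant n_def)
    finally have "poly p1 0 = q ^ n * (\<Prod>y\<in>A. - y)" .
    moreover have "poly p2 0 = (\<Prod>y\<in>A. - y)" by (simp add: p2_def poly_prod)
    ultimately show ?thesis by (simp only: poly_diff left_diff_distrib mult_1)
  qed
  moreover have "poly R 0 = - (1 - q) * (\<Sum>x\<in>A. psi x A) * (\<Prod>y\<in>A. - y)"
  proof -
    have "poly R 0 = (\<Sum>x\<in>A. (1 - q) * psi x A * (x * (\<Prod>y\<in>A - {x}. - y)))"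
      by (simp add: R_def poly_sum poly_prod mult_ac)
    also have "\<dots> = (\<Sum>x\<in>A. (1 - q) * psi x A * (- (\<Prod>y\<in>A. - y)))"
      by (rule sum.cong) (simp_all add: prod.remove[OF fin])
    also have "\<dots> = (\<Sum>x\<in>A. (- (1 - q) * (\<Prod>y\<in>A. - y)) * psi x A)"
      by (rule sum.cong) (simp_all only: mult_minus_left mult_minus_right mult_ac)
    finally show ?thesis by (simp only: sum_distrib_left[symmetric] sum_distrib_right[symmetric] mult_ac)
  qed
  moreover have "(\<Prod>y\<in>A. - y) \<noteq> 0" using A0 fin by auto
  ultimately show ?thesis by (simp add: n_def) (simp add: algebra_simps)
qed

text \<open>The interpolation argument divides by the product of the variables, so a variable 0 is
  split off: \<open>psi 0 A\<close> is \<open>q\<close> to the number of the others, and 0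
  contributes the factor 1 to every other \<open>psi x A\<close>.\<close>

lemma sum_psi:
  assumes fin: "finite A" and ne: "A \<noteq> {}"
  shows "(1 - q) * (\<Sum>x\<in>A. psi x A) = 1 - q ^ card A"
proof (cases "0 \<in> A")
  case True
  define B where "B = A - {0}"
  have A: "A = insert 0 B" "0 \<notin> B" "finite B" using True fin by (auto simp: B_def)
  have p0: "psi 0 A = q ^ card B" 
  proof -
    have "A - {0} = B" using A by auto
    moreover have "(\<Prod>y\<in>B. (0 - q * y) / (0 - y)) = (\<Prod>y\<in>B. q)"
      using A by (intro prod.cong) auto
    ultimately show ?thesis by (simp add: psi_def)
  qed
  have px: "psi x A = psi x B" if "x \<in> B" for x
  proof -
    have "A - {x} = insert 0 (B - {x})" using A that by auto
    then show ?thesis using A that by (auto simp: psi_def)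
  qed
  have "(\<Sum>x\<in>A. psi x A) = q ^ card B + (\<Sum>x\<in>B. psi x B)" using A p0 px by (simp add: sum.insert)
  moreover have "(1 - q) * (\<Sum>x\<in>B. psi x B) = 1 - q ^ card B"
    using sum_psi_nonzero[of B] A by (cases "B = {}") auto
  ultimately have "(1 - q) * (\<Sum>x\<in>A. psi x A) = (1 - q) * q ^ card B + (1 - q ^ card B)"
    by (simp only: distrib_left)
  also have "\<dots> = 1 - q ^ card A" using A by (simp add: algebra_simps)
  finally show ?thesis .
qed (use sum_psi_nonzero assms in blast)

text \<open>Symmetrising the constant 1 gives the q-factorial, one q-integer from
  \<open>sum_psi\<close> for each variable taken. This is the reason for the normalisation
  \<open>hl_v\<close>: it makes \<open>P\<close> of the empty partition equal to 1.\<close>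

lemma hlsym_replicate_0: "finite A \<Longrightarrow> card A = n \<Longrightarrow> hlsym (replicate n 0) empty_ind A = qf n / (1 - q) ^ n"
proof (induction n arbitrary: A)
  case 0 then show ?case by (simp add: empty_ind_def)
next
  case (Suc n)
  have "hlsym (replicate (Suc n) 0) empty_ind A = (\<Sum>x\<in>A. psi x A) * (qf n / (1 - q) ^ n)"
    unfolding sum_distrib_right replicate_Suc hlsym.simps by (rule sum.cong) (use Suc in auto)
  also have "(\<Sum>x\<in>A. psi x A) = (1 - q ^ Suc n) / (1 - q)"
  proof -
    have "A \<noteq> {}" using Suc.prems by auto
    then show ?thesis using sum_psi[of A] Suc.prems q_less_1 by (simp add: field_simps)
  qed
  finally show ?case by (simp add: qf_Suc mult.commute)
qed

lemma PA_zero [simp]: "finite A \<Longrightarrow> PA (\<lambda>_. 0) A = 1"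
proof -
  assume "finite A"
  moreover have "map (\<lambda>_. 0) [0..<card A] = replicate (card A) (0 :: nat)" by (simp add: map_replicate_const)
  moreover have "hl_v q n (\<lambda>_. 0) = qf n / (1 - q) ^ n" for n by (simp add: hl_v_def)
  ultimately show ?thesis using hlsym_replicate_0[of A "card A"] q_less_1 by (simp add: PA_def)
qed

definition col1 :: "nat \<Rightarrow> nat \<Rightarrow> nat" where
  "col1 r i = (if i < r then 1 else 0)"

lemma col1_partition: "col1 r \<in> partitions"
proof -
  have "{i. col1 r i \<noteq> 0} \<subseteq> {..<r}" by (auto simp: col1_def)
  then show ?thesis by (auto simp: partitions_def antimono_def col1_def intro: finite_subset)
qed

lemma cj_col1: "cj (col1 r) i = (if i = 0 then r else 0)"
proof -
  have "j < cj (col1 r) i \<longleftrightarrow> j < (if i = 0 then r else 0)" for j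
    using cj_less_iff[OF col1_partition] by (auto simp: col1_def)
  then have "{..<cj (col1 r) i} = {..<(if i = 0 then r else 0)}" by (simp only: set_eq_iff lessThan_iff) simp
  then show ?thesis by (metis card_lessThan)
qed

lemma col1_simps [simp]: "part_length (col1 r) = r" "part_size (col1 r) = r"
  using part_length_eq[OF col1_partition, of r] part_size_eq_cj[OF col1_partition, of r 1]
  by (simp_all add: cj_col1) (simp add: col1_def)

lemma VSP_zero: "VSP (\<lambda>_. 0) = range col1"
proof
  show "range col1 \<subseteq> VSP (\<lambda>_. 0)" by (auto simp: VSP_def col1_partition cj_col1)
  show "VSP (\<lambda>_. 0) \<subseteq> range col1"
  proof
    fix lam assume "lam \<in> VSP (\<lambda>_. 0)"
    then have l: "lam \<in> partitions" "\<And>i. cj lam (Suc i) = 0" by (auto simp: VSP_def)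
    have "cj lam = cj (col1 (cj lam 0))"
    proof
      fix i show "cj lam i = cj (col1 (cj lam 0)) i" using l(2) by (cases i) (auto simp: cj_col1)
    qed
    then have "lam = col1 (cj lam 0)" using cj_cj l(1) col1_partition by metis
    then show "lam \<in> range col1" by blast
  qed
qed

lemma vs_col1: "vs (col1 r) (\<lambda>_. 0) = 1"
  using vs_eq[OF col1_partition, of r 1 "\<lambda>_. 0"] by (simp add: cj_col1) (simp add: col1_def)

text \<open>The Pieri identity for the empty partition, where all coefficients are 1. It identifies
  \<open>PA (col1 r)\<close> as the elementary symmetric function of degree
  \<open>r\<close>.\<close>

lemma egen_eq_sum:
  assumes "finite A" shows "egen z A = (\<Sum>r\<le>card A. z ^ r * PA (col1 r) A)"
proof -
  have inj: "inj_on col1 {..card A}" by (rule inj_onI) (metis col1_simps(1))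
  have "{lam. lam \<in> VSP (\<lambda>_. 0) \<and> part_length lam \<le> card A} = col1 ` {..card A}"
    unfolding VSP_zero by auto
  then show ?thesis
    using Pieri_egen[OF zero_partition assms, of z] assms by (simp add: sum.reindex[OF inj] vs_col1)
qed

definition VSr :: "(nat \<Rightarrow> nat) \<Rightarrow> nat \<Rightarrow> (nat \<Rightarrow> nat) set" where
  "VSr mu r = {lam \<in> VSP mu. part_size lam = part_size mu + r}"

lemma finite_VSr: "finite (VSr mu r)"
  by (rule finite_subset[OF _ finite_partitions_size[of "part_size mu + r"]]) (auto simp: VSr_def VSP_def)

lemma finite_VSP_length:
  assumes "mu \<in> partitions" shows "finite {lam \<in> VSP mu. part_length lam \<le> n}"
proof (rule finite_subset[OF _ finite_partitions_size])
  show "{lam \<in> VSP mu. part_length lam \<le> n} \<subseteq> {lam \<in> partitions. part_size lam \<le> (\<Sum>i<n. Suc (mu 0))}"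
  proof clarify
    fix lam assume l: "lam \<in> VSP mu" "part_length lam \<le> n"
    have lp: "lam \<in> partitions" using l by (simp add: VSP_def)
    have "part_size lam = (\<Sum>i<n. lam i)" by (rule part_size_eq_sum[OF lp l(2)])
    also have "\<dots> \<le> (\<Sum>i<n. Suc (mu 0))"
      by (rule sum_mono) (use VSP_0_le[OF assms l(1)] partitions_antimono[OF lp] in \<open>blast intro: le_trans\<close>)
    finally show "lam \<in> partitions \<and> part_size lam \<le> (\<Sum>i<n. Suc (mu 0))" using lp by blast
  qed
qed

text \<open>Comparison of the coefficients of \<open>z ^ r\<close> in \<open>Pieri_egen\<close>. The
  bound on the number of parts disappears because \<open>PA lam A\<close> vanishes beyond it, so the
  index set no longer depends on \<open>A\<close>.\<close>

lemma Pieri: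
  assumes mu: "mu \<in> partitions" and fin: "finite A"
  shows "PA (col1 r) A * PA mu A = (\<Sum>lam\<in>VSr mu r. vs lam mu * PA lam A)"
proof -
  define X where "X = {lam \<in> VSP mu. part_length lam \<le> card A}"
  have finX: "finite X" unfolding X_def by (rule finite_VSP_length[OF mu])
  \<comment> \<open>Large enough to bound the degrees in \<open>z\<close> on both sides and to
    include the index \<open>r\<close>.\<close>
  define D where "D = card A + r + (\<Sum>lam\<in>X. part_size lam)"
  define b where "b k = (\<Sum>lam | lam \<in> X \<and> part_size lam - part_size mu = k. vs lam mu * PA lam A)" for k
  have "(\<Sum>k\<le>D. (PA (col1 k) A * PA mu A) * z ^ k) = (\<Sum>k\<le>D. b k * z ^ k)" for z
  proof -
    have "(\<Sum>k\<le>D. (PA (col1 k) A * PA mu A) * z ^ k) = (\<Sum>k\<le>card A. (PA (col1 k) A * PA mu A) * z ^ k)"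
      by (rule sum.mono_neutral_right) (auto simp: D_def PA_def)
    also have "\<dots> = egen z A * PA mu A"
      unfolding egen_eq_sum[OF fin] sum_distrib_right by (rule sum.cong) (auto simp: mult_ac)
    also have "\<dots> = (\<Sum>lam\<in>X. z ^ (part_size lam - part_size mu) * vs lam mu * PA lam A)"
      unfolding Pieri_egen[OF mu fin] X_def by (rule sum.cong) auto
    also have "\<dots> = (\<Sum>k\<le>D. \<Sum>lam | lam \<in> X \<and> part_size lam - part_size mu = k.
        z ^ (part_size lam - part_size mu) * vs lam mu * PA lam A)"
    proof (rule sum.group[symmetric, where g = "\<lambda>lam. part_size lam - part_size mu", simplified])
      show "(\<lambda>lam. part_size lam - part_size mu) ` X \<subseteq> {..D}"
      proof clarsimp
        fix lam assume "lam \<in> X"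
        then have "part_size lam \<le> (\<Sum>lam\<in>X. part_size lam)" using finX by (intro member_le_sum) auto
        then show "part_size lam - part_size mu \<le> D" by (simp add: D_def)
      qed
    qed (use finX in auto)
    also have "\<dots> = (\<Sum>k\<le>D. b k * z ^ k)"
      by (rule sum.cong[OF refl]) (auto simp: b_def sum_distrib_right sum_distrib_left mult_ac intro!: sum.cong)
    finally show ?thesis .
  qed
  then have "\<forall>k\<le>D. PA (col1 k) A * PA mu A = b k"
    using polyfun_eq_coeffs[of "\<lambda>k. PA (col1 k) A * PA mu A" D b] by blast
  then have "PA (col1 r) A * PA mu A = b r" by (simp add: D_def)
  also have "\<dots> = (\<Sum>lam\<in>VSr mu r. vs lam mu * PA lam A)"
    unfolding b_def
  proof (rule sum.mono_neutral_left[OF finite_VSr])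
    show "{lam. lam \<in> X \<and> part_size lam - part_size mu = r} \<subseteq> VSr mu r"
      using VSP_size[OF mu] by (fastforce simp: X_def VSr_def)
    show "\<forall>lam\<in>VSr mu r - {lam. lam \<in> X \<and> part_size lam - part_size mu = r}. vs lam mu * PA lam A = 0"
      by (auto simp: VSr_def X_def PA_def)
  qed
  finally show ?thesis .
qed

text \<open>The coefficients for multiplication by the complete symmetric functions.\<close>

definition sk :: "(nat \<Rightarrow> nat) \<Rightarrow> (nat \<Rightarrow> nat) \<Rightarrow> real" where
  "sk lam mu = (if \<forall>i. cj mu i \<le> cj lam i then
     \<Prod>i<lam 0. q ^ ((cj lam i - cj mu i) choose 2) * qb (cj lam i - cj mu (Suc i)) (cj lam i - cj mu i) else 0)"

lemma sk_eq:
  assumes lam: "lam \<in> partitions" and "lam 0 \<le> N" and le: "\<And>i. cj mu i \<le> cj lam i"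
  shows "sk lam mu = (\<Prod>i<N. q ^ ((cj lam i - cj mu i) choose 2) * qb (cj lam i - cj mu (Suc i)) (cj lam i - cj mu i))"
    (is "_ = prod ?f _")
proof -
  have "prod ?f {..<lam 0} = prod ?f {..<N}"
  proof (rule prod.mono_neutral_left)
    show "\<forall>i\<in>{..<N} - {..<lam 0}. ?f i = 1"
    proof
      fix i assume "i \<in> {..<N} - {..<lam 0}"
      then have "cj lam i = 0" using cj_zero_iff[OF lam] by auto
      then show "?f i = 1" by (simp add: numeral_2_eq_2)
    qed
  qed (use assms in auto)
  then show ?thesis using le by (simp add: sk_def)
qed

definition part_add :: "(nat \<Rightarrow> nat) \<Rightarrow> nat \<Rightarrow> (nat \<Rightarrow> nat) set" where
  "part_add mu m = {lam \<in> partitions. part_size lam = part_size mu + m}"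

lemma finite_part_add: "finite (part_add mu m)"
  by (rule finite_subset[OF _ finite_partitions_size[of "part_size mu + m"]]) (auto simp: part_add_def)

lemma cj_inject: "lam \<in> partitions \<Longrightarrow> mu \<in> partitions \<Longrightarrow> cj lam = cj mu \<Longrightarrow> lam = mu"
  using cj_cj by metis

text \<open>
  After rewriting the binomials, the summand is a product in which \<open>rho\<^sub>i\<close> occurs in
  the \<open>i\<close>-th factor only, so the sum is a product of alternating \<open>q\<close>-binomial sums.
\<close>

lemma vs_sk_inverse:
  assumes mu: "mu \<in> partitions" and lam: "lam \<in> partitions"
  shows "(\<Sum>rho | rho \<in> VSP mu \<and> (\<forall>i. cj rho i \<le> cj lam i).
      (-1) ^ (part_size rho - part_size mu) * vs rho mu * sk lam rho) = (if lam = mu then 1 else 0)"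
proof (cases "\<forall>i. cj mu i \<le> cj lam i")
  case False
  then have "lam \<noteq> mu" by auto
  moreover have "{rho. rho \<in> VSP mu \<and> (\<forall>i. cj rho i \<le> cj lam i)} = {}"
    using False by (auto simp: VSP_def intro: le_trans)
  ultimately show ?thesis by (simp only: sum.empty if_False)
next
  case True
  \<comment> \<open>One index beyond the last column of \<open>lam\<close>: the factor that is
    pushed out at the end by the index shift below is then 1.\<close>
  define N where "N = Suc (lam 0)"
  \<comment> \<open>The bounds on \<open>cj rho i\<close> refer to \<open>lam\<close> and
    \<open>mu\<close> only, not to other columns of \<open>rho\<close>; hence the strips in question
    form a product of intervals.\<close>
  define u where "u i = (if i = 0 then cj lam 0 else min (cj lam i) (cj mu (i - 1)))" for i
  define f where "f i k = (-1) ^ (k - cj mu i) * q ^ ((cj lam i - k) choose 2) * qb (cj lam i - cj mu i) (k - cj mu i)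
      * (if i = 0 then 1 else qb (cj lam (i - 1) - k) (cj lam (i - 1) - cj mu (i - 1)))" for i k
  define X where "X = {rho. rho \<in> VSP mu \<and> (\<forall>i. cj rho i \<le> cj lam i)}"
  have lz: "cj lam i = 0" if "N \<le> i" for i using that cj_zero_iff[OF lam] by (simp add: N_def)
  have mz: "cj mu i = 0" if "N \<le> i" for i using that lz True by (metis le_zero_eq)
  have term_eq: "(-1) ^ (part_size rho - part_size mu) * vs rho mu * sk lam rho = (\<Prod>i<N. f i (cj rho i))"
    if rho: "rho \<in> X" for rho
  proof -
    have rp: "rho \<in> partitions" and r: "cj mu i \<le> cj rho i" "cj rho (Suc i) \<le> cj mu i" "cj rho i \<le> cj lam i" for i
      using rho by (auto simp: X_def VSP_def)
    have rz: "cj rho N = 0" using r(3)[of N] lz[of N] by simp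
    then have r0: "rho 0 \<le> N" using cj_zero_iff[OF rp] by blast
    have m0: "mu 0 \<le> N" using mz[of N] cj_zero_iff[OF mu] by blast
    have "(\<Sum>i<N. cj rho i - cj mu i) + (\<Sum>i<N. cj mu i) = (\<Sum>i<N. cj rho i)"
      unfolding sum.distrib[symmetric] by (rule sum.cong) (use r in auto)
    then have size: "part_size rho - part_size mu = (\<Sum>i<N. cj rho i - cj mu i)"
      using part_size_eq_cj[OF rp r0] part_size_eq_cj[OF mu m0] by simp
    let ?g = "\<lambda>i. qb (cj lam i - cj rho (Suc i)) (cj lam i - cj mu i)"
    have fac: "qb (cj rho i - cj rho (Suc i)) (cj rho i - cj mu i) * qb (cj lam i - cj rho (Suc i)) (cj lam i - cj rho i)
       = qb (cj lam i - cj mu i) (cj rho i - cj mu i) * ?g i" for i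
    proof -
      have "cj rho (Suc i) \<le> cj mu i" "cj mu i \<le> cj rho i" "cj rho i \<le> cj lam i" using r by auto
      then show ?thesis by (simp add: qb_def diff_le_mono2)
    qed
    have shift: "(\<Prod>i<N. ?g i) = (\<Prod>i<N. if i = 0 then 1 else ?g (i - 1))"
    proof (cases N)
      case (Suc M)
      have "cj lam M = 0" using Suc cj_zero_iff[OF lam] by (simp add: N_def)
      then have "?g M = 1" by simp
      then have "(\<Prod>i<N. ?g i) = (\<Prod>i<M. ?g i)" using Suc by simp
      also have "\<dots> = (\<Prod>i<N. if i = 0 then 1 else ?g (i - 1))"
        unfolding Suc by (simp only: prod.lessThan_Suc_shift) simp
      finally show ?thesis .
    qed simp
    have "(-1) ^ (part_size rho - part_size mu) * vs rho mu * sk lam rho =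
       (\<Prod>i<N. (-1) ^ (cj rho i - cj mu i) * (qb (cj rho i - cj rho (Suc i)) (cj rho i - cj mu i) *
          (q ^ ((cj lam i - cj rho i) choose 2) * qb (cj lam i - cj rho (Suc i)) (cj lam i - cj rho i))))"
      unfolding size power_sum vs_eq[OF rp r0] prod.distrib
      by (subst sk_eq[OF lam, of N]) (use r(3) in \<open>auto simp: prod.distrib N_def\<close>)
    also have "\<dots> = (\<Prod>i<N. (-1) ^ (cj rho i - cj mu i) * q ^ ((cj lam i - cj rho i) choose 2) *
          qb (cj lam i - cj mu i) (cj rho i - cj mu i) * ?g i)"
      by (rule prod.cong[OF refl]) (use fac in \<open>simp add: mult_ac\<close>)
    also have "\<dots> = (\<Prod>i<N. f i (cj rho i))"
      unfolding prod.distrib shift f_def by (intro arg_cong2[where f = "(*)"] refl prod.cong) auto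
    finally show ?thesis .
  qed
  have mu_u: "cj mu i \<le> u i" for i
    using True cj_antimono[OF mu, of "i - 1" i] by (auto simp: u_def)
  have bij: "bij_betw (\<lambda>rho. restrict (cj rho) {..<N}) X (PiE {..<N} (\<lambda>i. {cj mu i..u i}))"
  proof (rule bij_betw_byWitness[where f' = "\<lambda>g. cj (\<lambda>i. if i < N then g i else 0)"])
    show "\<forall>rho\<in>X. cj (\<lambda>i. if i < N then restrict (cj rho) {..<N} i else 0) = rho"
    proof
      fix rho assume rho: "rho \<in> X"
      have "(\<lambda>i. if i < N then restrict (cj rho) {..<N} i else 0) = cj rho"
      proof
        fix i show "(if i < N then restrict (cj rho) {..<N} i else 0) = cj rho i"
          using lz[of i] rho by (auto simp: X_def) (metis le_zero_eq linorder_not_less)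
      qed
      then show "cj (\<lambda>i. if i < N then restrict (cj rho) {..<N} i else 0) = rho"
        using cj_cj[of rho] rho by (simp add: X_def VSP_def)
    qed
    have key: "(\<lambda>i. if i < N then g i else 0) \<in> partitions \<and> cj (\<lambda>i. if i < N then g i else 0) \<in> X \<and>
        cj (cj (\<lambda>i. if i < N then g i else 0)) = (\<lambda>i. if i < N then g i else 0)"
      if g: "g \<in> PiE {..<N} (\<lambda>i. {cj mu i..u i})" for g
    proof -
      let ?h = "\<lambda>i. if i < N then g i else 0"
      have h: "cj mu i \<le> ?h i" "?h (Suc i) \<le> cj mu i" "?h i \<le> cj lam i" for i
      proof -
        have b: "cj mu j \<le> g j" "g j \<le> u j" if "j < N" for j
          using PiE_mem[OF g, of j] that by simp_all
        show "cj mu i \<le> ?h i" using b(1)[of i] mz[of i] by auto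
        show "?h (Suc i) \<le> cj mu i" using b(2)[of "Suc i"] by (auto simp: u_def)
        show "?h i \<le> cj lam i" using b(2)[of i] by (auto simp: u_def split: if_splits)
      qed
      have "?h (Suc i) \<le> ?h i" for i using h(2)[of i] h(1)[of i] by (rule le_trans)
      then have "antimono ?h" by (simp add: antimono_iff_le_Suc)
      moreover have "{i. ?h i \<noteq> 0} \<subseteq> {..<N}" by (auto split: if_splits)
      then have "finite {i. ?h i \<noteq> 0}" by (rule finite_subset) simp
      ultimately have hp: "?h \<in> partitions" by (simp add: partitions_def)
      have cc: "cj (cj ?h) = ?h" by (rule cj_cj[OF hp])
      have "cj ?h \<in> X" using h cj_partitions[OF hp] by (simp only: X_def VSP_def mem_Collect_eq cc) blast
      with hp cc show ?thesis by blast
    qed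
    show "\<forall>g\<in>PiE {..<N} (\<lambda>i. {cj mu i..u i}). restrict (cj (cj (\<lambda>i. if i < N then g i else 0))) {..<N} = g"
    proof
      fix g assume g: "g \<in> PiE {..<N} (\<lambda>i. {cj mu i..u i})"
      show "restrict (cj (cj (\<lambda>i. if i < N then g i else 0))) {..<N} = g"
        using key[OF g] PiE_arb[OF g] by (auto simp: fun_eq_iff restrict_def)
    qed
    show "(\<lambda>rho. restrict (cj rho) {..<N}) ` X \<subseteq> PiE {..<N} (\<lambda>i. {cj mu i..u i})"
    proof clarify
      fix rho assume rho: "rho \<in> X"
      have "cj rho i \<le> u i" for i
        using rho by (cases i) (auto simp: X_def VSP_def u_def)
      then show "restrict (cj rho) {..<N} \<in> PiE {..<N} (\<lambda>i. {cj mu i..u i})"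
        using rho by (auto simp: X_def VSP_def)
    qed
    show "(\<lambda>g. cj (\<lambda>i. if i < N then g i else 0)) ` PiE {..<N} (\<lambda>i. {cj mu i..u i}) \<subseteq> X"
      using key by blast
  qed
  have "(\<Sum>rho\<in>X. (-1) ^ (part_size rho - part_size mu) * vs rho mu * sk lam rho) = (\<Sum>rho\<in>X. \<Prod>i<N. f i (restrict (cj rho) {..<N} i))"
    by (rule sum.cong) (auto simp: term_eq)
  also have "\<dots> = (\<Sum>g\<in>PiE {..<N} (\<lambda>i. {cj mu i..u i}). \<Prod>i<N. f i (g i))"
    by (rule sum.reindex_bij_betw[OF bij])
  also have "\<dots> = (\<Prod>i<N. \<Sum>k\<in>{cj mu i..u i}. f i k)"
    by (rule prod_sum_PiE[symmetric]) auto
  also have "\<dots> = (if lam = mu then 1 else 0)"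
  proof (cases "lam = mu")
    case True
    have "(\<Sum>k\<in>{cj mu i..u i}. f i k) = 1" for i
    proof -
      have "u i = cj mu i" using True cj_antimono[OF mu, of "i - 1" i] by (auto simp: u_def)
      then show ?thesis using True by (simp add: f_def numeral_2_eq_2)
    qed
    with True show ?thesis by simp
  next
    case False
    then have "cj lam \<noteq> cj mu" using cj_inject lam mu by blast
    then have ex: "\<exists>i. cj lam i \<noteq> cj mu i" by auto
    define i where "i = (LEAST i. cj lam i \<noteq> cj mu i)"
    have i: "cj lam i \<noteq> cj mu i" unfolding i_def by (rule LeastI_ex[OF ex])
    have less: "cj lam j = cj mu j" if "j < i" for j using not_less_Least that unfolding i_def by blast
    have iN: "i < N" using i lz[of i] mz[of i] by (metis linorder_not_less)
    \<comment> \<open>Minimality of \<open>i\<close> makes the interval complete and the shifted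
      binomial in \<open>f i\<close> equal to 1, which leaves the alternating q-binomial
      sum.\<close>
    have ui: "u i = cj lam i"
      using less[of "i - 1"] cj_antimono[OF lam, of "i - 1" i] by (cases i) (auto simp: u_def)
    have fi: "f i k = (-1) ^ (k - cj mu i) * q ^ ((cj lam i - k) choose 2) * qb (cj lam i - cj mu i) (k - cj mu i)" for k
      using less[of "i - 1"] by (cases i) (auto simp: f_def)
    have "(\<Sum>k\<in>{cj mu i..u i}. f i k) = (\<Sum>k\<le>cj lam i - cj mu i. (-1) ^ k * q ^ ((cj lam i - cj mu i - k) choose 2) * qb (cj lam i - cj mu i) k)"
      unfolding fi ui
      by (rule sum.reindex_bij_witness[where j = "\<lambda>k. k - cj mu i" and i = "\<lambda>k. k + cj mu i"])
        (use spec[OF True, of i] in auto)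
    also have "\<dots> = 0" by (rule qb_alternating) (use i spec[OF True, of i] in simp)
    finally have "(\<Prod>i<N. \<Sum>k\<in>{cj mu i..u i}. f i k) = 0" using iN by (intro prod_zero) auto
    with False show ?thesis by simp
  qed
  finally show ?thesis unfolding X_def .
qed

lemma cj_le_size:
  assumes "mu \<in> partitions" "lam \<in> partitions" "\<And>i. cj mu i \<le> cj lam i"
  shows "part_size mu \<le> part_size lam"
proof -
  define N where "N = lam 0 + mu 0"
  have "part_size mu = (\<Sum>i<N. cj mu i)" "part_size lam = (\<Sum>i<N. cj lam i)"
    by (rule part_size_eq_cj; simp add: assms N_def)+
  then show ?thesis using assms(3) by (simp add: sum_mono)
qed

lemma cj_le_size_eq:
  assumes "mu \<in> partitions" "lam \<in> partitions" "\<And>i. cj mu i \<le> cj lam i" "part_size mu = part_size lam"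
  shows "lam = mu"
proof -
  define N where "N = lam 0 + mu 0"
  have "part_size mu = (\<Sum>i<N. cj mu i)" "part_size lam = (\<Sum>i<N. cj lam i)"
    by (rule part_size_eq_cj; simp add: assms N_def)+
  then have "(\<Sum>i<N. cj mu i) = (\<Sum>i<N. cj lam i)" using assms(4) by simp
  then have "cj mu i = cj lam i" if "i < N" for i
    using sum_mono_inv[of "cj mu" "{..<N}" "cj lam" i] assms(3) that by auto
  moreover have "cj mu i = cj lam i" if "\<not> i < N" for i
    using that cj_zero_iff[OF assms(1), of i] cj_zero_iff[OF assms(2), of i] by (simp add: N_def)
  ultimately have "cj lam = cj mu" by (metis ext)
  then show ?thesis using cj_inject assms by blast
qed

lemma sk_self: "mu \<in> partitions \<Longrightarrow> sk mu mu = 1"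
  by (simp add: sk_def numeral_2_eq_2)

lemma sk_zero_cases: "sk lam mu \<noteq> 0 \<Longrightarrow> cj mu i \<le> cj lam i"
  by (auto simp: sk_def split: if_splits)

lemma VSr_0: "mu \<in> partitions \<Longrightarrow> VSr mu 0 = {mu}"
  using cj_le_size_eq cj_antimono by (auto simp: VSr_def VSP_def)

lemma vs_self: "vs mu mu = 1"
  by (simp add: vs_def)

text \<open>The candidate for the product of \<open>PA mu A\<close> with the complete symmetric
  function of degree \<open>m\<close>; that function itself is the candidate for the empty
  partition.\<close>

definition hpieri :: "(nat \<Rightarrow> nat) \<Rightarrow> nat \<Rightarrow> real set \<Rightarrow> real" where
  "hpieri mu m A = (\<Sum>lam\<in>part_add mu m. sk lam mu * PA lam A)"

lemma hpieri_0: "mu \<in> partitions \<Longrightarrow> hpieri mu 0 A = PA mu A"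
proof -
  assume mu: "mu \<in> partitions"
  have "hpieri mu 0 A = (\<Sum>lam\<in>{mu}. sk lam mu * PA lam A)"
    unfolding hpieri_def
  proof (rule sum.mono_neutral_right[OF finite_part_add])
    show "\<forall>lam\<in>part_add mu 0 - {mu}. sk lam mu * PA lam A = 0"
    proof
      fix lam assume "lam \<in> part_add mu 0 - {mu}"
      then have "sk lam mu = 0" using cj_le_size_eq[OF mu, of lam] sk_zero_cases by (fastforce simp: part_add_def)
      then show "sk lam mu * PA lam A = 0" by simp
    qed
  qed (use mu in \<open>auto simp: part_add_def\<close>)
  then show ?thesis by (simp add: sk_self mu)
qed

text \<open>The counterpart of the relation that the alternating sum of \<open>e_k h_(m-k)\<close>
  vanishes for \<open>m > 0\<close>. Exchanging the sums reduces it to \<open>vs_sk_inverse\<close>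
  for each \<open>lam\<close> separately.\<close>

lemma hpieri_recurrence:
  assumes mu: "mu \<in> partitions" and m: "0 < m"
  shows "(\<Sum>k\<le>m. (-1) ^ k * (\<Sum>rho\<in>VSr mu k. vs rho mu * hpieri rho (m - k) A)) = 0"
proof -
  let ?f = "\<lambda>lam rho. (-1) ^ (part_size rho - part_size mu) * vs rho mu * sk lam rho"
  have inner: "(\<Sum>k\<le>m. \<Sum>rho\<in>VSr mu k. ?f lam rho) = 0" if lam: "lam \<in> part_add mu m" for lam
  proof -
    have lp: "lam \<in> partitions" "part_size lam = part_size mu + m" using lam by (auto simp: part_add_def)
    define X where "X = {rho. rho \<in> VSP mu \<and> (\<forall>i. cj rho i \<le> cj lam i)}"
    have Xp: "rho \<in> partitions" if "rho \<in> X" for rho using that by (simp add: X_def VSP_def)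
    have Xs: "part_size rho \<le> part_size lam" if "rho \<in> X" for rho
      using cj_le_size[OF Xp[OF that] lp(1)] that by (simp add: X_def)
    have finX: "finite X"
      by (rule finite_subset[OF _ finite_partitions_size[of "part_size lam"]]) (use Xp Xs in auto)
    have "(\<Sum>rho\<in>X. ?f lam rho) = (\<Sum>k\<le>m. \<Sum>rho | rho \<in> X \<and> part_size rho - part_size mu = k. ?f lam rho)"
    proof (rule sum.group[symmetric, where g = "\<lambda>rho. part_size rho - part_size mu", simplified])
      show "(\<lambda>rho. part_size rho - part_size mu) ` X \<subseteq> {..m}"
        using Xs lp(2) by fastforce
    qed (use finX in auto)
    also have "\<dots> = (\<Sum>k\<le>m. \<Sum>rho\<in>VSr mu k. ?f lam rho)"
    proof (rule sum.cong[OF refl], rule sum.mono_neutral_left[OF finite_VSr])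
      fix k
      show "{rho. rho \<in> X \<and> part_size rho - part_size mu = k} \<subseteq> VSr mu k"
        using VSP_size[OF mu] by (fastforce simp: X_def VSr_def)
      show "\<forall>rho\<in>VSr mu k - {rho. rho \<in> X \<and> part_size rho - part_size mu = k}. ?f lam rho = 0"
        using sk_zero_cases by (fastforce simp: X_def VSr_def)
    qed
    finally have "(\<Sum>k\<le>m. \<Sum>rho\<in>VSr mu k. ?f lam rho) = (\<Sum>rho\<in>X. ?f lam rho)" ..
    also have "\<dots> = 0" using vs_sk_inverse[OF mu lp(1)] m lp(2) unfolding X_def by auto
    finally show ?thesis .
  qed
  have "(\<Sum>k\<le>m. (-1) ^ k * (\<Sum>rho\<in>VSr mu k. vs rho mu * hpieri rho (m - k) A)) =
      (\<Sum>k\<le>m. \<Sum>rho\<in>VSr mu k. \<Sum>lam\<in>part_add mu m. ?f lam rho * PA lam A)"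
    unfolding sum_distrib_left
  proof (intro sum.cong refl)
    fix k rho assume k: "k \<in> {..m}" and r: "rho \<in> VSr mu k"
    have e: "part_add rho (m - k) = part_add mu m" using k r by (auto simp: part_add_def VSr_def)
    show "(- 1) ^ k * (vs rho mu * hpieri rho (m - k) A) = (\<Sum>lam\<in>part_add mu m. ?f lam rho * PA lam A)"
      unfolding hpieri_def e sum_distrib_left by (rule sum.cong) (use r in \<open>auto simp: VSr_def\<close>)
  qed
  also have "\<dots> = (\<Sum>k\<le>m. \<Sum>lam\<in>part_add mu m. \<Sum>rho\<in>VSr mu k. ?f lam rho * PA lam A)"
    by (rule sum.cong[OF refl], rule sum.swap)
  also have "\<dots> = (\<Sum>lam\<in>part_add mu m. \<Sum>k\<le>m. \<Sum>rho\<in>VSr mu k. ?f lam rho * PA lam A)"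
    by (rule sum.swap)
  also have "\<dots> = (\<Sum>lam\<in>part_add mu m. (\<Sum>k\<le>m. \<Sum>rho\<in>VSr mu k. ?f lam rho) * PA lam A)"
    by (simp only: sum_distrib_right)
  also have "\<dots> = 0" using inner by simp
  finally show ?thesis .
qed

text \<open>The recurrence together with the Pieri rule for \<open>e_k\<close> writes
  \<open>hpieri nu m A\<close> as \<open>PA nu A\<close> times an expression in which
  \<open>nu\<close> does not occur. The case of the empty partition identifies that
  expression.\<close>

lemma hpieri_eq:
  assumes "finite A" "mu \<in> partitions"
  shows "hpieri mu m A = hpieri (\<lambda>_. 0) m A * PA mu A"
  using assms(2)
proof (induction m arbitrary: mu rule: less_induct)
  case (less m)
  show ?case
  proof (cases "m = 0")
    case True then show ?thesis using hpieri_0[OF less.prems] hpieri_0[OF zero_partition] assms(1) by simp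
  next
    case False
    have *: "hpieri nu m A = - (\<Sum>k<m. (-1) ^ Suc k * hpieri (\<lambda>_. 0) (m - Suc k) A * PA (col1 (Suc k)) A) * PA nu A"
      if nu: "nu \<in> partitions" for nu
    proof -
      obtain m' where m': "m = Suc m'" using False by (cases m) auto
      have "0 = (\<Sum>k\<le>m. (-1) ^ k * (\<Sum>rho\<in>VSr nu k. vs rho nu * hpieri rho (m - k) A))"
        using hpieri_recurrence[OF nu] False by simp
      also have "\<dots> = hpieri nu m A + (\<Sum>k<m. (-1) ^ Suc k * (\<Sum>rho\<in>VSr nu (Suc k). vs rho nu * hpieri rho (m - Suc k) A))"
        unfolding m' by (subst sum.atMost_Suc_shift)
          (simp add: VSr_0[OF nu] vs_self lessThan_Suc_atMost)
      also have "(\<Sum>k<m. (-1) ^ Suc k * (\<Sum>rho\<in>VSr nu (Suc k). vs rho nu * hpieri rho (m - Suc k) A)) =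
          (\<Sum>k<m. (-1) ^ Suc k * hpieri (\<lambda>_. 0) (m - Suc k) A * PA (col1 (Suc k)) A) * PA nu A"
        unfolding sum_distrib_right
      proof (rule sum.cong[OF refl])
        fix k assume k: "k \<in> {..<m}"
        have "(\<Sum>rho\<in>VSr nu (Suc k). vs rho nu * hpieri rho (m - Suc k) A) =
            (\<Sum>rho\<in>VSr nu (Suc k). vs rho nu * (hpieri (\<lambda>_. 0) (m - Suc k) A * PA rho A))"
        proof (rule sum.cong[OF refl])
          fix rho assume "rho \<in> VSr nu (Suc k)"
          then have "rho \<in> partitions" by (simp add: VSr_def VSP_def)
          then have "hpieri rho (m - Suc k) A = hpieri (\<lambda>_. 0) (m - Suc k) A * PA rho A"
            using k by (intro less.IH) auto
          then show "vs rho nu * hpieri rho (m - Suc k) A = vs rho nu * (hpieri (\<lambda>_. 0) (m - Suc k) A * PA rho A)" by simp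
        qed
        also have "\<dots> = hpieri (\<lambda>_. 0) (m - Suc k) A * (PA (col1 (Suc k)) A * PA nu A)"
          unfolding Pieri[OF nu assms(1)] sum_distrib_left by (simp add: mult_ac)
        finally show "(-1) ^ Suc k * (\<Sum>rho\<in>VSr nu (Suc k). vs rho nu * hpieri rho (m - Suc k) A) =
            (-1) ^ Suc k * hpieri (\<lambda>_. 0) (m - Suc k) A * PA (col1 (Suc k)) A * PA nu A" by simp
      qed
      finally show ?thesis by simp
    qed
    show ?thesis using *[OF less.prems] *[OF zero_partition] assms(1) by simp
  qed
qed

lemma sk_zero:
  assumes "lam \<in> partitions" shows "sk lam (\<lambda>_. 0) = q ^ part_n lam"
  by (simp add: sk_def part_n_eq[OF assms order_refl] power_sum)

lemma complete_Pieri: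
  assumes "finite A" "mu \<in> partitions"
  shows "(\<Sum>nu | nu \<in> partitions \<and> part_size nu = m. q ^ part_n nu * PA nu A) * PA mu A =
     (\<Sum>lam | lam \<in> partitions \<and> part_size lam = part_size mu + m. sk lam mu * PA lam A)"
proof -
  have "hpieri (\<lambda>_. 0) m A = (\<Sum>nu | nu \<in> partitions \<and> part_size nu = m. q ^ part_n nu * PA nu A)"
    unfolding hpieri_def part_add_def by (rule sum.cong) (auto simp: sk_zero)
  then show ?thesis using hpieri_eq[OF assms, of m] unfolding hpieri_def[of mu] part_add_def by simp
qed

section \<open>Linear independence and structure constants\<close>

text \<open>The leading coefficient in a new variable \<open>t\<close> that tends to infinity.
  Either \<open>t\<close> takes the first exponent, which must then be \<open>M\<close>, or some
  \<open>x\<close> precedes it and the factor \<open>(x - q * t) / (x - t)\<close> tends to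
  \<open>q\<close>.\<close>

primrec top_coeff :: "nat \<Rightarrow> nat list \<Rightarrow> real set \<Rightarrow> real" where
  "top_coeff M [] A = 0"
| "top_coeff M (a # as) A = (if a = M then hlsym as empty_ind A else 0) + q * (\<Sum>x\<in>A. x ^ a * psi x A * top_coeff M as (A - {x}))"

lemma eventually_notin_finite:
  assumes "finite (A :: real set)" shows "eventually (\<lambda>t. t \<notin> A \<and> t > 0) at_top"
proof -
  have "eventually (\<lambda>t. t > Max (insert 0 A)) at_top" by (rule eventually_gt_at_top)
  then show ?thesis
  proof (rule eventually_mono)
    fix t assume "t > Max (insert 0 A)"
    then have "\<forall>x\<in>insert 0 A. x < t" using assms by (subst (asm) Max_less_iff) auto
    then show "t \<notin> A \<and> t > 0" by auto
  qed
qed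

lemma hlsym_limit:
  "finite A \<Longrightarrow> \<forall>a\<in>set as. a \<le> M \<Longrightarrow> ((\<lambda>t. hlsym as empty_ind (insert t A) / t ^ M) \<longlongrightarrow> top_coeff M as A) at_top"
proof (induction as arbitrary: A)
  case Nil
  then show ?case by (simp add: empty_ind_def)
next
  case (Cons a as)
  have l1: "((\<lambda>t. \<Prod>y\<in>A. (t - q * y) / (t - y)) \<longlongrightarrow> (\<Prod>y\<in>A. 1)) at_top"
  proof (rule tendsto_prod)
    fix y show "((\<lambda>t. (t - q * y) / (t - y)) \<longlongrightarrow> 1) at_top"
      by real_asymp
  qed
  have l2: "((\<lambda>t::real. t ^ a / t ^ M) \<longlongrightarrow> (if a = M then 1 else 0)) at_top"
  proof (cases "a = M")
    case True
    have "eventually (\<lambda>t::real. t ^ a / t ^ M = 1) at_top"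
      using eventually_gt_at_top[of 0] by eventually_elim (simp add: True)
    then show ?thesis using True by (simp add: tendsto_eventually)
  next
    case False
    then have "a < M" using Cons.prems(2) by auto
    then obtain d where d: "M = a + Suc d" using less_iff_Suc_add by auto
    have "((\<lambda>t::real. inverse (t ^ Suc d)) \<longlongrightarrow> 0) at_top"
      by (intro tendsto_inverse_0_at_top filterlim_pow_at_top filterlim_ident) auto
    moreover have "eventually (\<lambda>t::real. inverse (t ^ Suc d) = t ^ a / t ^ M) at_top"
      using eventually_gt_at_top[of 0] by eventually_elim (simp add: d power_add field_simps)
    ultimately have "((\<lambda>t::real. t ^ a / t ^ M) \<longlongrightarrow> 0) at_top" by (rule Lim_transform_eventually)
    then show ?thesis using False by simp
  qed
  have l3: "((\<lambda>t. (x - q * t) / (x - t)) \<longlongrightarrow> q) at_top" for x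
    using q_pos by real_asymp
  have IH: "((\<lambda>t. hlsym as empty_ind (insert t (A - {x})) / t ^ M) \<longlongrightarrow> top_coeff M as (A - {x})) at_top" for x
    by (rule Cons.IH) (use Cons.prems in auto)
  have lim: "((\<lambda>t. t ^ a / t ^ M * ((\<Prod>y\<in>A. (t - q * y) / (t - y)) * hlsym as empty_ind A) +
      (\<Sum>x\<in>A. x ^ a * psi x A * ((x - q * t) / (x - t)) * (hlsym as empty_ind (insert t (A - {x})) / t ^ M)))
      \<longlongrightarrow> (if a = M then 1 else 0) * ((\<Prod>y\<in>A. 1) * hlsym as empty_ind A) +
        (\<Sum>x\<in>A. x ^ a * psi x A * q * top_coeff M as (A - {x}))) at_top"
    by (intro tendsto_add tendsto_mult tendsto_sum tendsto_const l1 l2 l3 IH)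
  have "(if a = M then 1 else 0) * ((\<Prod>y\<in>A. 1) * hlsym as empty_ind A) +
        (\<Sum>x\<in>A. x ^ a * psi x A * q * top_coeff M as (A - {x})) = top_coeff M (a # as) A"
    by (simp add: sum_distrib_left mult_ac)
  note lim = lim[unfolded this]
  have "eventually (\<lambda>t. t ^ a / t ^ M * ((\<Prod>y\<in>A. (t - q * y) / (t - y)) * hlsym as empty_ind A) +
      (\<Sum>x\<in>A. x ^ a * psi x A * ((x - q * t) / (x - t)) * (hlsym as empty_ind (insert t (A - {x})) / t ^ M))
      = hlsym (a # as) empty_ind (insert t A) / t ^ M) at_top"
    using eventually_notin_finite[OF Cons.prems(1)]
  proof eventually_elim
    case (elim t)
    have tA: "insert t A - {t} = A" using elim by auto
    then have p: "psi t (insert t A) = (\<Prod>y\<in>A. (t - q * y) / (t - y))" by (simp add: psi_def)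
    have px: "psi x (insert t A) = psi x A * ((x - q * t) / (x - t))"
      and xA: "insert t A - {x} = insert t (A - {x})" if "x \<in> A" for x
    proof -
      show *: "insert t A - {x} = insert t (A - {x})" using that elim by auto
      show "psi x (insert t A) = psi x A * ((x - q * t) / (x - t))"
        unfolding psi_def * using Cons.prems(1) elim by (subst prod.insert) auto
    qed
    have "hlsym (a # as) empty_ind (insert t A) = t ^ a * psi t (insert t A) * hlsym as empty_ind A +
        (\<Sum>x\<in>A. x ^ a * psi x (insert t A) * hlsym as empty_ind (insert t A - {x}))"
      using elim Cons.prems(1) tA by simp
    also have "\<dots> = t ^ a * (\<Prod>y\<in>A. (t - q * y) / (t - y)) * hlsym as empty_ind A +
        (\<Sum>x\<in>A. x ^ a * (psi x A * ((x - q * t) / (x - t))) * hlsym as empty_ind (insert t (A - {x})))"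
      unfolding p by (intro arg_cong2[where f = "(+)"] refl sum.cong) (simp add: px xA)
    finally show ?case
      by (simp only: add_divide_distrib sum_divide_distrib times_divide_eq_right times_divide_eq_left
          divide_divide_eq_left mult_ac)
  qed
  with lim show ?case by (rule Lim_transform_eventually)
qed

lemma top_coeff_less: "\<forall>a\<in>set as. a < M \<Longrightarrow> top_coeff M as A = 0"
  by (induction as arbitrary: A) auto

text \<open>The large variable may take any of the leading exponents \<open>M\<close>; being
  preceded by \<open>k\<close> other variables costs \<open>q ^ k\<close>.\<close>

lemma top_coeff_replicate:
  assumes "\<forall>b\<in>set bs. b < M"
  shows "top_coeff M (replicate (Suc m) M @ bs) A = (\<Sum>k<Suc m. q ^ k) * hlsym (replicate m M @ bs) empty_ind A"
proof (induction m arbitrary: A)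
  case 0 then show ?case using top_coeff_less[OF assms] by simp
next
  case (Suc m)
  let ?S = "\<Sum>k<Suc m. q ^ k"
  have "top_coeff M (replicate (Suc (Suc m)) M @ bs) A = hlsym (replicate (Suc m) M @ bs) empty_ind A +
      q * (\<Sum>x\<in>A. x ^ M * psi x A * (?S * hlsym (replicate m M @ bs) empty_ind (A - {x})))"
    by (simp only: replicate_Suc[of "Suc m"] append_Cons top_coeff.simps simp_thms if_True Suc)
  also have "\<dots> = (1 + q * ?S) * hlsym (replicate (Suc m) M @ bs) empty_ind A"
  proof -
    have "(\<Sum>x\<in>A. x ^ M * psi x A * (c * g x)) = c * (\<Sum>x\<in>A. x ^ M * psi x A * g x)" for c and g :: "real \<Rightarrow> real"
      by (simp add: sum_distrib_left mult_ac)
    then have "(\<Sum>x\<in>A. x ^ M * psi x A * (?S * hlsym (replicate m M @ bs) empty_ind (A - {x}))) =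
        ?S * hlsym (replicate (Suc m) M @ bs) empty_ind A" by (simp only: replicate_Suc append_Cons hlsym.simps)
    then show ?thesis by (simp only: distrib_right mult_1 mult.assoc)
  qed
  also have "1 + q * ?S = (\<Sum>k<Suc (Suc m). q ^ k)"
    by (subst (2) sum.lessThan_Suc_shift) (simp add: sum_distrib_left del: sum.lessThan_Suc)
  finally show ?case .
qed

lemma cj_tl: "lam \<in> partitions \<Longrightarrow> cj (\<lambda>i. lam (Suc i)) i = cj lam i - 1"
proof -
  assume lam: "lam \<in> partitions"
  have "j < cj (\<lambda>i. lam (Suc i)) i \<longleftrightarrow> j < cj lam i - 1" for j
    using cj_less_iff[OF part_tl_partition[OF lam], of j i] cj_less_iff[OF lam, of "Suc j" i] by linarith
  then have "{..<cj (\<lambda>i. lam (Suc i)) i} = {..<cj lam i - 1}" by (simp only: set_eq_iff lessThan_iff) simp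
  then show ?thesis by (metis card_lessThan)
qed

text \<open>Removing the first row lowers the multiplicity of the largest part by one. The ratio of
  the normalisations is the q-integer found in \<open>top_coeff_replicate\<close>, and the two
  cancel in \<open>PA_limit\<close>.\<close>

lemma hl_v_tl:
  assumes lam: "lam \<in> partitions" and len: "part_length lam \<le> Suc n" and pos: "lam 0 = Suc M"
  shows "hl_v q (Suc n) lam = (\<Sum>k<cj lam M. q ^ k) * hl_v q n (\<lambda>i. lam (Suc i))"
proof -
  let ?t = "\<lambda>i. lam (Suc i)"
  define m where "m = cj lam M"
  have m0: "0 < m" using cj_less_iff[OF lam, of 0 M] pos by (simp add: m_def)
  have z: "cj lam (Suc M) = 0" using cj_zero_iff[OF lam] pos by simp
  have ge: "0 < cj lam i" if "i \<le> M" for i using cj_less_iff[OF lam, of 0 i] pos that by simp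
  have "lam 1 \<le> Suc M" using partitions_antimono[OF lam, of 0 1] pos by simp
  then have v2: "hl_v q n ?t = (\<Prod>i\<le>Suc M. qf (cc n ?t i - cc n ?t (Suc i))) / (1 - q) ^ n"
    using part_tl_length[OF lam] len by (intro hl_v_eq part_tl_partition[OF lam]) auto
  have v1: "hl_v q (Suc n) lam = (\<Prod>i\<le>Suc M. qf (cc (Suc n) lam i - cc (Suc n) lam (Suc i))) / (1 - q) ^ Suc n"
    by (rule hl_v_eq[OF lam len]) (simp add: pos)
  have same: "cc (Suc n) lam i - cc (Suc n) lam (Suc i) = cc n ?t i - cc n ?t (Suc i)" if "i \<le> M" for i
    using ge[OF that] cj_tl[OF lam] that ge[of "i - 1"] by (cases i) auto
  have p: "(\<Prod>i\<le>M. qf (cc (Suc n) lam i - cc (Suc n) lam (Suc i))) = (\<Prod>i\<le>M. qf (cc n ?t i - cc n ?t (Suc i)))"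
    by (rule prod.cong) (use same in auto)
  have last: "cc (Suc n) lam (Suc M) - cc (Suc n) lam (Suc (Suc M)) = m" "cc n ?t (Suc M) - cc n ?t (Suc (Suc M)) = m - 1"
    using z cj_tl[OF lam] by (simp_all add: m_def)
  obtain m' where m': "m = Suc m'" using m0 by (cases m) auto
  have "(\<Sum>k<m. q ^ k) = (1 - q ^ m) / (1 - q)"
    using q_less_1 by (simp add: sum_gp_strict)
  then have qm: "qf m = (\<Sum>k<m. q ^ k) * qf (m - 1) * (1 - q)" using q_less_1 by (simp add: m' qf_Suc)
  show ?thesis unfolding v1 v2 prod.atMost_Suc p last m_def[symmetric] qm
    using q_less_1 by simp
qed

text \<open>The leading coefficient of \<open>P_lam\<close> in one variable is \<open>P\<close> of
  \<open>lam\<close> without its first row; a first row shorter than \<open>Suc M\<close> leaves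
  nothing in the limit.\<close>

lemma PA_limit:
  assumes lam: "lam \<in> partitions" and le: "lam 0 \<le> Suc M" and fin: "finite A"
  shows "((\<lambda>t. PA lam (insert t A) / t ^ Suc M) \<longlongrightarrow> (if lam 0 = Suc M then PA (\<lambda>i. lam (Suc i)) A else 0)) at_top"
proof -
  define n where "n = card A"
  have ev: "eventually (\<lambda>t. card (insert t A) = Suc n) at_top"
    using eventually_notin_finite[OF fin] by eventually_elim (simp add: fin n_def)
  show ?thesis
  proof (cases "part_length lam \<le> Suc n")
    case False
    have "eventually (\<lambda>t. PA lam (insert t A) / t ^ Suc M = 0) at_top"
      using ev by eventually_elim (use False in \<open>simp add: PA_def\<close>)
    moreover have "PA (\<lambda>i. lam (Suc i)) A = 0"
      using False part_tl_length[OF lam] by (simp add: PA_def n_def)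
    ultimately show ?thesis by (simp add: tendsto_eventually)
  next
    case True
    define as where "as = map lam [0..<Suc n]"
    have as_le: "\<forall>a\<in>set as. a \<le> lam 0"
      using partitions_antimono[OF lam, of 0] by (auto simp: as_def simp del: upt_Suc)
    have "((\<lambda>t. hlsym as empty_ind (insert t A) / t ^ Suc M) \<longlongrightarrow> top_coeff (Suc M) as A) at_top"
      by (rule hlsym_limit[OF fin]) (use as_le le in auto)
    then have lim: "((\<lambda>t. hlsym as empty_ind (insert t A) / t ^ Suc M / hl_v q (Suc n) lam) \<longlongrightarrow> top_coeff (Suc M) as A / hl_v q (Suc n) lam) at_top"
      by (intro tendsto_divide tendsto_const) (use hl_v_pos[OF lam True] in auto)
    have ev2: "eventually (\<lambda>t. hlsym as empty_ind (insert t A) / t ^ Suc M / hl_v q (Suc n) lam = PA lam (insert t A) / t ^ Suc M) at_top"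
      using ev by eventually_elim (use True in \<open>simp add: PA_def as_def del: upt_Suc\<close>)
    have "top_coeff (Suc M) as A / hl_v q (Suc n) lam = (if lam 0 = Suc M then PA (\<lambda>i. lam (Suc i)) A else 0)"
    proof (cases "lam 0 = Suc M")
      case False
      then have "\<forall>a\<in>set as. a < Suc M" using le as_le by auto
      then show ?thesis using False top_coeff_less by simp
    next
      case l0: True
      define m where "m = cj lam M"
      have m0: "0 < m" using cj_less_iff[OF lam, of 0 M] l0 by (simp add: m_def)
      then obtain m' where m': "m = Suc m'" by (cases m) auto
      have mn: "m \<le> Suc n" using cj_antimono[OF lam, of 0 M] part_length_eq[OF lam] True by (simp add: m_def)
      have big: "lam i = Suc M" if "i < m" for i
        using cj_less_iff[OF lam, of i M] that partitions_antimono[OF lam, of 0 i] l0 by (simp add: m_def)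
      have small: "lam i < Suc M" if "\<not> i < m" for i
        using cj_less_iff[OF lam, of i M] that by (simp add: m_def)
      have rep: "map lam [j..<m] = replicate (m - j) (Suc M)" for j
        by (rule replicate_eqI) (auto simp: big)
      have s: "[j..<Suc n] = [j..<m] @ [m..<Suc n]" if "j \<le> m" for j
        using upt_add_eq_append[of j m "Suc n - m"] that mn by (simp del: upt_Suc)
      have as: "as = replicate (Suc m') (Suc M) @ map lam [m..<Suc n]"
        unfolding as_def s[of 0, OF le0] map_append rep by (simp only: m' diff_zero)
      have tl: "map (\<lambda>i. lam (Suc i)) [0..<n] = replicate m' (Suc M) @ map lam [m..<Suc n]"
      proof -
        have "map (\<lambda>i. lam (Suc i)) [0..<n] = map lam (map Suc [0..<n])" by simp
        also have "\<dots> = map lam [1..<Suc n]" by (simp only: map_Suc_upt One_nat_def)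
        also have "\<dots> = replicate m' (Suc M) @ map lam [m..<Suc n]"
          using s[of 1] rep[of 1] m' by (simp del: upt_Suc)
        finally show ?thesis .
      qed
      have sm: "\<forall>b\<in>set (map lam [m..<Suc n]). b < Suc M" using small by (auto simp del: upt_Suc)
      have "top_coeff (Suc M) as A = (\<Sum>k<m. q ^ k) * hlsym (map (\<lambda>i. lam (Suc i)) [0..<n]) empty_ind A"
        unfolding as tl m' using top_coeff_replicate[OF sm, of m' A] by (simp only: m')
      moreover have "(\<Sum>k<m. q ^ k) \<noteq> 0"
        using m0 q_pos by (intro order.strict_implies_not_eq[OF sum_pos, symmetric]) auto
      moreover have "part_length (\<lambda>i. lam (Suc i)) \<le> n" using part_tl_length[OF lam] True by simp
      ultimately show ?thesis
        unfolding hl_v_tl[OF lam True l0] m_def[symmetric] by (simp add: PA_def n_def l0)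
    qed
    then show ?thesis using Lim_transform_eventually[OF lim ev2] by simp
  qed
qed

text \<open>A linear relation is divided by the highest power of one variable, which is sent to
  infinity. The partitions with the longest first row survive and lose that row. Since they shared
  its length they remain distinct, and the new relation concerns smaller partitions.\<close>

lemma PA_linear_independent:
  assumes "finite F" "F \<subseteq> partitions" "\<And>A. finite A \<Longrightarrow> (\<Sum>lam\<in>F. c lam * PA lam A) = 0" "lam \<in> F"
  shows "c lam = 0"
proof -
  have main: "\<forall>F c. finite F \<longrightarrow> F \<subseteq> partitions \<longrightarrow> (\<forall>lam\<in>F. part_size lam \<le> K) \<longrightarrow>
      (\<forall>A. finite A \<longrightarrow> (\<Sum>lam\<in>F. c lam * PA lam A) = 0) \<longrightarrow> (\<forall>lam\<in>F. c lam = (0 :: real))" for K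
  proof (induction K rule: less_induct)
    case (less K)
    show ?case
    proof (intro allI impI, rule ccontr)
      fix F and c :: "(nat \<Rightarrow> nat) \<Rightarrow> real"
      assume fin: "finite F" and sub: "F \<subseteq> partitions" and size: "\<forall>lam\<in>F. part_size lam \<le> K"
        and eq: "\<forall>A. finite A \<longrightarrow> (\<Sum>lam\<in>F. c lam * PA lam A) = 0" and ne: "\<not> (\<forall>lam\<in>F. c lam = 0)"
      define F' where "F' = {lam\<in>F. c lam \<noteq> 0}"
      have F': "finite F'" "F' \<noteq> {}" using fin ne by (auto simp: F'_def)
      have eq': "(\<Sum>lam\<in>F'. c lam * PA lam A) = 0" if "finite A" for A
      proof -
        have "(\<Sum>lam\<in>F'. c lam * PA lam A) = (\<Sum>lam\<in>F. c lam * PA lam A)"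
          unfolding F'_def by (rule sum.mono_neutral_left) (use fin in auto)
        then show ?thesis using eq that by simp
      qed
      define M where "M = Max ((\<lambda>lam. lam 0) ` F')"
      have Mle: "lam 0 \<le> M" if "lam \<in> F'" for lam using that F' by (simp add: M_def)
      have "M \<in> (\<lambda>lam. lam 0) ` F'" unfolding M_def by (rule Max_in) (use F' in auto)
      then obtain lam0 where lam0: "lam0 \<in> F'" "lam0 0 = M" by blast
      show False
      proof (cases M)
        case 0
        have "lam = (\<lambda>_. 0)" if "lam \<in> F'" for lam
        proof
          fix i show "lam i = 0" using partitions_antimono[of lam 0 i] Mle[OF that] 0 that sub by (auto simp: F'_def)
        qed
        then have "F' = {\<lambda>_. 0}" using F'(2) by auto
        then have "(\<lambda>_. 0) \<in> F'" "c (\<lambda>_. 0) = 0" using eq'[of "{}"] by auto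
        then show False by (simp add: F'_def)
      next
        case (Suc N)
        define F1 where "F1 = {lam\<in>F'. lam 0 = M}"
        let ?tl = "\<lambda>lam i. lam (Suc i)"
        have lim: "(\<Sum>lam\<in>F1. c lam * PA (?tl lam) A) = 0" if A: "finite A" for A
        proof -
          have "((\<lambda>t. \<Sum>lam\<in>F'. c lam * (PA lam (insert t A) / t ^ Suc N)) \<longlongrightarrow>
             (\<Sum>lam\<in>F'. c lam * (if lam 0 = Suc N then PA (?tl lam) A else 0))) at_top"
            by (intro tendsto_sum tendsto_mult tendsto_const PA_limit A)
              (use sub Mle Suc in \<open>auto simp: F'_def\<close>)
          moreover have "(\<Sum>lam\<in>F'. c lam * (PA lam (insert t A) / t ^ Suc N)) = 0" for t
            using eq'[of "insert t A"] A
            by (simp only: times_divide_eq_right sum_divide_distrib[symmetric] finite_insert div_0)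
          ultimately have "(\<Sum>lam\<in>F'. c lam * (if lam 0 = Suc N then PA (?tl lam) A else 0)) = 0"
            by (simp add: tendsto_const_iff)
          moreover have "(\<Sum>lam\<in>F'. c lam * (if lam 0 = Suc N then PA (?tl lam) A else 0)) =
              (\<Sum>lam\<in>F1. c lam * PA (?tl lam) A)"
            by (rule sum.mono_neutral_cong_right) (use F' in \<open>auto simp: F1_def Suc\<close>)
          ultimately show ?thesis by simp
        qed
        have inj: "inj_on ?tl F1"
        proof (rule inj_onI)
          fix lam mu assume l: "lam \<in> F1" "mu \<in> F1" and e: "?tl lam = ?tl mu"
          show "lam = mu"
          proof
            fix i show "lam i = mu i" using l fun_cong[OF e, of "i - 1"] by (cases i) (auto simp: F1_def)
          qed
        qed
        have s1: "part_size (?tl lam) < K" if "lam \<in> F1" for lam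
        proof -
          have "lam \<in> partitions" "part_size lam \<le> K" "lam 0 = Suc N"
            using that sub size Suc by (auto simp: F1_def F'_def)
          then show ?thesis using part_tl_size[of lam] by simp
        qed
        have l1: "lam0 \<in> F1" using lam0 by (simp add: F1_def)
        have K: "K - 1 < K" using s1[OF l1] by simp
        define d where "d = c \<circ> inv_into F1 ?tl"
        have a1: "finite (?tl ` F1)" using F' by (simp add: F1_def)
        have a2: "?tl ` F1 \<subseteq> partitions" using sub part_tl_partition by (auto simp: F1_def F'_def)
        have a3: "\<forall>nu\<in>?tl ` F1. part_size nu \<le> K - 1" using s1 by fastforce
        have a4: "\<forall>A. finite A \<longrightarrow> (\<Sum>nu\<in>?tl ` F1. d nu * PA nu A) = 0"
        proof (intro allI impI)
          fix A :: "real set" assume A: "finite A"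
          have "(\<Sum>nu\<in>?tl ` F1. d nu * PA nu A) = (\<Sum>lam\<in>F1. d (?tl lam) * PA (?tl lam) A)"
            by (rule sum.reindex_cong[OF inj]) auto
          also have "\<dots> = (\<Sum>lam\<in>F1. c lam * PA (?tl lam) A)"
            by (rule sum.cong) (simp_all add: d_def inv_into_f_f[OF inj])
          finally show "(\<Sum>nu\<in>?tl ` F1. d nu * PA nu A) = 0" using lim[OF A] by simp
        qed
        have "\<forall>nu\<in>?tl ` F1. d nu = 0" using less.IH[OF K] a1 a2 a3 a4 by blast
        then have "d (?tl lam0) = 0" using l1 by blast
        then have "c lam0 = 0" using inv_into_f_f[OF inj l1] by (simp add: d_def)
        then show False using lam0 by (simp add: F'_def)
      qed
    qed
  qed
  have "\<forall>lam\<in>F. part_size lam \<le> Max (part_size ` F)" using assms(1) by simp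
  then show ?thesis using main[of "Max (part_size ` F)"] assms by blast
qed

lemma psi_scale: "t \<noteq> 0 \<Longrightarrow> psi (t * x) ((*) t ` A) = psi x A"
proof -
  assume t: "t \<noteq> 0"
  have "(*) t ` A - {t * x} = (*) t ` (A - {x})" using t by auto
  moreover have "inj_on ((*) t) (A - {x})" using t by (auto simp: inj_on_def)
  moreover have "(t * x - q * (t * y)) / (t * x - t * y) = (x - q * y) / (x - y)" for y
  proof -
    have "(t * x - q * (t * y)) / (t * x - t * y) = (t * (x - q * y)) / (t * (x - y))"
      by (simp add: algebra_simps)
    then show ?thesis using t by simp
  qed
  ultimately show ?thesis by (simp add: psi_def prod.reindex)
qed

lemma hlsym_scale: "t \<noteq> 0 \<Longrightarrow> hlsym as empty_ind ((*) t ` A) = t ^ sum_list as * hlsym as empty_ind A"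
proof (induction as arbitrary: A)
  case Nil then show ?case by (simp add: empty_ind_def)
next
  case (Cons a as)
  have inj: "inj_on ((*) t) A" using Cons.prems by (auto simp: inj_on_def)
  have d: "(*) t ` A - {t * x} = (*) t ` (A - {x})" for x using Cons.prems by auto
  show ?case
    unfolding hlsym.simps sum.reindex[OF inj] comp_def psi_scale[OF Cons.prems] d Cons.IH[OF Cons.prems] sum_distrib_left
    by (rule sum.cong) (simp_all add: power_mult_distrib power_add mult_ac)
qed

text \<open>Homogeneity has two uses: it forces the sizes to add up in the structure constants, and
  it moves the specialisation from \<open>1, q, ...\<close> to \<open>q, q^2, ...\<close>.\<close>

lemma PA_scale:
  assumes "t \<noteq> 0" "lam \<in> partitions"
  shows "PA lam ((*) t ` A) = t ^ part_size lam * PA lam A"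
proof -
  have "card ((*) t ` A) = card A" by (rule card_image) (use assms in \<open>auto simp: inj_on_def\<close>)
  moreover have "sum_list (map lam [0..<n]) = part_size lam" if "part_length lam \<le> n" for n
    unfolding part_size_eq_sum[OF assms(2) that] by (simp add: interv_sum_list_conv_sum_set_nat atLeast0LessThan)
  ultimately show ?thesis using hlsym_scale[OF assms(1)] by (simp add: PA_def)
qed

section \<open>Products of Hall--Littlewood polynomials lie in their linear span\<close>

definition hlspan :: "(real set \<Rightarrow> real) \<Rightarrow> bool" where
  "hlspan F \<longleftrightarrow> (\<exists>S g. finite S \<and> S \<subseteq> partitions \<and> (\<forall>A. finite A \<longrightarrow> F A = (\<Sum>lam\<in>S. g lam * PA lam A)))"

lemma hlspanI: "finite S \<Longrightarrow> S \<subseteq> partitions \<Longrightarrow> (\<And>A. finite A \<Longrightarrow> F A = (\<Sum>lam\<in>S. g lam * PA lam A)) \<Longrightarrow> hlspan F"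
  unfolding hlspan_def by blast

lemma hlspan_cong: "hlspan F \<Longrightarrow> (\<And>A. finite A \<Longrightarrow> F A = F' A) \<Longrightarrow> hlspan F'"
  unfolding hlspan_def by metis

lemma hlspan_zero: "hlspan (\<lambda>_. 0)"
  by (rule hlspanI[of "{}"]) auto

lemma hlspan_cmult: "hlspan F \<Longrightarrow> hlspan (\<lambda>A. c * F A)"
proof -
  assume "hlspan F"
  then obtain S g where "finite S" "S \<subseteq> partitions" "\<And>A. finite A \<Longrightarrow> F A = (\<Sum>lam\<in>S. g lam * PA lam A)"
    unfolding hlspan_def by blast
  then show ?thesis by (intro hlspanI[of S _ "\<lambda>lam. c * g lam"]) (auto simp: sum_distrib_left mult_ac)
qed

lemma hlspan_add:
  assumes "hlspan F" "hlspan F'" shows "hlspan (\<lambda>A. F A + F' A)"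
proof -
  obtain S g where S: "finite S" "S \<subseteq> partitions" "\<And>A. finite A \<Longrightarrow> F A = (\<Sum>lam\<in>S. g lam * PA lam A)"
    using assms(1) unfolding hlspan_def by blast
  obtain S' g' where S': "finite S'" "S' \<subseteq> partitions" "\<And>A. finite A \<Longrightarrow> F' A = (\<Sum>lam\<in>S'. g' lam * PA lam A)"
    using assms(2) unfolding hlspan_def by blast
  define h where "h lam = (if lam \<in> S then g lam else 0) + (if lam \<in> S' then g' lam else 0)" for lam
  show ?thesis
  proof (rule hlspanI)
    fix A :: "real set" assume A: "finite A"
    have "F A = (\<Sum>lam\<in>S \<union> S'. (if lam \<in> S then g lam else 0) * PA lam A)"
      unfolding S(3)[OF A] by (rule sum.mono_neutral_cong_left) (use S S' in auto)
    moreover have "F' A = (\<Sum>lam\<in>S \<union> S'. (if lam \<in> S' then g' lam else 0) * PA lam A)"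
      unfolding S'(3)[OF A] by (rule sum.mono_neutral_cong_left) (use S S' in auto)
    ultimately show "F A + F' A = (\<Sum>lam\<in>S \<union> S'. h lam * PA lam A)"
      by (simp only: h_def distrib_right sum.distrib)
  qed (use S S' in auto)
qed

lemma hlspan_sum: "finite I \<Longrightarrow> (\<And>i. i \<in> I \<Longrightarrow> hlspan (F i)) \<Longrightarrow> hlspan (\<lambda>A. \<Sum>i\<in>I. F i A)"
  by (induction I rule: finite_induct) (auto simp: hlspan_zero hlspan_add)

text \<open>Multipliers of the span. They are closed under products and linear combinations, so it
  suffices to start from the elementary symmetric functions, for which the Pieri rule is
  available.\<close>

definition hlmult :: "(real set \<Rightarrow> real) \<Rightarrow> bool" where
  "hlmult F \<longleftrightarrow> (\<forall>mu\<in>partitions. hlspan (\<lambda>A. F A * PA mu A))"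

lemma hlmult_hlspan:
  assumes "hlmult F" "hlspan H" shows "hlspan (\<lambda>A. F A * H A)"
proof -
  obtain S g where S: "finite S" "S \<subseteq> partitions" "\<And>A. finite A \<Longrightarrow> H A = (\<Sum>lam\<in>S. g lam * PA lam A)"
    using assms(2) unfolding hlspan_def by blast
  have "hlspan (\<lambda>A. \<Sum>lam\<in>S. g lam * (F A * PA lam A))"
    by (rule hlspan_sum[OF S(1)], rule hlspan_cmult) (use assms(1) S(2) in \<open>auto simp: hlmult_def\<close>)
  then show ?thesis by (rule hlspan_cong) (simp add: S(3) sum_distrib_left mult_ac)
qed

lemma hlmult_mult: "hlmult F \<Longrightarrow> hlmult F' \<Longrightarrow> hlmult (\<lambda>A. F A * F' A)"
proof -
  assume F: "hlmult F" "hlmult F'"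
  have "hlspan (\<lambda>A. F A * (F' A * PA mu A))" if "mu \<in> partitions" for mu
    by (rule hlmult_hlspan[OF F(1)]) (use F(2) that in \<open>simp add: hlmult_def\<close>)
  then show ?thesis by (simp add: hlmult_def mult.assoc)
qed

lemma hlmult_col1: "hlmult (PA (col1 r))"
  unfolding hlmult_def
proof
  fix mu :: "nat \<Rightarrow> nat" assume mu: "mu \<in> partitions"
  show "hlspan (\<lambda>A. PA (col1 r) A * PA mu A)"
    by (rule hlspanI[OF finite_VSr[of mu r] _ Pieri[OF mu]]) (auto simp: VSr_def VSP_def)
qed

lemma hlmult_sub:
  assumes "hlmult F" "finite I" "\<And>i. i \<in> I \<Longrightarrow> hlmult (F' i)"
  shows "hlmult (\<lambda>A. F A - (\<Sum>i\<in>I. c i * F' i A))"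
  unfolding hlmult_def
proof
  fix mu :: "nat \<Rightarrow> nat" assume mu: "mu \<in> partitions"
  have "hlspan (\<lambda>A. F A * PA mu A + (\<Sum>i\<in>I. (- c i) * (F' i A * PA mu A)))"
    by (rule hlspan_add, (use assms(1) mu in \<open>simp add: hlmult_def\<close>),
        rule hlspan_sum[OF assms(2)], rule hlspan_cmult) (use assms(3) mu in \<open>simp add: hlmult_def\<close>)
  then show "hlspan (\<lambda>A. (F A - (\<Sum>i\<in>I. c i * F' i A)) * PA mu A)"
    by (rule hlspan_cong) (simp add: left_diff_distrib sum_distrib_right sum_negf mult.assoc)
qed

lemma part_length_le_size: "lam \<in> partitions \<Longrightarrow> part_length lam \<le> part_size lam"
  using part_tl_size[OF cj_partitions, of lam] part_size_cj[of lam] part_length_eq[of lam] by simp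

text \<open>
  \<open>P\<^sub>lam\<close> is obtained from \<open>e\<^sub>r P\<^bsub>lam-\<^esub>\<close>, where \<open>lam-\<close> is \<open>lam\<close>
  without its first column and \<open>r\<close> is the length of that column: the other terms of the Pieri
  rule have a longer first column.
\<close>

lemma hlmult_PA: "lam \<in> partitions \<Longrightarrow> hlmult (PA lam)"
proof (induction lam rule: measure_induct_rule[where
      f = "\<lambda>lam. part_size lam * part_size lam + (part_size lam - part_length lam)"])
  case (less lam)
  note lam = less.prems
  show ?case
  proof (cases "part_length lam = 0")
    case True
    then have "lam = (\<lambda>_. 0)" using part_zero_iff[OF lam] by auto
    then have "lam = col1 0" by (simp add: col1_def fun_eq_iff)
    then show ?thesis using hlmult_col1 by simp
  next
    case False
    define r where "r = part_length lam"
    define dec where "dec = cj (\<lambda>i. cj lam (Suc i))"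
    have tlp: "(\<lambda>i. cj lam (Suc i)) \<in> partitions" by (rule part_tl_partition[OF cj_partitions[OF lam]])
    have dp: "dec \<in> partitions" unfolding dec_def by (rule cj_partitions[OF tlp])
    have cjd: "cj dec i = cj lam (Suc i)" for i unfolding dec_def by (simp add: cj_cj[OF tlp])
    have size: "part_size lam = r + part_size dec"
      using part_tl_size[OF cj_partitions[OF lam]] part_size_cj[OF lam] part_size_cj[OF tlp] part_length_eq[OF lam]
      by (simp add: dec_def r_def)
    define X where "X = VSr dec r - {lam}"
    have lamV: "lam \<in> VSr dec r"
      using lam size cj_antimono[OF lam] by (simp add: VSr_def VSP_def cjd)
    have vs1: "vs lam dec = 1" by (simp add: vs_def cjd)
    have PAlam: "PA lam A = PA (col1 r) A * PA dec A - (\<Sum>d\<in>X. vs d dec * PA d A)" if "finite A" for A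
      using Pieri[OF dp that, of r] sum.remove[OF finite_VSr lamV, of "\<lambda>d. vs d dec * PA d A"] vs1
      by (simp add: X_def)
    have Xmult: "hlmult (PA d)" if d: "d \<in> X" for d
    proof (rule less.IH)
      show dpp: "d \<in> partitions" using d by (simp add: X_def VSr_def VSP_def)
      have ds: "part_size d = part_size lam" using d size by (simp add: X_def VSr_def)
      have "part_length lam < part_length d"
      proof (rule ccontr)
        assume "\<not> part_length lam < part_length d"
        then have 0: "cj d 0 \<le> cj lam 0" using part_length_eq[OF dpp] part_length_eq[OF lam] by simp
        have "cj d i \<le> cj lam i" for i
          using 0 d by (cases i) (auto simp: X_def VSr_def VSP_def cjd)
        then have "lam = d" by (rule cj_le_size_eq[OF dpp lam _ ds])
        then show False using d by (simp add: X_def)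
      qed
      then show "part_size d * part_size d + (part_size d - part_length d)
          < part_size lam * part_size lam + (part_size lam - part_length lam)"
        using ds part_length_le_size[OF dpp] by simp
    qed
    have "hlmult (PA dec)"
    proof (rule less.IH[OF _ dp])
      have "part_size dec < part_size lam" using size False by (simp add: r_def)
      then have "Suc (part_size dec) * Suc (part_size dec) \<le> part_size lam * part_size lam"
        by (intro mult_le_mono) auto
      moreover have "part_size dec - part_length dec \<le> part_size dec" by simp
      ultimately show "part_size dec * part_size dec + (part_size dec - part_length dec)
          < part_size lam * part_size lam + (part_size lam - part_length lam)" by simp
    qed
    then have "hlmult (\<lambda>A. PA (col1 r) A * PA dec A)" by (rule hlmult_mult[OF hlmult_col1])
    then have "hlmult (\<lambda>A. PA (col1 r) A * PA dec A - (\<Sum>d\<in>X. vs d dec * PA d A))"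
      by (rule hlmult_sub) (use finite_VSr Xmult in \<open>auto simp: X_def\<close>)
    then show ?thesis
      unfolding hlmult_def by (auto intro: hlspan_cong simp: PAlam)
  qed
qed

section \<open>The structure constants are well defined\<close>

definition is_coeff :: "(nat \<Rightarrow> nat) \<Rightarrow> (nat \<Rightarrow> nat) \<Rightarrow> ((nat \<Rightarrow> nat) \<Rightarrow> real) \<Rightarrow> bool" where
  "is_coeff mu nu g \<longleftrightarrow> {lam. g lam \<noteq> 0} \<subseteq> partitions \<and> finite {lam. g lam \<noteq> 0} \<and>
     (\<forall>A. finite A \<longrightarrow> (hl_b q mu * PA mu A) * (hl_b q nu * PA nu A)
        = (\<Sum>lam | g lam \<noteq> 0. g lam * (hl_b q lam * PA lam A)))"

lemma is_coeff_iff: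
  "{lam. g lam \<noteq> 0} \<subseteq> partitions \<and> finite {lam. g lam \<noteq> 0} \<and>
      (\<forall>n. \<forall>x :: nat \<Rightarrow> real. inj_on x {..<n} \<longrightarrow>
           hl_Q q n mu x * hl_Q q n nu x = (\<Sum>lam | g lam \<noteq> 0. g lam * hl_Q q n lam x))
    \<longleftrightarrow> is_coeff mu nu g"
proof -
  let ?E = "\<lambda>A. (hl_b q mu * PA mu A) * (hl_b q nu * PA nu A)
        = (\<Sum>lam | g lam \<noteq> 0. g lam * (hl_b q lam * PA lam A))"
  have "(\<forall>n. \<forall>x :: nat \<Rightarrow> real. inj_on x {..<n} \<longrightarrow>
           hl_Q q n mu x * hl_Q q n nu x = (\<Sum>lam | g lam \<noteq> 0. g lam * hl_Q q n lam x))
     \<longleftrightarrow> (\<forall>n. \<forall>x :: nat \<Rightarrow> real. inj_on x {..<n} \<longrightarrow> ?E (x ` {..<n}))"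
    unfolding hl_Q_def by (intro iff_allI imp_cong refl) (simp add: hl_P_eq)
  also have "\<dots> \<longleftrightarrow> (\<forall>A. finite A \<longrightarrow> ?E A)"
  proof (intro iffI allI impI)
    fix A :: "real set"
    assume *: "\<forall>n. \<forall>x :: nat \<Rightarrow> real. inj_on x {..<n} \<longrightarrow> ?E (x ` {..<n})" and "finite A"
    obtain x where "inj_on x {..<card A}" "x ` {..<card A} = A" using exists_enumeration[OF \<open>finite A\<close>] .
    then show "?E A" using spec[OF spec[OF *, of "card A"], of x] by simp
  qed simp
  finally show ?thesis unfolding is_coeff_def by simp
qed

text \<open>Existence comes from \<open>hlmult_PA\<close> after division by the positive numbers
  \<open>hl_b q lam\<close>, uniqueness from linear independence on the union of the two
  supports.\<close>

lemma is_coeff_ex1: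
  assumes "mu \<in> partitions" "nu \<in> partitions" shows "\<exists>!g. is_coeff mu nu g"
proof (rule ex_ex1I)
  have "hlspan (\<lambda>A. PA mu A * PA nu A)" using hlmult_PA[OF assms(1)] assms(2) by (simp add: hlmult_def)
  then obtain S c where S: "finite S" "S \<subseteq> partitions" "\<And>A. finite A \<Longrightarrow> PA mu A * PA nu A = (\<Sum>lam\<in>S. c lam * PA lam A)"
    unfolding hlspan_def by blast
  define g where "g lam = (if lam \<in> S then hl_b q mu * hl_b q nu * c lam / hl_b q lam else 0)" for lam
  have sub: "{lam. g lam \<noteq> 0} \<subseteq> S" by (auto simp: g_def split: if_splits)
  have "(hl_b q mu * PA mu A) * (hl_b q nu * PA nu A) = (\<Sum>lam | g lam \<noteq> 0. g lam * (hl_b q lam * PA lam A))"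
    if "finite A" for A
  proof -
    have "(hl_b q mu * PA mu A) * (hl_b q nu * PA nu A) = (\<Sum>lam\<in>S. hl_b q mu * hl_b q nu * (c lam * PA lam A))"
      unfolding sum_distrib_left[symmetric] S(3)[OF that, symmetric] by (simp add: mult_ac)
    also have "\<dots> = (\<Sum>lam\<in>S. g lam * (hl_b q lam * PA lam A))"
    proof (rule sum.cong[OF refl])
      fix lam assume l: "lam \<in> S"
      then have "hl_b q lam > 0" using S(2) hl_b_pos by auto
      then show "hl_b q mu * hl_b q nu * (c lam * PA lam A) = g lam * (hl_b q lam * PA lam A)"
        using l by (simp add: g_def)
    qed
    also have "\<dots> = (\<Sum>lam | g lam \<noteq> 0. g lam * (hl_b q lam * PA lam A))"
      by (rule sum.mono_neutral_right) (use S sub in auto)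
    finally show ?thesis .
  qed
  then have "is_coeff mu nu g"
    unfolding is_coeff_def using sub S finite_subset by blast
  then show "\<exists>g. is_coeff mu nu g" by (rule exI[where x = g])
next
  fix g h assume g: "is_coeff mu nu g" and h: "is_coeff mu nu h"
  define U where "U = {lam. g lam \<noteq> 0} \<union> {lam. h lam \<noteq> 0}"
  have U: "finite U" "U \<subseteq> partitions" using g h by (auto simp: U_def is_coeff_def)
  have z: "(\<Sum>lam\<in>U. ((g lam - h lam) * hl_b q lam) * PA lam A) = 0" if "finite A" for A
  proof -
    have "(\<Sum>lam | g lam \<noteq> 0. g lam * (hl_b q lam * PA lam A)) = (\<Sum>lam\<in>U. g lam * (hl_b q lam * PA lam A))"
      by (rule sum.mono_neutral_left) (use U in \<open>auto simp: U_def\<close>)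
    moreover have "(\<Sum>lam | h lam \<noteq> 0. h lam * (hl_b q lam * PA lam A)) = (\<Sum>lam\<in>U. h lam * (hl_b q lam * PA lam A))"
      by (rule sum.mono_neutral_left) (use U in \<open>auto simp: U_def\<close>)
    moreover have "(\<Sum>lam | g lam \<noteq> 0. g lam * (hl_b q lam * PA lam A)) = (\<Sum>lam | h lam \<noteq> 0. h lam * (hl_b q lam * PA lam A))"
      using g h that by (simp add: is_coeff_def)
    ultimately show ?thesis by (simp add: left_diff_distrib sum_subtractf mult.assoc)
  qed
  show "g = h"
  proof
    fix lam show "g lam = h lam"
    proof (cases "lam \<in> U")
      case True
      have "(g lam - h lam) * hl_b q lam = 0"
        by (rule PA_linear_independent[where c = "\<lambda>lam. (g lam - h lam) * hl_b q lam", OF U z True])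
      then show ?thesis using hl_b_pos[of lam] U True by auto
    qed (auto simp: U_def)
  qed
qed

lemma hl_coeff_is_coeff:
  assumes "mu \<in> partitions" "nu \<in> partitions" shows "is_coeff mu nu (hl_coeff q mu nu)"
  unfolding hl_coeff_def is_coeff_iff using is_coeff_ex1[OF assms] by (rule theI')

text \<open>Compare the values at \<open>A\<close> and at \<open>2 A\<close>.\<close>

lemma hl_coeff_size:
  assumes mu: "mu \<in> partitions" and nu: "nu \<in> partitions" and ne: "hl_coeff q mu nu lam \<noteq> 0"
  shows "part_size lam = part_size mu + part_size nu"
proof -
  define g where "g = hl_coeff q mu nu"
  have g: "is_coeff mu nu g" unfolding g_def by (rule hl_coeff_is_coeff[OF mu nu])
  define U where "U = {lam. g lam \<noteq> 0}"
  have U: "finite U" "U \<subseteq> partitions" using g by (auto simp: U_def is_coeff_def)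
  let ?s = "part_size mu + part_size nu"
  have eq: "(hl_b q mu * PA mu A) * (hl_b q nu * PA nu A) = (\<Sum>lam\<in>U. g lam * (hl_b q lam * PA lam A))" if "finite A" for A
    using g that by (simp add: is_coeff_def U_def)
  have z: "(\<Sum>lam\<in>U. (g lam * hl_b q lam * (2 ^ part_size lam - 2 ^ ?s)) * PA lam A) = 0" if A: "finite A" for A
  proof -
    have "(\<Sum>lam\<in>U. g lam * (hl_b q lam * (2 ^ part_size lam * PA lam A))) = (\<Sum>lam\<in>U. g lam * (hl_b q lam * PA lam ((*) 2 ` A)))"
      by (rule sum.cong[OF refl]) (use U in \<open>auto simp: PA_scale\<close>)
    also have "\<dots> = (hl_b q mu * PA mu ((*) 2 ` A)) * (hl_b q nu * PA nu ((*) 2 ` A))"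
      using eq[of "(*) 2 ` A"] A by simp
    also have "\<dots> = 2 ^ ?s * ((hl_b q mu * PA mu A) * (hl_b q nu * PA nu A))"
      by (simp add: PA_scale mu nu power_add)
    also have "\<dots> = (\<Sum>lam\<in>U. 2 ^ ?s * (g lam * (hl_b q lam * PA lam A)))"
      unfolding eq[OF A] by (rule sum_distrib_left)
    finally show ?thesis by (simp add: algebra_simps sum_subtractf)
  qed
  have lU: "lam \<in> U" using ne by (simp add: U_def g_def)
  have "g lam * hl_b q lam * (2 ^ part_size lam - 2 ^ ?s) = 0"
    by (rule PA_linear_independent[where c = "\<lambda>lam. g lam * hl_b q lam * (2 ^ part_size lam - 2 ^ ?s)", OF U z lU])
  then have "(2 :: real) ^ part_size lam = 2 ^ ?s" using hl_b_pos[of lam] lU U ne by (auto simp: g_def)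
  then show ?thesis by simp
qed

section \<open>Principal specialisations and the surjection numbers\<close>

text \<open>
  At \<open>1, q, q\<^sup>2, \<dots>\<close> only the identity permutation contributes: a point
  \<open>x = q y\<close> cannot be taken before \<open>y\<close>.
\<close>

lemma hlsym_principal:
  "hlsym as empty_ind ((\<lambda>i. q ^ i) ` {k..<k + length as}) =
     (\<Prod>i<length as. (q ^ (k + i)) ^ (as ! i)) * qf (length as) / (1 - q) ^ length as"
proof (induction as arbitrary: k)
  case Nil then show ?case by (simp add: empty_ind_def)
next
  case (Cons a as)
  define n where "n = length as"
  define A where "A = (\<lambda>i. q ^ i) ` {k..<k + Suc n}"
  define B where "B = (\<lambda>i. q ^ i) ` {Suc k..<Suc k + n}"
  have inj: "inj_on (\<lambda>i. q ^ i) I" for I :: "nat set"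
    by (rule inj_onI) (use q_pos q_less_1 in \<open>simp add: power_inject_exp'\<close>)
  have "{k..<k + Suc n} = insert k {Suc k..<Suc k + n}" by auto
  then have A: "A = insert (q ^ k) B" by (simp add: A_def B_def)
  have kB: "q ^ k \<notin> B"
  proof
    assume "q ^ k \<in> B"
    then obtain i where "i \<in> {Suc k..<Suc k + n}" "q ^ k = q ^ i" by (auto simp: B_def)
    then show False using inj_onD[OF inj[of UNIV], of k i] by auto
  qed
  have fin: "finite B" by (simp add: B_def)
  have zero: "psi x A = 0" if "x \<in> B" for x
  proof -
    obtain i where i: "x = q ^ i" "Suc k \<le> i" "i < Suc k + n" using \<open>x \<in> B\<close> by (auto simp: B_def)
    have "i - 1 \<in> {k..<k + Suc n}" using i by auto
    then have "q ^ (i - 1) \<in> A" unfolding A_def by (rule imageI)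
    moreover have "q ^ (i - 1) \<noteq> x" using inj_onD[OF inj[of UNIV], of "i - 1" i] i by auto
    moreover have "x - q * q ^ (i - 1) = 0" using i by (cases i) auto
    ultimately show ?thesis
      unfolding psi_def using fin A by (intro prod_zero bexI[of _ "q ^ (i - 1)"]) auto
  qed
  have psik: "psi (q ^ k) A = (1 - q ^ Suc n) / (1 - q)"
  proof -
    have "psi (q ^ k) A = (\<Prod>y\<in>B. (q ^ k - q * y) / (q ^ k - y))" using A kB by (simp add: psi_def)
    also have "\<dots> = (\<Prod>i\<in>{Suc k..<Suc k + n}. (q ^ k - q * q ^ i) / (q ^ k - q ^ i))"
      unfolding B_def by (subst prod.reindex[OF inj]) simp
    also have "\<dots> = (\<Prod>j<n. (1 - q ^ Suc (Suc j)) / (1 - q ^ Suc j))"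
    proof (rule prod.reindex_bij_witness[where i = "\<lambda>j. Suc k + j" and j = "\<lambda>i. i - Suc k"])
      fix i assume i: "i \<in> {Suc k..<Suc k + n}"
      define j where "j = i - Suc k"
      have ij: "i = k + Suc j" using i by (simp add: j_def)
      have "(q ^ k - q * q ^ i) / (q ^ k - q ^ i) = (q ^ k * (1 - q ^ Suc (Suc j))) / (q ^ k * (1 - q ^ Suc j))"
        by (simp add: ij power_add algebra_simps)
      then show "(1 - q ^ Suc (Suc (i - Suc k))) / (1 - q ^ Suc (i - Suc k)) = (q ^ k - q * q ^ i) / (q ^ k - q ^ i)"
        using q_pos by (simp add: j_def)
    qed auto
    also have "\<dots> = (1 - q ^ Suc n) / (1 - q)"
    proof (induction n)
      case (Suc n)
      have "1 - q ^ Suc n \<noteq> 0" using pow_less_1[of "Suc n"] by auto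
      then show ?case using Suc by simp
    qed (use q_less_1 in simp)
    finally show ?thesis .
  qed
  have "hlsym (a # as) empty_ind A = (q ^ k) ^ a * psi (q ^ k) A * hlsym as empty_ind (A - {q ^ k})
      + (\<Sum>x\<in>B. x ^ a * psi x A * hlsym as empty_ind (A - {x}))"
    using A fin kB by (simp add: sum.insert)
  also have "(\<Sum>x\<in>B. x ^ a * psi x A * hlsym as empty_ind (A - {x})) = 0" by (rule sum.neutral) (simp add: zero)
  also have "A - {q ^ k} = B" using A kB by auto
  finally have "hlsym (a # as) empty_ind A = (q ^ k) ^ a * ((1 - q ^ Suc n) / (1 - q)) *
      ((\<Prod>i<n. (q ^ (Suc k + i)) ^ (as ! i)) * qf n / (1 - q) ^ n)"
    using Cons[of "Suc k"] psik by (simp only: B_def n_def add_0_right)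
  moreover have "(\<Prod>i<Suc n. (q ^ (k + i)) ^ ((a # as) ! i)) = (q ^ k) ^ a * (\<Prod>i<n. (q ^ (Suc k + i)) ^ (as ! i))"
    by (simp only: prod.lessThan_Suc_shift) simp
  ultimately show ?case unfolding A_def by (simp add: n_def qf_Suc)
qed

lemma hl_v_hl_b:
  assumes "lam \<in> partitions" "part_length lam \<le> n"
  shows "hl_v q n lam = qf (n - part_length lam) * hl_b q lam / (1 - q) ^ n"
  unfolding hl_v_eq[OF assms order_refl] hl_b_eq[OF assms(1) order_refl] part_length_eq[OF assms(1)]
    lessThan_Suc_atMost[symmetric] prod.lessThan_Suc_shift by simp

lemma hl_P_principal:
  assumes lam: "lam \<in> partitions" and len: "part_length lam \<le> n"
  shows "hl_P q n lam (\<lambda>i. q ^ i) = q ^ part_n lam / hl_b q lam * (qf n / qf (n - part_length lam))"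
proof -
  have inj: "inj_on (\<lambda>i. q ^ i) {..<n}"
    using q_pos q_less_1 by (auto simp: inj_on_def power_inject_exp')
  then have card: "card ((\<lambda>i. q ^ i) ` {..<n}) = n" by (simp add: card_image)
  have "(\<Prod>i<n. (q ^ i) ^ lam i) = q ^ part_n lam"
    by (simp add: part_n_eq_rows[OF lam len] power_sum power_mult)
  then have "hlsym (map lam [0..<n]) empty_ind ((\<lambda>i. q ^ i) ` {..<n}) = q ^ part_n lam * qf n / (1 - q) ^ n"
    using hlsym_principal[of "map lam [0..<n]" 0] by (simp add: atLeast0LessThan)
  then show ?thesis
    using len q_less_1 by (simp add: hl_P_eq[OF inj] PA_def card hl_v_hl_b[OF lam len])
qed

lemma qf_ratio_tendsto: "(\<lambda>n. qf n / qf (n - l)) \<longlonglongrightarrow> 1"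
proof (rule LIMSEQ_offset[where k = l])
  have "(\<lambda>n. qf (n + l) / qf n) \<longlonglongrightarrow> 1"
  proof (induction l)
    case (Suc l)
    have "(\<lambda>n. q ^ n * q ^ Suc l) \<longlonglongrightarrow> 0 * q ^ Suc l"
      by (intro tendsto_intros LIMSEQ_realpow_zero) (use q_pos q_less_1 in auto)
    then have "(\<lambda>n. qf (n + l) / qf n * (1 - q ^ n * q ^ Suc l)) \<longlonglongrightarrow> 1 * (1 - 0)"
      by (intro tendsto_mult Suc tendsto_diff tendsto_const) simp
    then show ?case by (simp add: qf_Suc power_add mult_ac)
  qed simp
  then show "(\<lambda>n. qf (n + l) / qf (n + l - l)) \<longlonglongrightarrow> 1" by simp
qed

text \<open>\<open>hl_P_inf\<close> is a \<open>lim\<close>, so convergence has to be shown: the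
  value in \<open>n\<close> variables differs from the limit by the ratio
  \<open>qf n / qf (n - part_length lam)\<close>, which tends to 1.\<close>

lemma hl_P_inf_principal:
  assumes lam: "lam \<in> partitions"
  shows "hl_P_inf q lam (\<lambda>i. q ^ i) = q ^ part_n lam / hl_b q lam"
proof -
  have "(\<lambda>n. q ^ part_n lam / hl_b q lam * (qf n / qf (n - part_length lam))) \<longlonglongrightarrow> q ^ part_n lam / hl_b q lam * 1"
    by (intro tendsto_mult tendsto_const qf_ratio_tendsto)
  moreover have "eventually (\<lambda>n. q ^ part_n lam / hl_b q lam * (qf n / qf (n - part_length lam)) = hl_P q n lam (\<lambda>i. q ^ i)) sequentially"
    using eventually_ge_at_top[of "part_length lam"] by eventually_elim (simp add: hl_P_principal[OF lam])
  ultimately have "(\<lambda>n. hl_P q n lam (\<lambda>i. q ^ i)) \<longlonglongrightarrow> q ^ part_n lam / hl_b q lam * 1"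
    by (rule Lim_transform_eventually)
  then show ?thesis by (simp add: hl_P_inf_def limI)
qed

lemma hl_P_inf_principal_Suc:
  assumes lam: "lam \<in> partitions"
  shows "hl_P_inf q lam (\<lambda>i. q ^ Suc i) = q ^ part_size lam * q ^ part_n lam / hl_b q lam"
proof -
  have "(\<lambda>n. q ^ part_n lam / hl_b q lam * (qf n / qf (n - part_length lam))) \<longlonglongrightarrow> q ^ part_n lam / hl_b q lam * 1"
    by (intro tendsto_mult tendsto_const qf_ratio_tendsto)
  then have "(\<lambda>n. q ^ part_size lam * (q ^ part_n lam / hl_b q lam * (qf n / qf (n - part_length lam))))
      \<longlonglongrightarrow> q ^ part_size lam * (q ^ part_n lam / hl_b q lam * 1)"
    by (rule tendsto_mult[OF tendsto_const])
  moreover have "eventually (\<lambda>n. q ^ part_size lam * (q ^ part_n lam / hl_b q lam * (qf n / qf (n - part_length lam)))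
      = hl_P q n lam (\<lambda>i. q ^ Suc i)) sequentially"
    using eventually_ge_at_top[of "part_length lam"]
  proof eventually_elim
    case (elim n)
    have inj: "inj_on (\<lambda>i. q ^ i) {..<n}"
      using q_pos q_less_1 by (auto simp: inj_on_def power_inject_exp')
    have inj': "inj_on (\<lambda>i. q ^ Suc i) {..<n}"
      using q_pos q_less_1 by (auto simp: inj_on_def power_inject_exp')
    have "(\<lambda>i. q ^ Suc i) ` {..<n} = (*) q ` (\<lambda>i. q ^ i) ` {..<n}" by (simp add: image_image)
    then have "hl_P q n lam (\<lambda>i. q ^ Suc i) = q ^ part_size lam * hl_P q n lam (\<lambda>i. q ^ i)"
      using PA_scale[OF _ lam, of q "(\<lambda>i. q ^ i) ` {..<n}"] q_pos
      by (simp only: hl_P_eq[OF inj] hl_P_eq[OF inj'])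
    then show ?case by (simp add: hl_P_principal[OF lam elim])
  qed
  ultimately have "(\<lambda>n. hl_P q n lam (\<lambda>i. q ^ Suc i)) \<longlonglongrightarrow> q ^ part_size lam * (q ^ part_n lam / hl_b q lam * 1)"
    by (rule Lim_transform_eventually)
  then show ?thesis by (simp add: hl_P_inf_def limI)
qed

text \<open>At \<open>q, q^2, ...\<close> the function \<open>P_nu\<close> takes the value
  \<open>q^m q^(n(nu)) / b_nu\<close>, where \<open>m\<close> is the size of \<open>nu\<close>.
  Summing \<open>Q_mu Q_nu\<close> with these weights gives \<open>q^m Q_mu\<close> times the
  complete symmetric function of degree \<open>m\<close>. Its expansion is
  \<open>complete_Pieri\<close>, and linear independence isolates the coefficient of
  \<open>lam\<close>.\<close>

lemma hl_skew_eq: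
  assumes lam: "lam \<in> partitions" and mu: "mu \<in> partitions"
  shows "hl_skew_P_inf q lam mu (\<lambda>i. q ^ Suc i) =
    q ^ (part_size lam - part_size mu) * hl_b q mu / hl_b q lam * sk lam mu"
proof (cases "part_size mu \<le> part_size lam")
  case False
  have "{nu. nu \<in> partitions \<and> hl_coeff q mu nu lam \<noteq> 0} = {}"
    using hl_coeff_size[OF mu] False by fastforce
  moreover have "sk lam mu = 0" using cj_le_size[OF mu lam] sk_zero_cases False by blast
  ultimately show ?thesis by (simp only: hl_skew_P_inf_def sum.empty mult_zero_right)
next
  case True
  then obtain m where m: "part_size lam = part_size mu + m" using le_Suc_ex by blast
  define X where "X = {nu \<in> partitions. part_size nu = m}"
  have X: "finite X" "X \<subseteq> partitions"
    using finite_subset[OF _ finite_partitions_size[of m], of X] by (auto simp: X_def)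
  define w where "w nu = q ^ m * q ^ part_n nu / hl_b q nu" for nu
  define g where "g k = (\<Sum>nu\<in>X. hl_coeff q mu nu k * w nu)" for k
  have skew: "hl_skew_P_inf q lam mu (\<lambda>i. q ^ Suc i) = g lam"
  proof -
    have "hl_skew_P_inf q lam mu (\<lambda>i. q ^ Suc i) =
       (\<Sum>nu\<in>X. hl_coeff q mu nu lam * hl_P_inf q nu (\<lambda>i. q ^ Suc i))"
      unfolding hl_skew_P_inf_def
    proof (rule sum.mono_neutral_left[OF X(1)])
      show "{nu. nu \<in> partitions \<and> hl_coeff q mu nu lam \<noteq> 0} \<subseteq> X"
        using hl_coeff_size[OF mu] m by (fastforce simp: X_def)
    qed (auto simp: X_def)
    also have "\<dots> = g lam"
      unfolding g_def by (rule sum.cong) (auto simp: w_def X_def hl_P_inf_principal_Suc[unfolded power_Suc])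
    finally show ?thesis .
  qed
  have supp: "{k. hl_coeff q mu nu k \<noteq> 0} \<subseteq> part_add mu m" if "nu \<in> X" for nu
    using that hl_coeff_size[OF mu] hl_coeff_is_coeff[OF mu, of nu]
    by (fastforce simp: X_def part_add_def is_coeff_def)
  have key: "(\<Sum>k\<in>part_add mu m. (g k * hl_b q k - q ^ m * hl_b q mu * sk k mu) * PA k A) = 0" if A: "finite A" for A
  proof -
    have "(\<Sum>k\<in>part_add mu m. g k * (hl_b q k * PA k A)) =
        (\<Sum>nu\<in>X. w nu * (\<Sum>k\<in>part_add mu m. hl_coeff q mu nu k * (hl_b q k * PA k A)))"
      unfolding g_def sum_distrib_left sum_distrib_right
      by (subst sum.swap) (simp add: mult_ac)
    also have "\<dots> = (\<Sum>nu\<in>X. w nu * ((hl_b q mu * PA mu A) * (hl_b q nu * PA nu A)))"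
    proof (rule sum.cong[OF refl])
      fix nu assume nu: "nu \<in> X"
      have "(\<Sum>k\<in>part_add mu m. hl_coeff q mu nu k * (hl_b q k * PA k A)) =
          (\<Sum>k | hl_coeff q mu nu k \<noteq> 0. hl_coeff q mu nu k * (hl_b q k * PA k A))"
        by (rule sum.mono_neutral_right) (use supp[OF nu] finite_part_add in auto)
      also have "\<dots> = (hl_b q mu * PA mu A) * (hl_b q nu * PA nu A)"
        using hl_coeff_is_coeff[OF mu, of nu] nu A by (simp add: is_coeff_def X_def)
      finally show "w nu * (\<Sum>k\<in>part_add mu m. hl_coeff q mu nu k * (hl_b q k * PA k A)) =
          w nu * ((hl_b q mu * PA mu A) * (hl_b q nu * PA nu A))" by simp
    qed
    also have "\<dots> = q ^ m * hl_b q mu * ((\<Sum>nu\<in>X. q ^ part_n nu * PA nu A) * PA mu A)"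
      unfolding sum_distrib_left sum_distrib_right
    proof (rule sum.cong[OF refl])
      fix nu assume "nu \<in> X"
      then have "hl_b q nu > 0" using hl_b_pos X by auto
      then show "w nu * ((hl_b q mu * PA mu A) * (hl_b q nu * PA nu A)) =
        q ^ m * hl_b q mu * (q ^ part_n nu * PA nu A * PA mu A)" by (simp add: w_def)
    qed
    also have "\<dots> = q ^ m * hl_b q mu * (\<Sum>k\<in>part_add mu m. sk k mu * PA k A)"
      using complete_Pieri[OF A mu, of m] by (simp add: X_def part_add_def)
    also have "\<dots> = (\<Sum>k\<in>part_add mu m. q ^ m * hl_b q mu * sk k mu * PA k A)"
      by (simp add: sum_distrib_left mult.assoc)
    finally show ?thesis by (simp add: left_diff_distrib sum_subtractf mult.assoc)
  qed
  have "g lam * hl_b q lam - q ^ m * hl_b q mu * sk lam mu = 0"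
    by (rule PA_linear_independent[where c = "\<lambda>k. g k * hl_b q k - q ^ m * hl_b q mu * sk k mu",
          OF finite_part_add _ key]) (use lam m in \<open>auto simp: part_add_def\<close>)
  then show ?thesis using hl_b_pos[OF lam] m unfolding skew by (simp add: field_simps)
qed

text \<open>A zero occurs for \<open>b \<le> l < a\<close> but not for \<open>l < b\<close>. A
  product of such factors therefore detects whether the columns of \<open>mu\<close> fit into those
  of \<open>lam\<close> only through their interplay.\<close>

definition sur_factor :: "nat \<Rightarrow> nat \<Rightarrow> nat \<Rightarrow> real" where
  "sur_factor a b l = (1 / q) ^ (a * l) * (\<Prod>j=b..<a. 1 - (1 / q) ^ j * q ^ l)"

lemma qf_ratio: "m \<le> n \<Longrightarrow> qf n = qf m * (\<Prod>j<n - m. 1 - q ^ (n - j))"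
proof (induction "n - m" arbitrary: m)
  case (Suc d)
  then have "qf n = qf (Suc m) * (\<Prod>j<n - Suc m. 1 - q ^ (n - j))" by simp
  moreover have "n - m = Suc (n - Suc m)" "n - (n - Suc m) = Suc m" using Suc by auto
  ultimately show ?case by (simp add: qf_Suc)
qed simp

lemma sur_factor_eq:
  assumes "b \<le> a" "a \<le> l"
  shows "q ^ ((l - a) choose 2) * qb (l - b) (l - a) / q ^ (l choose 2) =
    (1 / q) ^ (a choose 2) * q ^ (a * a) / qf (a - b) * sur_factor a b l"
proof -
  have ch: "(l choose 2) + a * a = ((l - a) choose 2) + (a choose 2) + a * l"
  proof -
    have r: "real (n choose 2) = real n * (real n - 1) / 2" for n
      by (induction n) (simp_all add: numeral_2_eq_2 field_simps)
    have "real ((l choose 2) + a * a) = real (((l - a) choose 2) + (a choose 2) + a * l)"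
      using assms by (simp add: r of_nat_diff field_simps)
    then show ?thesis by (simp only: of_nat_eq_iff)
  qed
  have "qf (l - b) = qf (l - a) * (\<Prod>j<a - b. 1 - q ^ (l - b - j))"
    using qf_ratio[of "l - a" "l - b"] assms by simp
  also have "(\<Prod>j<a - b. 1 - q ^ (l - b - j)) = (\<Prod>j=b..<a. 1 - (1 / q) ^ j * q ^ l)"
  proof (rule prod.reindex_bij_witness[where i = "\<lambda>j. j - b" and j = "\<lambda>j. j + b"])
    fix j assume "j \<in> {..<a - b}"
    then have "(l - b - j) + (j + b) = l" using assms by simp
    then have "q ^ l = q ^ (l - b - j) * q ^ (j + b)" by (simp only: power_add[symmetric])
    then show "1 - (1 / q) ^ (j + b) * q ^ l = 1 - q ^ (l - b - j)" using q_pos by (simp add: power_one_over)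
  qed auto
  finally have "qb (l - b) (l - a) = (\<Prod>j=b..<a. 1 - (1 / q) ^ j * q ^ l) / qf (a - b)"
    using assms by (simp add: qb_def diff_le_mono2)
  moreover have "q ^ ((l - a) choose 2) / q ^ (l choose 2) = (1 / q) ^ (a choose 2) * q ^ (a * a) * (1 / q) ^ (a * l)"
  proof -
    have "q ^ (l choose 2) * q ^ (a * a) = q ^ ((l - a) choose 2) * q ^ (a choose 2) * q ^ (a * l)"
      by (simp only: power_add[symmetric] ch)
    then show ?thesis using q_pos by (simp add: power_one_over divide_simps mult_ac)
  qed
  moreover have "x * y / z = (x / z) * y" for x y z :: real by simp
  ultimately have "q ^ ((l - a) choose 2) * qb (l - b) (l - a) / q ^ (l choose 2) =
      ((1 / q) ^ (a choose 2) * q ^ (a * a) * (1 / q) ^ (a * l)) * ((\<Prod>j=b..<a. 1 - (1 / q) ^ j * q ^ l) / qf (a - b))"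
    by (simp only:)
  then show ?thesis by (simp only: sur_factor_def times_divide_eq_right times_divide_eq_left mult.assoc)
qed

lemma sk_sur_factor:
  assumes lam: "lam \<in> partitions" and mu: "mu \<in> partitions"
  shows "sk lam mu / q ^ part_n lam =
    (\<Prod>i<mu 0. (1 / q) ^ (cj mu i choose 2) * q ^ (cj mu i * cj mu i) / qf (cj mu i - cj mu (Suc i))) *
    (\<Prod>i<mu 0. sur_factor (cj mu i) (cj mu (Suc i)) (cj lam i))"
proof (cases "\<forall>i. cj mu i \<le> cj lam i")
  case True
  define N where "N = lam 0 + mu 0"
  have "q ^ part_n lam = (\<Prod>i<N. q ^ (cj lam i choose 2))"
    by (subst part_n_eq[OF lam, of N]) (simp_all add: N_def power_sum)
  then have "sk lam mu / q ^ part_n lam =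
     (\<Prod>i<N. q ^ ((cj lam i - cj mu i) choose 2) * qb (cj lam i - cj mu (Suc i)) (cj lam i - cj mu i) / q ^ (cj lam i choose 2))"
    using sk_eq[OF lam, of N mu] True by (simp add: N_def prod_dividef)
  also have "\<dots> = (\<Prod>i<N. (1 / q) ^ (cj mu i choose 2) * q ^ (cj mu i * cj mu i) / qf (cj mu i - cj mu (Suc i)) *
      sur_factor (cj mu i) (cj mu (Suc i)) (cj lam i))"
    by (rule prod.cong[OF refl], rule sur_factor_eq) (use cj_antimono[OF mu] True in auto)
  also have "\<dots> = (\<Prod>i<mu 0. (1 / q) ^ (cj mu i choose 2) * q ^ (cj mu i * cj mu i) / qf (cj mu i - cj mu (Suc i)) *
      sur_factor (cj mu i) (cj mu (Suc i)) (cj lam i))"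
  proof (rule prod.mono_neutral_right)
    show "\<forall>i\<in>{..<N} - {..<mu 0}. (1 / q) ^ (cj mu i choose 2) * q ^ (cj mu i * cj mu i) / qf (cj mu i - cj mu (Suc i)) *
      sur_factor (cj mu i) (cj mu (Suc i)) (cj lam i) = 1"
    proof
      fix i assume "i \<in> {..<N} - {..<mu 0}"
      then have "cj mu i = 0" "cj mu (Suc i) = 0" using cj_zero_iff[OF mu] by auto
      then show "(1 / q) ^ (cj mu i choose 2) * q ^ (cj mu i * cj mu i) / qf (cj mu i - cj mu (Suc i)) *
        sur_factor (cj mu i) (cj mu (Suc i)) (cj lam i) = 1" by (simp add: sur_factor_def numeral_2_eq_2)
    qed
  qed (auto simp: N_def)
  finally show ?thesis by (simp only: prod.distrib)
next
  case False
  define I where "I = {i. cj lam i < cj mu i}"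
  have sub: "I \<subseteq> {..<mu 0}"
  proof
    fix i assume "i \<in> I"
    then have "cj mu i \<noteq> 0" by (simp add: I_def)
    then show "i \<in> {..<mu 0}" using cj_zero_iff[OF mu, of i] by simp
  qed
  then have fin: "finite I" by (rule finite_subset) simp
  have ne: "I \<noteq> {}" using False by (auto simp: I_def not_le)
  \<comment> \<open>The last violated column is the right one: the next column of \<open>mu\<close>
    fits again, so \<open>cj mu (Suc i) \<le> cj lam i < cj mu i\<close>, the range in which the
    factor vanishes.\<close>
  define i where "i = Max I"
  have i: "i \<in> I" using Max_in[OF fin ne] by (simp add: i_def)
  have "Suc i \<notin> I" using Max_ge[OF fin, of "Suc i"] by (auto simp: i_def)
  then have "cj mu (Suc i) \<le> cj lam i"
    using cj_antimono[OF lam, of i "Suc i"] by (simp add: I_def)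
  moreover have "cj lam i < cj mu i" using i by (simp add: I_def)
  ultimately have "sur_factor (cj mu i) (cj mu (Suc i)) (cj lam i) = 0"
    unfolding sur_factor_def using q_pos
    by (subst prod_zero) (auto intro!: bexI[of _ "cj lam i"] simp: power_one_over)
  then have "(\<Prod>i<mu 0. sur_factor (cj mu i) (cj mu (Suc i)) (cj lam i)) = 0"
    using i sub by (intro prod_zero) auto
  moreover have "sk lam mu = 0" using False by (auto simp: sk_def)
  ultimately show ?thesis by simp
qed

lemma sur_eq:
  assumes mu: "mu \<in> partitions"
  obtains K where "\<And>lam. lam \<in> partitions \<Longrightarrow>
    sur (1 / q) lam mu = K * (\<Prod>i<mu 0. sur_factor (cj mu i) (cj mu (Suc i)) (cj lam i))"
proof
  define K1 where "K1 = (\<Prod>i<mu 0. (1 / q) ^ (cj mu i choose 2) * q ^ (cj mu i * cj mu i) / qf (cj mu i - cj mu (Suc i)))"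
  fix lam assume lam: "lam \<in> partitions"
  have bm: "hl_b q mu > 0" and bl: "hl_b q lam > 0" using hl_b_pos mu lam by auto
  have "sur (1 / q) lam mu = (q ^ (part_size lam - part_size mu) * hl_b q mu / hl_b q lam * sk lam mu) /
     ((q ^ part_size lam * q ^ part_n lam / hl_b q lam) * (hl_b q mu * (q ^ part_n mu / hl_b q mu)))"
    unfolding sur_def Let_def hl_Q_inf_def
    by (simp add: hl_skew_eq[OF lam mu, unfolded power_Suc] hl_P_inf_principal_Suc[OF lam, unfolded power_Suc] hl_P_inf_principal[OF mu])
  also have "\<dots> = hl_b q mu / q ^ part_n mu * ((q ^ (part_size lam - part_size mu) / q ^ part_size lam) * (sk lam mu / q ^ part_n lam))"
    using bm bl by (simp add: field_simps)
  also have "(q ^ (part_size lam - part_size mu) / q ^ part_size lam) * (sk lam mu / q ^ part_n lam) =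
      1 / q ^ part_size mu * (sk lam mu / q ^ part_n lam)"
  proof (cases "sk lam mu = 0")
    case False
    then have "part_size mu \<le> part_size lam" using cj_le_size[OF mu lam] sk_zero_cases by blast
    then have "q ^ part_size lam = q ^ (part_size lam - part_size mu) * q ^ part_size mu"
      by (simp only: power_add[symmetric] le_add_diff_inverse2)
    then show ?thesis using q_pos by simp
  qed simp
  also have "hl_b q mu / q ^ part_n mu * (1 / q ^ part_size mu * (sk lam mu / q ^ part_n lam)) =
     (hl_b q mu / q ^ part_n mu * (1 / q ^ part_size mu) * K1) * (\<Prod>i<mu 0. sur_factor (cj mu i) (cj mu (Suc i)) (cj lam i))"
    unfolding sk_sur_factor[OF lam mu] K1_def by (simp only: mult_ac)
  finally show "sur (1 / q) lam mu =
     (hl_b q mu / q ^ part_n mu * (1 / q ^ part_size mu) * K1) * (\<Prod>i<mu 0. sur_factor (cj mu i) (cj mu (Suc i)) (cj lam i))" .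
qed

section \<open>Euler's identity and a theta function\<close>

lemma qpoch_inf_pos: "0 < x \<Longrightarrow> x < 1 \<Longrightarrow> qpoch_inf x q > 0"
  and qpoch_tendsto: "0 < x \<Longrightarrow> x < 1 \<Longrightarrow> (\<lambda>n. qpoch x q n) \<longlonglongrightarrow> qpoch_inf x q"
proof -
  assume x: "0 < x" "x < 1"
  have "summable (\<lambda>i. x * q ^ i)"
    by (intro summable_mult summable_geometric) (use q_pos q_less_1 in auto)
  then have "summable (\<lambda>i. norm ((1 - x * q ^ i) - 1))" using x q_pos by simp
  then have conv: "convergent_prod (\<lambda>i. 1 - x * q ^ i)"
    by (intro abs_convergent_prod_imp_convergent_prod summable_imp_abs_convergent_prod)
  have pos: "1 - x * q ^ i > 0" for i
  proof -
    have "q ^ i \<le> 1" using q_pos q_less_1 by (simp add: power_le_one)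
    then have "x * q ^ i \<le> x * 1" using x by (intro mult_left_mono) auto
    also have "x * 1 < 1" using x by simp
    finally show ?thesis by simp
  qed
  show "qpoch_inf x q > 0" unfolding qpoch_inf_def by (rule less_0_prodinf[OF conv pos])
  show "(\<lambda>n. qpoch x q n) \<longlonglongrightarrow> qpoch_inf x q"
    unfolding qpoch_inf_def qpoch_def using has_prod_imp_tendsto'[OF convergent_prod_has_prod[OF conv]] .
qed

text \<open>The infinite product \<open>(q; q)_inf\<close>. As a positive lower bound of all
  \<open>qf n\<close> it replaces the denominators in every estimate.\<close>

definition q0 :: real where "q0 = qpoch_inf q q"

lemma q0_pos: "q0 > 0" and q0_le: "q0 \<le> qf n"
proof -
  show "q0 > 0" unfolding q0_def by (rule qpoch_inf_pos[OF q_pos q_less_1])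
  have "decseq qf"
  proof (rule decseq_SucI)
    fix n
    have "qf (Suc n) \<le> qf n * 1"
      unfolding qf_Suc by (intro mult_left_mono) (use qf_pos[of n] q_pos in auto)
    then show "qf (Suc n) \<le> qf n" by simp
  qed
  then show "q0 \<le> qf n" unfolding q0_def
    using decseq_ge qpoch_tendsto[OF q_pos q_less_1] by blast
qed

definition gj :: "nat \<Rightarrow> real" where "gj j = (-1) ^ j * q ^ (j choose 2) / qf j"

text \<open>The entire function that Euler's identity equates with \<open>(x; q)_inf\<close>. It is
  handled through its functional equation and its values at integral powers of
  \<open>q\<close>.\<close>

definition eul :: "real \<Rightarrow> real" where "eul x = (\<Sum>\<^sub>\<infinity>j. gj j * x ^ j)"

lemma abs_gj_le: "\<bar>gj j\<bar> \<le> q ^ (j choose 2) / q0"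
  using q0_le[of j] q0_pos qf_pos[of j] q_pos by (simp add: gj_def abs_mult power_abs frac_le)

lemma gj_abs_summable: "Infinite_Sum.abs_summable_on (\<lambda>j. gj j * x ^ j) UNIV"
proof -
  define y where "y = \<bar>x\<bar> + 1"
  have "(\<lambda>n. q ^ n * y) \<longlonglongrightarrow> 0 * y"
    by (intro tendsto_intros LIMSEQ_realpow_zero) (use q_pos q_less_1 in auto)
  then have "eventually (\<lambda>n. q ^ n * y < 1 / 2) sequentially" by (rule order_tendstoD) simp
  then obtain N where N: "\<And>n. n \<ge> N \<Longrightarrow> q ^ n * y < 1 / 2" by (auto simp: eventually_sequentially)
  have "summable (\<lambda>j. q ^ (j choose 2) * y ^ j)"
  proof (rule summable_ratio_test[of "1 / 2" N])
    fix n assume n: "N \<le> n"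
    have "(Suc n choose 2) = n + (n choose 2)" by (simp add: numeral_2_eq_2)
    then have "q ^ (Suc n choose 2) * y ^ Suc n = (q ^ n * y) * (q ^ (n choose 2) * y ^ n)"
      by (simp add: power_add mult_ac)
    also have "\<dots> \<le> 1 / 2 * (q ^ (n choose 2) * y ^ n)"
      by (intro mult_right_mono less_imp_le N n) (use q_pos in \<open>auto simp: y_def\<close>)
    finally show "norm (q ^ (Suc n choose 2) * y ^ Suc n) \<le> 1 / 2 * norm (q ^ (n choose 2) * y ^ n)"
      using q_pos by (simp add: y_def)
  qed simp
  then have s: "summable (\<lambda>j. norm (q ^ (j choose 2) / q0 * y ^ j))"
    using q_pos q0_pos by (simp add: y_def summable_divide field_simps)
  have "Infinite_Sum.abs_summable_on (\<lambda>j. q ^ (j choose 2) / q0 * y ^ j) UNIV"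
    using norm_summable_imp_summable_on[of "\<lambda>j. norm (q ^ (j choose 2) / q0 * y ^ j)"] s by simp
  then show ?thesis
  proof (rule Infinite_Sum.abs_summable_on_comparison_test)
    fix j
    have "\<bar>gj j\<bar> * \<bar>x\<bar> ^ j \<le> q ^ (j choose 2) / q0 * y ^ j"
      by (intro mult_mono abs_gj_le power_mono) (use q_pos q0_pos in \<open>auto simp: y_def\<close>)
    also have "\<dots> = norm (q ^ (j choose 2) / q0 * y ^ j)" using q_pos q0_pos by (simp add: y_def)
    finally show "norm (gj j * x ^ j) \<le> norm (q ^ (j choose 2) / q0 * y ^ j)"
      by (simp add: abs_mult power_abs)
  qed
qed

lemma gj_summable: "(\<lambda>j. gj j * x ^ j) summable_on UNIV"
  by (rule Infinite_Sum.abs_summable_summable[OF gj_abs_summable])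

lemma eul_sums: "(\<lambda>j. gj j * x ^ j) sums eul x"
  unfolding eul_def by (rule has_sum_imp_sums) (rule has_sum_infsum[OF gj_summable])

lemma eul_funeq: "eul x = (1 - x) * eul (q * x)"
proof -
  have "(\<lambda>j. gj j * x ^ j - gj j * (q * x) ^ j) sums (eul x - eul (q * x))"
    by (intro sums_diff eul_sums)
  moreover have "gj 0 * x ^ 0 - gj 0 * (q * x) ^ 0 = 0" by simp
  ultimately have "(\<lambda>j. gj (Suc j) * x ^ Suc j - gj (Suc j) * (q * x) ^ Suc j) sums (eul x - eul (q * x))"
    by (subst sums_Suc_iff) simp
  moreover have "gj (Suc j) * x ^ Suc j - gj (Suc j) * (q * x) ^ Suc j = (- x) * (gj j * (q * x) ^ j)" for j
  proof -
    have "1 - q ^ Suc j \<noteq> 0" using pow_less_1[of "Suc j"] by simp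
    moreover have "(Suc j choose 2) = j + (j choose 2)" by (simp add: numeral_2_eq_2)
    moreover have "gj (Suc j) * x ^ Suc j - gj (Suc j) * (q * x) ^ Suc j = gj (Suc j) * (1 - q ^ Suc j) * x ^ Suc j"
      by (simp add: power_mult_distrib algebra_simps)
    ultimately show ?thesis
      by (simp add: gj_def qf_Suc power_mult_distrib power_add del: power_Suc)
        (simp add: mult_ac)
  qed
  ultimately have "(\<lambda>j. (- x) * (gj j * (q * x) ^ j)) sums (eul x - eul (q * x))" by simp
  moreover have "(\<lambda>j. (- x) * (gj j * (q * x) ^ j)) sums ((- x) * eul (q * x))"
    by (intro sums_mult eul_sums)
  ultimately have "eul x - eul (q * x) = (- x) * eul (q * x)" by (rule sums_unique2)
  then show ?thesis by (simp add: algebra_simps)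
qed

lemma eul_neg: "eul (q powi (- int m)) = 0"
proof (induction m)
  case 0 then show ?case using eul_funeq[of 1] by simp
next
  case (Suc m)
  have "q * q powi (- int (Suc m)) = q powi (- int m)"
    using q_pos power_int_add_1[of q "- int (Suc m)"] by (simp add: mult.commute)
  then show ?case using eul_funeq[of "q powi (- int (Suc m))"] Suc by simp
qed

lemma eul_pos: "eul (q ^ Suc n) = eul q / qf n"
proof (induction n)
  case (Suc n)
  have nz: "1 - q ^ Suc n \<noteq> 0" using pow_less_1[of "Suc n"] by simp
  have "eul q / qf n = (1 - q ^ Suc n) * eul (q ^ Suc (Suc n))"
    using eul_funeq[of "q ^ Suc n"] Suc by simp
  then have "eul q = eul (q ^ Suc (Suc n)) * (qf n * (1 - q ^ Suc n))"
    using qf_pos[of n] by (simp add: divide_eq_eq mult_ac del: power_Suc)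
  then show ?case using nz qf_pos[of n] by (simp add: qf_Suc del: power_Suc)
qed simp

text \<open>A zero at \<open>q\<close> would propagate to all \<open>q ^ Suc n\<close> by the
  functional equation, whereas \<open>eul\<close> tends to 1 at 0.\<close>

lemma eul_q_nonzero: "eul q \<noteq> 0"
proof
  assume "eul q = 0"
  then have z: "eul (q ^ Suc n) = 0" for n by (simp add: eul_pos del: power_Suc)
  have "(eul \<longlongrightarrow> gj 0) (at 0)"
    by (rule powser_limit_0[of 1]) (auto intro: eul_sums)
  moreover have "filterlim (\<lambda>n. q ^ Suc n) (at 0) sequentially"
    unfolding filterlim_at
  proof
    show "(\<lambda>n. q ^ Suc n) \<longlonglongrightarrow> 0"
      using q_pos q_less_1 by (intro LIMSEQ_Suc LIMSEQ_realpow_zero) auto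
  qed (use q_pos in auto)
  ultimately have "(\<lambda>n. eul (q ^ Suc n)) \<longlonglongrightarrow> gj 0" by (rule filterlim_compose)
  then show False using z by (simp add: gj_def tendsto_const_iff)
qed

text \<open>The point of Euler's series here: a single power series in \<open>q powi n\<close>
  represents \<open>1 / qf n\<close> for \<open>n \<ge> 0\<close> and 0 for \<open>n < 0\<close>, so
  a sum over \<open>n \<ge> 0\<close> can be extended to all integers.\<close>

lemma eul_int: "eul (q powi (n + 1)) = (if n < 0 then 0 else eul q / qf (nat n))"
proof (cases "n < 0")
  case True
  then have e: "n + 1 = - int (nat (- n - 1))" by simp
  have "eul (q powi (n + 1)) = 0" unfolding e by (rule eul_neg)
  then show ?thesis using True by simp
next
  case False
  then have "q powi (n + 1) = q ^ Suc (nat n)" by (simp add: power_int_def nat_add_distrib)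
  then show ?thesis using eul_pos False by simp
qed

text \<open>Quadratic exponents decay at least geometrically.\<close>

lemma gauss_le: "q powr (x\<^sup>2 / 2 + b * x) \<le> q powr (- (\<bar>b\<bar> + 1)\<^sup>2 / 2) * q powr \<bar>x\<bar>"
proof -
  have "0 \<le> (\<bar>x\<bar> - (\<bar>b\<bar> + 1))\<^sup>2" by simp
  also have "\<dots> = \<bar>x\<bar>\<^sup>2 - 2 * (\<bar>b\<bar> + 1) * \<bar>x\<bar> + (\<bar>b\<bar> + 1)\<^sup>2" by (simp add: power2_diff)
  finally have 1: "\<bar>x\<bar> - (\<bar>b\<bar> + 1)\<^sup>2 / 2 \<le> \<bar>x\<bar>\<^sup>2 / 2 - \<bar>b\<bar> * \<bar>x\<bar>" by (simp add: algebra_simps)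
  have "- (\<bar>b\<bar> * \<bar>x\<bar>) \<le> b * x" by (metis abs_ge_minus_self abs_mult minus_le_iff)
  then have "\<bar>x\<bar> - (\<bar>b\<bar> + 1)\<^sup>2 / 2 \<le> x\<^sup>2 / 2 + b * x" using 1 by simp
  then have "q powr (x\<^sup>2 / 2 + b * x) \<le> q powr (\<bar>x\<bar> - (\<bar>b\<bar> + 1)\<^sup>2 / 2)"
    using q_pos q_less_1 by (simp add: powr_mono')
  also have "\<dots> = q powr (- (\<bar>b\<bar> + 1)\<^sup>2 / 2) * q powr \<bar>x\<bar>" by (simp add: powr_add[symmetric])
  finally show ?thesis .
qed

section \<open>Absolute convergence by geometric majorants\<close>

lemma summable_powr_abs_int:
  assumes "a > 0" shows "(\<lambda>x :: int. q powr (a * \<bar>real_of_int x\<bar>)) summable_on UNIV"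
proof -
  define r where "r = q powr a"
  have r: "0 < r" "r < 1"
    using q_pos powr_less_mono2[OF assms, of q 1] q_less_1 by (auto simp: r_def)
  have "summable (\<lambda>n. r ^ n)" using r by (simp add: summable_geometric)
  then have s: "(\<lambda>n. r ^ n) summable_on UNIV" using r by (intro summable_nonneg_imp_summable_on) auto
  have e: "q powr (a * \<bar>real_of_int x\<bar>) = r ^ nat \<bar>x\<bar>" for x
    using r by (simp add: r_def powr_powr[symmetric] powr_realpow[symmetric])
  have "(\<lambda>x :: int. r ^ nat \<bar>x\<bar>) summable_on int ` UNIV"
    by (subst summable_on_reindex) (use s in \<open>auto simp: o_def\<close>)
  moreover have "(\<lambda>x :: int. r ^ nat \<bar>x\<bar>) summable_on (\<lambda>n. - int n) ` UNIV"
    by (subst summable_on_reindex) (use s in \<open>auto simp: o_def inj_on_def\<close>)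
  ultimately have "(\<lambda>x :: int. r ^ nat \<bar>x\<bar>) summable_on (int ` UNIV \<union> (\<lambda>n. - int n) ` UNIV)"
    by (rule summable_on_union)
  moreover have "(int ` UNIV \<union> (\<lambda>n. - int n) ` UNIV) = UNIV"
  proof -
    have "x \<in> int ` UNIV \<union> (\<lambda>n. - int n) ` UNIV" for x by (cases x rule: int_cases2) auto
    then show ?thesis by blast
  qed
  ultimately show ?thesis by (simp add: e)
qed

lemma summable_powr_abs_int2:
  assumes "a > 0"
  shows "(\<lambda>(x :: int, y :: int). q powr (a * (\<bar>real_of_int x\<bar> + \<bar>real_of_int y\<bar>))) summable_on UNIV"
proof -
  define f where "f x = q powr (a * \<bar>real_of_int x\<bar>)" for x
  have f: "f summable_on UNIV" unfolding f_def by (rule summable_powr_abs_int[OF assms])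
  have f0: "\<bar>f x\<bar> = f x" for x by (simp add: f_def)
  have "Infinite_Sum.abs_summable_on (\<lambda>(x, y). f x * f y) (Sigma UNIV (\<lambda>_. UNIV))"
    unfolding Infinite_Sum.abs_summable_on_Sigma_iff
  proof (intro conjI ballI)
    show "Infinite_Sum.abs_summable_on (\<lambda>y. case (x, y) of (x, y) \<Rightarrow> f x * f y) UNIV" for x
      using f by (simp add: f0 abs_mult summable_on_cmult_right)
    show "Infinite_Sum.abs_summable_on (\<lambda>x. \<Sum>\<^sub>\<infinity>y. norm (case (x, y) of (x, y) \<Rightarrow> f x * f y)) UNIV"
      using f by (simp add: f0 abs_mult infsum_cmult_right' summable_on_cmult_left)
  qed
  then have "(\<lambda>(x, y). f x * f y) summable_on UNIV" using Infinite_Sum.abs_summable_summable by force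
  moreover have "f x * f y = q powr (a * (\<bar>real_of_int x\<bar> + \<bar>real_of_int y\<bar>))" for x y
    by (simp add: f_def powr_add[symmetric] distrib_left)
  ultimately show ?thesis by simp
qed

text \<open>\<open>\<phi>\<close> stands for the coordinates in which a quadratic exponent has been
  separated; its injectivity is enough for comparison with a double geometric series over pairs of
  integers.\<close>

lemma abs_summable_powr_bound:
  fixes f :: "'a \<Rightarrow> real" and \<phi> :: "'a \<Rightarrow> int \<times> int"
  assumes "a > 0" and inj: "inj_on \<phi> A"
    and le: "\<And>z. z \<in> A \<Longrightarrow> \<bar>f z\<bar> \<le> K * q powr (a * (\<bar>real_of_int (fst (\<phi> z))\<bar> + \<bar>real_of_int (snd (\<phi> z))\<bar>))"
  shows "Infinite_Sum.abs_summable_on f A"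
proof -
  let ?h = "\<lambda>(x :: int, y :: int). q powr (a * (\<bar>real_of_int x\<bar> + \<bar>real_of_int y\<bar>))"
  have "?h summable_on \<phi> ` A"
    by (rule summable_on_subset_banach[OF summable_powr_abs_int2[OF assms(1)]]) simp
  then have "(?h \<circ> \<phi>) summable_on A" using summable_on_reindex[OF inj] by blast
  then have "(\<lambda>z. K * (?h \<circ> \<phi>) z) summable_on A" by (rule summable_on_cmult_right)
  then show ?thesis
    by (rule summable_on_comparison_test) (use le in \<open>auto simp: case_prod_unfold\<close>)
qed

lemma abs_summable_powr_bound1:
  fixes f :: "'a \<Rightarrow> real" and \<phi> :: "'a \<Rightarrow> int"
  assumes "a > 0" and inj: "inj_on \<phi> A" and le: "\<And>z. z \<in> A \<Longrightarrow> \<bar>f z\<bar> \<le> K * q powr (a * \<bar>real_of_int (\<phi> z)\<bar>)"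
  shows "Infinite_Sum.abs_summable_on f A"
  by (rule abs_summable_powr_bound[where \<phi> = "\<lambda>z. (\<phi> z, 0)", OF assms(1)])
    (use inj le in \<open>auto simp: inj_on_def\<close>)

section \<open>A theta function on the residue classes modulo 2\<close>

definition Theta :: "int \<Rightarrow> real" where
  "Theta y = (\<Sum>\<^sub>\<infinity>t. q powr (real_of_int (y + 2 * t) * (real_of_int (y + 2 * t) + 1) / 2))"

text \<open>The exponent \<open>x (x + 1) / 2\<close> is invariant under \<open>x \<mapsto> - 1 - x\<close>, which exchanges parities.\<close>

lemma Theta_const: "Theta y = Theta 0"
proof -
  have shift: "Theta (y + 2 * k) = Theta y" for y k
    unfolding Theta_def
    by (rule infsum_reindex_bij_witness[where i = "\<lambda>t. t - k" and j = "\<lambda>t. t + k"]) (auto simp: algebra_simps)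
  have refl: "Theta (- 1 - y) = Theta y" for y
    unfolding Theta_def
    by (rule infsum_reindex_bij_witness[where i = uminus and j = uminus]) (auto simp: algebra_simps)
  show ?thesis
  proof (cases "even y")
    case True
    then obtain k where "y = 0 + 2 * k" by auto
    then show ?thesis using shift by metis
  next
    case False
    then obtain k where "y = 2 * k + 1" by (elim oddE)
    then have "y = - 1 - 0 + 2 * (k + 1)" by simp
    then show ?thesis using shift refl by metis
  qed
qed

text \<open>Completing the square replaces \<open>y\<close> by \<open>y - e\<close>, and
  \<open>Theta_const\<close> removes the dependence on the class of \<open>y - e\<close>.\<close>

lemma Theta_sum:
  "(\<Sum>\<^sub>\<infinity>t. q powr (real_of_int (y + 2 * t) * (real_of_int (y + 2 * t) + 1) / 2 - real_of_int e * real_of_int (y + 2 * t)))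
    = q powr (- real_of_int e * (real_of_int e - 1) / 2) * Theta 0"
proof -
  have "q powr (real_of_int (y + 2 * t) * (real_of_int (y + 2 * t) + 1) / 2 - real_of_int e * real_of_int (y + 2 * t)) =
     q powr (- real_of_int e * (real_of_int e - 1) / 2) *
     q powr (real_of_int (y - e + 2 * t) * (real_of_int (y - e + 2 * t) + 1) / 2)" for t
  proof -
    have "real_of_int (y + 2 * t) * (real_of_int (y + 2 * t) + 1) / 2 - real_of_int e * real_of_int (y + 2 * t) =
       - real_of_int e * (real_of_int e - 1) / 2 + real_of_int (y - e + 2 * t) * (real_of_int (y - e + 2 * t) + 1) / 2"
      by (simp add: field_simps)
    then show ?thesis by (simp only: powr_add)
  qed
  then show ?thesis using Theta_const[of "y - e"] by (simp add: infsum_cmult_right' Theta_def)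
qed

lemma qpar_sq: "qpar (q\<^sup>2)"
proof (rule qpar.intro)
  show "0 < q\<^sup>2" using q_pos by simp
  show "q\<^sup>2 < 1" by (rule pow_less_1) simp
qed

lemma sq_power: "(q\<^sup>2) ^ n = q powr (2 * real n)"
proof -
  have "(q\<^sup>2) ^ n = q ^ (2 * n)" by (simp add: power_mult)
  also have "\<dots> = q powr (real (2 * n))" using q_pos by (simp only: powr_realpow)
  finally show ?thesis by simp
qed

lemma real_choose_2: "real (n choose 2) = real n * (real n - 1) / 2"
  by (induction n) (simp_all add: numeral_2_eq_2 field_simps)

lemma sq_gj_le: "\<bar>qpar.gj (q\<^sup>2) j\<bar> \<le> q powr (real j * real j - real j) / qpar.q0 (q\<^sup>2)"
proof -
  have "2 * (real j * (real j - 1) / 2) = real j * real j - real j" by (simp add: right_diff_distrib)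
  then show ?thesis using qpar.abs_gj_le[OF qpar_sq, of j] by (simp only: sq_power real_choose_2)
qed

text \<open>For \<open>y = s\<close> and \<open>y = s + 1\<close> the numbers
  \<open>y + 2 * t\<close> are the lengths of the outer column on top of an inner one of length
  \<open>s\<close>; in both cases the halved difference, rounded down, is \<open>t\<close>.\<close>

definition gsum :: "int \<Rightarrow> int \<Rightarrow> real" where
  "gsum e y = (\<Sum>\<^sub>\<infinity>t :: nat. q powr ((real_of_int y + 2 * t) * (real_of_int y + 2 * t + 1) / 2 - real_of_int e * (real_of_int y + 2 * t))
     / qpoch (q\<^sup>2) (q\<^sup>2) t)"

text \<open>The contribution of the index \<open>j\<close> of Euler's series in base
  \<open>q\<^sup>2\<close>: its coefficient, a factor from the shift by one in
  \<open>eul_int\<close>, and the value of the theta sum with exponent \<open>e - j\<close>.\<close>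

definition gbeta :: "int \<Rightarrow> nat \<Rightarrow> real" where
  "gbeta e j = Theta 0 / qpar.eul (q\<^sup>2) (q\<^sup>2) * qpar.gj (q\<^sup>2) j * q powr (2 * real j - (real_of_int e - j) * (real_of_int e - j - 1) / 2)"

text \<open>
  Expand \<open>1 / (Q; Q)\<^sub>t\<close>, extended by \<open>0\<close> to negative \<open>t\<close>, with Euler's identity and sum over \<open>t\<close> first.
\<close>

lemma gsum_eq: "gsum e y = (\<Sum>\<^sub>\<infinity>j. gbeta e j * q powr (- real j * real_of_int y))"
proof -
  define X where "X t = real_of_int (y + 2 * t)" for t
  define En where "En e t = q powr (X t * (X t + 1) / 2 - real_of_int e * X t)" for e t
  define F where "F t j = En e t * (qpar.gj (q\<^sup>2) j * ((q\<^sup>2) powi (t + 1)) ^ j)" for t :: int and j :: nat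
  have qq: "((q\<^sup>2) powi (t + 1)) ^ j = q powr (2 * real j * (real_of_int t + 1))" for t j
  proof -
    have e: "q\<^sup>2 = q powr 2" using q_pos by simp
    have "(q\<^sup>2) powi (t + 1) = (q\<^sup>2) powr (real_of_int (t + 1))"
      using q_pos by (intro powr_real_of_int'[symmetric]) auto
    also have "\<dots> = q powr (2 * real_of_int (t + 1))" unfolding e by (rule powr_powr)
    finally have "((q\<^sup>2) powi (t + 1)) ^ j = (q powr (2 * real_of_int (t + 1))) ^ j" by (rule arg_cong)
    also have "\<dots> = q powr (2 * real_of_int (t + 1) * real j)"
      using q_pos by (subst powr_realpow[symmetric]) (simp_all add: powr_powr)
    finally show ?thesis by (simp add: mult_ac)
  qed
  have sumF: "Infinite_Sum.abs_summable_on (\<lambda>(t, j). F t j) (UNIV \<times> UNIV)"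
  \<comment> \<open>In the coordinates \<open>t\<close> and \<open>t + j\<close> the quadratic
    exponent is a sum of two squares with linear terms, so both directions decay.\<close>
  proof (rule abs_summable_powr_bound[where \<phi> = "\<lambda>(t, j). (t, t + int j)" and a = 2])
    let ?b1 = "real_of_int y - real_of_int e" and ?b2 = "1 / 2 :: real"
    define y2 where "y2 = real_of_int y * (real_of_int y + 1) / 2 - real_of_int e * real_of_int y"
    define K where "K = q powr y2 / qpar.q0 (q\<^sup>2) * sqrt 1"
    show "inj_on (\<lambda>(t, j). (t, t + int j)) (UNIV \<times> UNIV)" by (auto simp: inj_on_def)
    fix z :: "int \<times> nat"
    obtain t j where z: "z = (t, j)" by (cases z)
    define u v where "u = real_of_int t" and "v = real_of_int t + real j"
    have ex: "X t * (X t + 1) / 2 - real_of_int e * X t + (real j * real j - real j) + 2 * real j * (real_of_int t + 1)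
       = y2 + 2 * (u\<^sup>2 / 2 + ?b1 * u) + 2 * (v\<^sup>2 / 2 + ?b2 * v)"
      by (simp add: X_def u_def v_def y2_def power2_eq_square field_simps)
    have "\<bar>F t j\<bar> = En e t * (\<bar>qpar.gj (q\<^sup>2) j\<bar> * q powr (2 * real j * (real_of_int t + 1)))"
      by (simp add: F_def qq abs_mult En_def)
    also have "\<dots> \<le> En e t * (q powr (real j * real j - real j) / qpar.q0 (q\<^sup>2) * q powr (2 * real j * (real_of_int t + 1)))"
      by (intro mult_left_mono mult_right_mono sq_gj_le) (auto simp: En_def)
    also have "\<dots> = q powr (X t * (X t + 1) / 2 - real_of_int e * X t + (real j * real j - real j) + 2 * real j * (real_of_int t + 1)) / qpar.q0 (q\<^sup>2)"
      by (simp add: En_def powr_add)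
    also have "\<dots> = q powr y2 / qpar.q0 (q\<^sup>2) * ((q powr (u\<^sup>2 / 2 + ?b1 * u))\<^sup>2 * (q powr (v\<^sup>2 / 2 + ?b2 * v))\<^sup>2)"
    proof -
      have sq2: "(q powr a)\<^sup>2 = q powr (2 * a)" for a by (simp add: power2_eq_square powr_add[symmetric])
      have "q powr (y2 + 2 * a + 2 * b) = q powr y2 * ((q powr a)\<^sup>2 * (q powr b)\<^sup>2)" for a b
        by (simp only: powr_add sq2 mult.assoc)
      then show ?thesis by (simp only: ex times_divide_eq_left)
    qed
    also have "\<dots> \<le> q powr y2 / qpar.q0 (q\<^sup>2) * ((q powr (- (\<bar>?b1\<bar> + 1)\<^sup>2 / 2) * q powr \<bar>u\<bar>)\<^sup>2 * (q powr (- (\<bar>?b2\<bar> + 1)\<^sup>2 / 2) * q powr \<bar>v\<bar>)\<^sup>2)"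
      using qpar.q0_pos[OF qpar_sq] by (intro mult_left_mono mult_mono power_mono gauss_le) auto
    also have "\<dots> = (q powr y2 / qpar.q0 (q\<^sup>2) * (q powr (- (\<bar>?b1\<bar> + 1)\<^sup>2 / 2))\<^sup>2 * (q powr (- (\<bar>?b2\<bar> + 1)\<^sup>2 / 2))\<^sup>2) * q powr (2 * (\<bar>u\<bar> + \<bar>v\<bar>))"
    proof -
      have "q powr (2 * (\<bar>u\<bar> + \<bar>v\<bar>)) = (q powr \<bar>u\<bar>)\<^sup>2 * (q powr \<bar>v\<bar>)\<^sup>2"
        by (simp add: power2_eq_square powr_add[symmetric])
      then show ?thesis by (simp only: power_mult_distrib mult_ac)
    qed
    finally show "\<bar>case z of (t, j) \<Rightarrow> F t j\<bar> \<le>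
       (q powr y2 / qpar.q0 (q\<^sup>2) * (q powr (- (\<bar>?b1\<bar> + 1)\<^sup>2 / 2))\<^sup>2 * (q powr (- (\<bar>?b2\<bar> + 1)\<^sup>2 / 2))\<^sup>2) *
        q powr (2 * (\<bar>real_of_int (fst (case z of (t, j) \<Rightarrow> (t, t + int j)))\<bar> + \<bar>real_of_int (snd (case z of (t, j) \<Rightarrow> (t, t + int j)))\<bar>))"
      by (simp add: z u_def v_def)
  qed simp
  then have sumF': "(\<lambda>(t, j). F t j) summable_on UNIV \<times> UNIV" by (rule Infinite_Sum.abs_summable_summable)
  have "(\<Sum>\<^sub>\<infinity>t. \<Sum>\<^sub>\<infinity>j. F t j) = (\<Sum>\<^sub>\<infinity>j. \<Sum>\<^sub>\<infinity>t. F t j)"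
    by (rule infsum_swap_banach[OF sumF'])
  moreover have "(\<Sum>\<^sub>\<infinity>t. \<Sum>\<^sub>\<infinity>j. F t j) = qpar.eul (q\<^sup>2) (q\<^sup>2) * gsum e y"
  proof -
    have "(\<Sum>\<^sub>\<infinity>j. F t j) = En e t * (if t < 0 then 0 else qpar.eul (q\<^sup>2) (q\<^sup>2) / qpoch (q\<^sup>2) (q\<^sup>2) (nat t))" for t
      unfolding F_def infsum_cmult_right' qpar.eul_int[OF qpar_sq, symmetric] by (simp only: qpar.eul_def[OF qpar_sq])
    then have "(\<Sum>\<^sub>\<infinity>t. \<Sum>\<^sub>\<infinity>j. F t j) = (\<Sum>\<^sub>\<infinity>t. En e t * (if t < 0 then 0 else qpar.eul (q\<^sup>2) (q\<^sup>2) / qpoch (q\<^sup>2) (q\<^sup>2) (nat t)))"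
      by simp
    also have "\<dots> = (\<Sum>\<^sub>\<infinity>t\<in>range int. En e t * (if t < 0 then 0 else qpar.eul (q\<^sup>2) (q\<^sup>2) / qpoch (q\<^sup>2) (q\<^sup>2) (nat t)))"
    proof (rule infsum_cong_neutral)
      fix x :: int assume "x \<in> UNIV - range int"
      then have "x < 0" by (metis DiffD2 nat_0_le not_less rangeI)
      then show "En e x * (if x < 0 then 0 else qpar.eul (q\<^sup>2) (q\<^sup>2) / qpoch (q\<^sup>2) (q\<^sup>2) (nat x)) = 0" by simp
    qed auto
    also have "\<dots> = (\<Sum>\<^sub>\<infinity>t. qpar.eul (q\<^sup>2) (q\<^sup>2) * (En e (int t) / qpoch (q\<^sup>2) (q\<^sup>2) t))"
      by (subst infsum_reindex) (auto simp: o_def mult_ac)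
    also have "\<dots> = qpar.eul (q\<^sup>2) (q\<^sup>2) * gsum e y"
      unfolding infsum_cmult_right' by (simp add: gsum_def En_def X_def)
    finally show ?thesis .
  qed
  moreover have "(\<Sum>\<^sub>\<infinity>t. F t j) = qpar.eul (q\<^sup>2) (q\<^sup>2) * (gbeta e j * q powr (- real j * real_of_int y))" for j
  proof -
    \<comment> \<open>The index \<open>j\<close> acts on the sum over \<open>t\<close> only by
      shifting the parameter \<open>e\<close> to \<open>e - j\<close>.\<close>
    have "F t j = qpar.gj (q\<^sup>2) j * q powr (2 * real j - real j * real_of_int y) * En (e - int j) t" for t
    proof -
      have "X t * (X t + 1) / 2 - real_of_int e * X t + 2 * real j * (real_of_int t + 1) =
         (2 * real j - real j * real_of_int y) + (X t * (X t + 1) / 2 - real_of_int (e - int j) * X t)"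
        by (simp add: X_def algebra_simps)
      then have *: "En e t * q powr (2 * real j * (real_of_int t + 1)) =
          q powr (2 * real j - real j * real_of_int y) * En (e - int j) t"
        unfolding En_def by (simp only: powr_add[symmetric])
      have "F t j = qpar.gj (q\<^sup>2) j * (En e t * q powr (2 * real j * (real_of_int t + 1)))"
        unfolding F_def qq by (rule mult.left_commute)
      then show ?thesis by (simp only: *)
    qed
    then have "(\<Sum>\<^sub>\<infinity>t. F t j) = qpar.gj (q\<^sup>2) j * q powr (2 * real j - real j * real_of_int y) * (\<Sum>\<^sub>\<infinity>t. En (e - int j) t)"
      by (simp only: infsum_cmult_right')
    also have "(\<Sum>\<^sub>\<infinity>t. En (e - int j) t) = q powr (- real_of_int (e - int j) * (real_of_int (e - int j) - 1) / 2) * Theta 0"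
      unfolding En_def X_def by (rule Theta_sum)
    also have "qpar.gj (q\<^sup>2) j * q powr (2 * real j - real j * real_of_int y) * \<dots> =
       qpar.gj (q\<^sup>2) j * Theta 0 * q powr ((2 * real j - (real_of_int e - j) * (real_of_int e - j - 1) / 2) + (- real j * real_of_int y))"
    proof -
      have "(2 * real j - real j * real_of_int y) + (- real_of_int (e - int j) * (real_of_int (e - int j) - 1) / 2) =
         (2 * real j - (real_of_int e - j) * (real_of_int e - j - 1) / 2) + (- real j * real_of_int y)"
        by (simp add: field_simps)
      then have "q powr (2 * real j - real j * real_of_int y) * q powr (- real_of_int (e - int j) * (real_of_int (e - int j) - 1) / 2) =
          q powr ((2 * real j - (real_of_int e - j) * (real_of_int e - j - 1) / 2) + (- real j * real_of_int y))"
        by (simp only: powr_add[symmetric])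
      moreover have "a * b * (c * d) = a * d * (b * c)" for a b c d :: real by simp
      ultimately show ?thesis by (simp only:)
    qed
    also have "\<dots> = qpar.eul (q\<^sup>2) (q\<^sup>2) * (gbeta e j * q powr (- real j * real_of_int y))"
      unfolding powr_add gbeta_def using qpar.eul_q_nonzero[OF qpar_sq] by simp
    finally show ?thesis .
  qed
  ultimately have "qpar.eul (q\<^sup>2) (q\<^sup>2) * gsum e y = (\<Sum>\<^sub>\<infinity>j. qpar.eul (q\<^sup>2) (q\<^sup>2) * (gbeta e j * q powr (- real j * real_of_int y)))"
    by simp
  then show ?thesis unfolding infsum_cmult_right' using qpar.eul_q_nonzero[OF qpar_sq] by simp
qed

text \<open>The coefficients of Euler's series in base \<open>q\<^sup>2\<close> decay with exponent
  \<open>j^2\<close>, while the theta factor grows with exponent \<open>j^2 / 2\<close>; a Gaussian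
  with exponent \<open>j^2 / 2\<close> remains.\<close>

lemma gbeta_bound:
  obtains K where "K \<ge> 0" "\<And>j. \<bar>gbeta e j\<bar> \<le> K * q powr ((real j)\<^sup>2 / 2 + real j / 2 + real_of_int e * real j)"
proof
  define K where "K = \<bar>Theta 0 / qpar.eul (q\<^sup>2) (q\<^sup>2)\<bar> / qpar.q0 (q\<^sup>2) * q powr (- real_of_int e * (real_of_int e - 1) / 2)"
  show "K \<ge> 0" using qpar.q0_pos[OF qpar_sq] by (simp add: K_def)
  fix j
  have "\<bar>gbeta e j\<bar> \<le> \<bar>Theta 0 / qpar.eul (q\<^sup>2) (q\<^sup>2)\<bar> * (q powr (real j * real j - real j) / qpar.q0 (q\<^sup>2)) *
      q powr (2 * real j - (real_of_int e - j) * (real_of_int e - j - 1) / 2)"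
    unfolding gbeta_def abs_mult using sq_gj_le[of j] qpar.q0_pos[OF qpar_sq] by (intro mult_mono) auto
  also have "\<dots> = K * q powr ((real j)\<^sup>2 / 2 + real j / 2 + real_of_int e * real j)"
  proof -
    have "(real j * real j - real j) + (2 * real j - (real_of_int e - j) * (real_of_int e - j - 1) / 2) =
      (- real_of_int e * (real_of_int e - 1) / 2) + ((real j)\<^sup>2 / 2 + real j / 2 + real_of_int e * real j)"
      by (simp add: power2_eq_square field_simps)
    then have "q powr (real j * real j - real j) * q powr (2 * real j - (real_of_int e - j) * (real_of_int e - j - 1) / 2)
      = q powr (- real_of_int e * (real_of_int e - 1) / 2) * q powr ((real j)\<^sup>2 / 2 + real j / 2 + real_of_int e * real j)"
      by (simp only: powr_add[symmetric])
    then show ?thesis unfolding K_def by (simp add: mult_ac)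
  qed
  finally show "\<bar>gbeta e j\<bar> \<le> K * q powr ((real j)\<^sup>2 / 2 + real j / 2 + real_of_int e * real j)" .
qed

abbreviation Qf :: "nat \<Rightarrow> real" where "Qf n \<equiv> qpoch (q\<^sup>2) (q\<^sup>2) n"
abbreviation Q0 :: real where "Q0 \<equiv> qpar.q0 (q\<^sup>2)"

lemma Qf_pos: "Qf n > 0" and Q0_pos: "Q0 > 0" and Qf_inverse_le: "1 / Qf n \<le> 1 / Q0"
  using qpar.qf_pos[OF qpar_sq, of n] qpar.q0_pos[OF qpar_sq] qpar.q0_le[OF qpar_sq, of n]
  by (auto simp: frac_le)

section \<open>Signed sums over one column\<close>

text \<open>The weight \<open>q^(c(c+1)/2) p^(e c)\<close> of a column of length \<open>c\<close>.
  Every exponential factor in \<open>c\<close> only shifts \<open>e\<close>; real values of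
  \<open>e\<close> let the same function serve as a majorant.\<close>

definition Ew :: "real \<Rightarrow> nat \<Rightarrow> real" where
  "Ew e c = q powr (real c * (real c + 1) / 2 - e * real c)"

lemma Ew_pos: "Ew e c > 0" using q_pos by (simp add: Ew_def)

lemma Ew_mult: "Ew e c * q powr (- x * real c) = Ew (e + x) c"
proof -
  have "real c * (real c + 1) / 2 - e * real c + - x * real c = real c * (real c + 1) / 2 - (e + x) * real c"
    by (simp add: distrib_right)
  then show ?thesis unfolding Ew_def by (simp only: powr_add[symmetric])
qed

definition gK :: "real \<Rightarrow> real" where "gK e = q powr (- (\<bar>1 / 2 - e\<bar> + 1)\<^sup>2 / 2)"

lemma Ew_le: "Ew e c \<le> gK e * q powr \<bar>real c\<bar>"
proof -
  have "real c * (real c + 1) / 2 - e * real c = (real c)\<^sup>2 / 2 + (1 / 2 - e) * real c"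
    by (simp add: power2_eq_square field_simps)
  then show ?thesis using gauss_le[of "real c" "1 / 2 - e"] by (simp only: Ew_def gK_def)
qed

lemma summable_bounded_Ew:
  assumes "\<And>c. \<bar>f c\<bar> \<le> K * Ew e c" "K \<ge> 0"
  shows "f summable_on UNIV" "(\<lambda>c. \<bar>f c\<bar>) summable_on UNIV"
proof -
  have "Infinite_Sum.abs_summable_on f UNIV"
  proof (rule abs_summable_powr_bound1[where a = 1 and \<phi> = int])
    fix c
    have "\<bar>f c\<bar> \<le> K * Ew e c" by (rule assms)
    also have "\<dots> \<le> K * (gK e * q powr \<bar>real c\<bar>)" by (intro mult_left_mono Ew_le assms)
    finally show "\<bar>f c\<bar> \<le> (K * gK e) * q powr (1 * \<bar>real_of_int (int c)\<bar>)" by (simp add: mult.assoc)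
  qed auto
  then show "f summable_on UNIV" "(\<lambda>c. \<bar>f c\<bar>) summable_on UNIV"
    by (auto intro: Infinite_Sum.abs_summable_summable)
qed

text \<open>The interaction of a column of length \<open>c\<close> with the next column, of length
  \<open>s\<close>. The value 0 for \<open>s > c\<close> encodes the order of the columns, so that
  both lengths may range over all naturals.\<close>

definition Dw :: "nat \<Rightarrow> nat \<Rightarrow> real" where
  "Dw c s = (if s \<le> c then 1 / Qf ((c - s) div 2) else 0)"

lemma Dw_bounds: "0 \<le> Dw c s" "Dw c s \<le> 1 / Q0"
  using Qf_pos[of "(c - s) div 2"] Q0_pos Qf_inverse_le[of "(c - s) div 2"] by (auto simp: Dw_def)

lemma gbeta_summable: "(\<lambda>j. gbeta e j * q powr (- real j * real_of_int y)) summable_on UNIV"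
proof -
  obtain K where K: "K \<ge> 0" "\<And>j. \<bar>gbeta e j\<bar> \<le> K * q powr ((real j)\<^sup>2 / 2 + real j / 2 + real_of_int e * real j)"
    using gbeta_bound by blast
  show ?thesis
  proof (rule summable_bounded_Ew(1)[OF _ K(1)])
    fix j
    have "\<bar>gbeta e j * q powr (- real j * real_of_int y)\<bar> \<le>
        K * q powr ((real j)\<^sup>2 / 2 + real j / 2 + real_of_int e * real j) * q powr (- real j * real_of_int y)"
      unfolding abs_mult using K(2)[of j] by (intro mult_mono) auto
    also have "\<dots> = K * Ew (real_of_int y - real_of_int e) j"
    proof -
      have "((real j)\<^sup>2 / 2 + real j / 2 + real_of_int e * real j) + (- real j * real_of_int y) =
        real j * (real j + 1) / 2 - (real_of_int y - real_of_int e) * real j"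
        by (simp add: power2_eq_square field_simps)
      then show ?thesis unfolding Ew_def mult.assoc by (simp only: powr_add[symmetric])
    qed
    finally show "\<bar>gbeta e j * q powr (- real j * real_of_int y)\<bar> \<le> K * Ew (real_of_int y - real_of_int e) j" .
  qed
qed

text \<open>The lengths \<open>c \<ge> s\<close> of the two parities relative to \<open>s\<close>
  give \<open>gsum\<close> at \<open>s\<close> and at \<open>s + 1\<close>; their expansions combine
  to the factor \<open>1 + \<tau> * q powr (- real j)\<close>. On the right \<open>s\<close>
  survives only in a sign and in powers with \<open>j \<ge> 0\<close>.\<close>

lemma column_sum:
  assumes tau: "\<tau> = 1 \<or> \<tau> = -1"
  shows "(\<Sum>\<^sub>\<infinity>c. \<tau> ^ c * Ew (real_of_int e) c * Dw c s) =
    (\<Sum>\<^sub>\<infinity>j. \<tau> ^ s * (gbeta e j * (1 + \<tau> * q powr (- real j))) * q powr (- real j * real s))"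
proof -
  let ?f = "\<lambda>c. \<tau> ^ c * Ew (real_of_int e) c * Dw c s"
  have sumf: "?f summable_on UNIV"
  proof (rule summable_bounded_Ew(1))
    fix c
    have "\<bar>?f c\<bar> = Ew (real_of_int e) c * Dw c s"
      using tau Ew_pos[of "real_of_int e" c] Dw_bounds(1)[of c s] by (auto simp: abs_mult power_abs)
    also have "\<dots> \<le> Ew (real_of_int e) c * (1 / Q0)"
      by (intro mult_left_mono Dw_bounds) (use Ew_pos[of "real_of_int e" c] in simp)
    finally show "\<bar>?f c\<bar> \<le> (1 / Q0) * Ew (real_of_int e) c" by (simp add: mult.commute)
  qed (use Q0_pos in simp)
  define A where "A = range (\<lambda>t :: nat. s + 2 * t)"
  define B where "B = range (\<lambda>t :: nat. Suc s + 2 * t)"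
  have AB: "A \<inter> B = {}" unfolding A_def B_def by auto presburger
  have un: "A \<union> B = {s..}"
  proof
    show "{s..} \<subseteq> A \<union> B"
    proof
      fix c assume "c \<in> {s..}"
      then have "c = s + 2 * ((c - s) div 2) \<or> c = Suc s + 2 * ((c - s) div 2)" by simp presburger
      then show "c \<in> A \<union> B" by (auto simp: A_def B_def)
    qed
  qed (auto simp: A_def B_def)
  have sq: "\<tau> ^ (2 * t) = 1" for t using tau by (auto simp: power_mult)
  have "infsum ?f UNIV = infsum ?f {s..}"
    by (rule infsum_cong_neutral) (auto simp: Dw_def)
  also have "\<dots> = infsum ?f A + infsum ?f B"
    unfolding un[symmetric]
    by (rule infsum_Un_disjoint[OF _ _ AB]) (use summable_on_subset_banach[OF sumf] in auto)
  also have "infsum ?f A = (\<Sum>\<^sub>\<infinity>t. \<tau> ^ s * (q powr ((real_of_int (int s) + 2 * t) * (real_of_int (int s) + 2 * t + 1) / 2 - real_of_int e * (real_of_int (int s) + 2 * t)) / Qf t))"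
    unfolding A_def
    by (subst infsum_reindex) (auto simp: inj_on_def o_def Dw_def Ew_def power_add sq)
  also have "\<dots> = \<tau> ^ s * gsum e (int s)" unfolding infsum_cmult_right' by (simp add: gsum_def)
  also have "infsum ?f B = (\<Sum>\<^sub>\<infinity>t. \<tau> ^ Suc s * (q powr ((real_of_int (int (Suc s)) + 2 * t) * (real_of_int (int (Suc s)) + 2 * t + 1) / 2 - real_of_int e * (real_of_int (int (Suc s)) + 2 * t)) / Qf t))"
  proof -
    have d: "(Suc s + 2 * t - s) div 2 = t" for t by simp
    have "?f (Suc s + 2 * t) = \<tau> ^ Suc s * (q powr ((real_of_int (int (Suc s)) + 2 * t) * (real_of_int (int (Suc s)) + 2 * t + 1) / 2 - real_of_int e * (real_of_int (int (Suc s)) + 2 * t)) / Qf t)" for t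
      unfolding Dw_def Ew_def power_add sq d by (simp add: add.assoc)
    then show ?thesis unfolding B_def by (subst infsum_reindex) (auto simp: inj_on_def o_def)
  qed
  also have "\<dots> = \<tau> ^ Suc s * gsum e (int (Suc s))" unfolding infsum_cmult_right' by (simp add: gsum_def)
  also have "\<tau> ^ s * gsum e (int s) + \<tau> ^ Suc s * gsum e (int (Suc s)) =
      \<tau> ^ s * ((\<Sum>\<^sub>\<infinity>j. gbeta e j * q powr (- real j * real_of_int (int s))) +
        (\<Sum>\<^sub>\<infinity>j. \<tau> * (gbeta e j * q powr (- real j * real_of_int (int (Suc s))))))"
    unfolding gsum_eq infsum_cmult_right' by (simp add: distrib_left mult.assoc mult.left_commute)
  also have "\<dots> = \<tau> ^ s * (\<Sum>\<^sub>\<infinity>j. gbeta e j * q powr (- real j * real_of_int (int s)) +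
        \<tau> * (gbeta e j * q powr (- real j * real_of_int (int (Suc s)))))"
    by (subst infsum_add[OF gbeta_summable summable_on_cmult_right[OF gbeta_summable]]) (rule refl)
  also have "\<dots> = (\<Sum>\<^sub>\<infinity>j. \<tau> ^ s * (gbeta e j * q powr (- real j * real_of_int (int s)) +
        \<tau> * (gbeta e j * q powr (- real j * real_of_int (int (Suc s))))))"
    by (rule infsum_cmult_right'[symmetric])
  also have "\<dots> = (\<Sum>\<^sub>\<infinity>j. \<tau> ^ s * (gbeta e j * (1 + \<tau> * q powr (- real j))) * q powr (- real j * real s))"
  proof (rule infsum_cong)
    fix j
    have "q powr (- real j * real_of_int (int (Suc s))) = q powr (- real j) * q powr (- real j * real s)"
      unfolding powr_add[symmetric] by (rule arg_cong[where f = "(powr) q"]) (simp add: algebra_simps)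
    then show "\<tau> ^ s * (gbeta e j * q powr (- real j * real_of_int (int s)) +
        \<tau> * (gbeta e j * q powr (- real j * real_of_int (int (Suc s))))) =
        \<tau> ^ s * (gbeta e j * (1 + \<tau> * q powr (- real j))) * q powr (- real j * real s)"
      by (simp only: of_int_of_nat_eq) (simp only: distrib_left distrib_right mult_1_right mult.assoc mult.left_commute)
  qed
  finally show ?thesis .
qed

text \<open>
  One column of the partition: vanishing of all exponential moments of the inner signed weight
  \<open>w\<close> is inherited by the outer sum.  The interchange of summations needs \<open>e' < e\<close>.
\<close>

lemma layer_sum:
  assumes tau: "\<tau> = 1 \<or> \<tau> = -1" and K: "K \<ge> 0" and w: "\<And>s. \<bar>w s\<bar> \<le> K * Ew e' s" and less: "e' < real_of_int e"
    and mom: "\<And>j :: nat. ((\<lambda>s. w s * \<tau> ^ s * q powr (- real j * real s)) has_sum 0) UNIV"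
  shows "((\<lambda>c. \<tau> ^ c * Ew (real_of_int e) c * (\<Sum>s\<le>c. w s * Dw c s)) has_sum 0) UNIV"
proof -
  let ?e = "real_of_int e"
  define f where "f c s = \<tau> ^ c * Ew ?e c * (w s * Dw c s)" for c s
  have tp: "\<bar>\<tau> ^ n\<bar> = 1" for n using tau by (auto simp: power_abs)
  have "Infinite_Sum.abs_summable_on (\<lambda>(c, s). f c s) (UNIV \<times> UNIV)"
  proof (rule abs_summable_powr_bound[where \<phi> = "\<lambda>(c, s). (int c, int s)" and a = 1])
    fix z :: "nat \<times> nat"
    obtain c s where z: "z = (c, s)" by (cases z)
    have "\<bar>f c s\<bar> = Ew ?e c * (\<bar>w s\<bar> * Dw c s)"
      unfolding f_def abs_mult tp using Ew_pos[of ?e c] Dw_bounds(1)[of c s] by simp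
    also have "\<dots> \<le> (gK ?e * q powr \<bar>real c\<bar>) * ((K * (gK e' * q powr \<bar>real s\<bar>)) * (1 / Q0))"
    proof (intro mult_mono Ew_le Dw_bounds)
      have "\<bar>w s\<bar> \<le> K * Ew e' s" by (rule w)
      also have "\<dots> \<le> K * (gK e' * q powr \<bar>real s\<bar>)" by (intro mult_left_mono Ew_le K)
      finally show "\<bar>w s\<bar> \<le> K * (gK e' * q powr \<bar>real s\<bar>)" .
    qed (use K Q0_pos Dw_bounds in \<open>auto simp: gK_def\<close>)
    also have "\<dots> = (gK ?e * K * gK e' * (1 / Q0)) * (q powr \<bar>real c\<bar> * q powr \<bar>real s\<bar>)" by simp
    also have "q powr \<bar>real c\<bar> * q powr \<bar>real s\<bar> = q powr (1 * (\<bar>real c\<bar> + \<bar>real s\<bar>))" by (simp add: powr_add)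
    finally show "\<bar>case z of (c, s) \<Rightarrow> f c s\<bar> \<le> (gK ?e * K * gK e' * (1 / Q0)) *
       q powr (1 * (\<bar>real_of_int (fst (case z of (c, s) \<Rightarrow> (int c, int s)))\<bar> + \<bar>real_of_int (snd (case z of (c, s) \<Rightarrow> (int c, int s)))\<bar>))"
      by (simp add: z)
  qed (auto simp: inj_on_def)
  then have sumf: "(\<lambda>(c, s). f c s) summable_on UNIV \<times> UNIV" by (rule Infinite_Sum.abs_summable_summable)
  have inner: "(\<Sum>\<^sub>\<infinity>s. f c s) = \<tau> ^ c * Ew ?e c * (\<Sum>s\<le>c. w s * Dw c s)" for c
  proof -
    have "(\<Sum>\<^sub>\<infinity>s. f c s) = (\<Sum>\<^sub>\<infinity>s\<in>{..c}. f c s)"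
      by (rule infsum_cong_neutral) (auto simp: f_def Dw_def)
    then show ?thesis by (simp add: f_def sum_distrib_left)
  qed
  define b where "b j = gbeta e j * (1 + \<tau> * q powr (- real j))" for j
  define g where "g s j = b j * (w s * \<tau> ^ s * q powr (- real j * real s))" for s j
  obtain K2 where K2: "K2 \<ge> 0" "\<And>j. \<bar>gbeta e j\<bar> \<le> K2 * q powr ((real j)\<^sup>2 / 2 + real j / 2 + ?e * real j)"
    using gbeta_bound by blast
  \<comment> \<open>In the coordinates \<open>s - j\<close> and \<open>j\<close> used below, the
    Gaussian factor decays at rate 1 in the first, while the second has only a linear term, of rate
    \<open>?e - e'\<close>. \<open>a\<close> is a common rate.\<close>
  define a where "a = min 1 (?e - e')"
  have a: "a > 0" "a \<le> 1" "a \<le> ?e - e'" using less by (auto simp: a_def)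
  have "Infinite_Sum.abs_summable_on (\<lambda>(s, j). g s j) (UNIV \<times> UNIV)"
  proof (rule abs_summable_powr_bound[where \<phi> = "\<lambda>(s, j). (int s - int j, int j)" and a = a])
    fix z :: "nat \<times> nat"
    obtain s j where z: "z = (s, j)" by (cases z)
    define u where "u = real s - real j"
    have "\<bar>1 + \<tau> * q powr (- real j)\<bar> \<le> 2 * q powr (- real j)"
    proof -
      have "1 \<le> q powr (- real j)" using q_pos q_less_1 powr_mono'[of "- real j" 0 q] by simp
      then show ?thesis using tau by auto
    qed
    then have b: "\<bar>b j\<bar> \<le> K2 * q powr ((real j)\<^sup>2 / 2 + real j / 2 + ?e * real j) * (2 * q powr (- real j))"
      unfolding b_def abs_mult using K2 by (intro mult_mono) auto
    have "\<bar>g s j\<bar> = \<bar>b j\<bar> * (\<bar>w s\<bar> * q powr (- real j * real s))"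
      unfolding g_def abs_mult tp by simp
    also have "\<dots> \<le> (K2 * q powr ((real j)\<^sup>2 / 2 + real j / 2 + ?e * real j) * (2 * q powr (- real j))) * ((K * Ew e' s) * q powr (- real j * real s))"
      using b w[of s] K2(1) by (intro mult_mono) auto
    also have "\<dots> = (2 * K2 * K) * (q powr ((real j)\<^sup>2 / 2 + real j / 2 + ?e * real j) * q powr (- real j) * Ew e' s * q powr (- real j * real s))"
      by simp
    also have "q powr ((real j)\<^sup>2 / 2 + real j / 2 + ?e * real j) * q powr (- real j) * Ew e' s * q powr (- real j * real s) =
        q powr (u\<^sup>2 / 2 + (1 / 2 - e') * u + (?e - e') * real j)"
      unfolding Ew_def powr_add[symmetric]
      by (rule arg_cong[where f = "(powr) q"]) (simp add: u_def power2_eq_square field_simps)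
    also have "\<dots> = q powr (u\<^sup>2 / 2 + (1 / 2 - e') * u) * q powr ((?e - e') * real j)" by (rule powr_add)
    also have "\<dots> \<le> (gK e' * q powr (a * \<bar>u\<bar>)) * q powr (a * \<bar>real j\<bar>)"
    proof (intro mult_mono)
      have "q powr (u\<^sup>2 / 2 + (1 / 2 - e') * u) \<le> gK e' * q powr \<bar>u\<bar>" unfolding gK_def by (rule gauss_le)
      also have "\<dots> \<le> gK e' * q powr (a * \<bar>u\<bar>)"
        by (intro mult_left_mono powr_mono') (use a q_pos q_less_1 in \<open>auto simp: gK_def mult_left_le_one_le\<close>)
      finally show "q powr (u\<^sup>2 / 2 + (1 / 2 - e') * u) \<le> gK e' * q powr (a * \<bar>u\<bar>)" .
      show "q powr ((?e - e') * real j) \<le> q powr (a * \<bar>real j\<bar>)"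
        by (intro powr_mono') (use a q_pos q_less_1 in \<open>auto intro: mult_right_mono\<close>)
    qed (auto simp: gK_def)
    also have "\<dots> = gK e' * q powr (a * (\<bar>u\<bar> + \<bar>real j\<bar>))" by (simp add: powr_add distrib_left)
    finally have "\<bar>g s j\<bar> \<le> (2 * K2 * K) * (gK e' * q powr (a * (\<bar>u\<bar> + \<bar>real j\<bar>)))"
      using K K2(1) by (simp add: mult_left_mono)
    then show "\<bar>case z of (s, j) \<Rightarrow> g s j\<bar> \<le> (2 * K2 * K * gK e') *
       q powr (a * (\<bar>real_of_int (fst (case z of (s, j) \<Rightarrow> (int s - int j, int j)))\<bar> + \<bar>real_of_int (snd (case z of (s, j) \<Rightarrow> (int s - int j, int j)))\<bar>))"
      by (simp add: z u_def mult.assoc)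
  qed (use a in \<open>auto simp: inj_on_def\<close>)
  then have sumg: "(\<lambda>(s, j). g s j) summable_on UNIV \<times> UNIV" by (rule Infinite_Sum.abs_summable_summable)
  have "(\<Sum>\<^sub>\<infinity>c. f c s) = (\<Sum>\<^sub>\<infinity>j. g s j)" for s
  proof -
    have "(\<Sum>\<^sub>\<infinity>c. f c s) = (\<Sum>\<^sub>\<infinity>c. w s * (\<tau> ^ c * Ew ?e c * Dw c s))"
      by (rule infsum_cong) (simp add: f_def)
    also have "\<dots> = (\<Sum>\<^sub>\<infinity>j. w s * (\<tau> ^ s * (gbeta e j * (1 + \<tau> * q powr (- real j))) * q powr (- real j * real s)))"
      unfolding infsum_cmult_right' column_sum[OF tau] ..
    also have "\<dots> = (\<Sum>\<^sub>\<infinity>j. g s j)"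
      by (rule infsum_cong) (simp add: g_def b_def mult_ac)
    finally show ?thesis .
  qed
  moreover have "(\<Sum>\<^sub>\<infinity>s. \<Sum>\<^sub>\<infinity>j. g s j) = (\<Sum>\<^sub>\<infinity>j. \<Sum>\<^sub>\<infinity>s. g s j)" by (rule infsum_swap_banach[OF sumg])
  moreover have "(\<Sum>\<^sub>\<infinity>s. g s j) = 0" for j
    unfolding g_def infsum_cmult_right' using infsumI[OF mom[of j]] by simp
  ultimately have "(\<Sum>\<^sub>\<infinity>s. \<Sum>\<^sub>\<infinity>c. f c s) = 0" by simp
  then have "(\<Sum>\<^sub>\<infinity>c. \<Sum>\<^sub>\<infinity>s. f c s) = 0" using infsum_swap_banach[OF sumf] by simp
  moreover have "(\<lambda>c. \<Sum>\<^sub>\<infinity>s. f c s) summable_on UNIV"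
    using summable_on_Sigma_banach[OF sumf] by simp
  ultimately have "((\<lambda>c. \<Sum>\<^sub>\<infinity>s. f c s) has_sum 0) UNIV" by (metis has_sum_infsum)
  then show ?thesis unfolding inner .
qed

lemma column_bounded:
  assumes K: "K \<ge> 0" and w: "\<And>s. \<bar>w s\<bar> \<le> K * Ew e' s"
  obtains B where "B \<ge> 0" "\<And>c. \<bar>\<Sum>s\<le>c. w s * Dw c s\<bar> \<le> B"
proof
  have sw: "(\<lambda>s. \<bar>w s\<bar>) summable_on UNIV" by (rule summable_bounded_Ew(2)[OF w K])
  show "(\<Sum>\<^sub>\<infinity>s. \<bar>w s\<bar>) * (1 / Q0) \<ge> 0" using Q0_pos by (simp add: infsum_nonneg)
  fix c
  have "\<bar>\<Sum>s\<le>c. w s * Dw c s\<bar> \<le> (\<Sum>s\<le>c. \<bar>w s\<bar> * (1 / Q0))"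
  proof (rule order_trans[OF sum_abs], rule sum_mono)
    fix s
    show "\<bar>w s * Dw c s\<bar> \<le> \<bar>w s\<bar> * (1 / Q0)"
      unfolding abs_mult using Dw_bounds[of c s] by (intro mult_left_mono) auto
  qed
  also have "\<dots> = (\<Sum>s\<le>c. \<bar>w s\<bar>) * (1 / Q0)" by (rule sum_distrib_right[symmetric])
  also have "\<dots> \<le> (\<Sum>\<^sub>\<infinity>s. \<bar>w s\<bar>) * (1 / Q0)"
    by (intro mult_right_mono finite_sum_le_infsum sw) (use Q0_pos in auto)
  finally show "\<bar>\<Sum>s\<le>c. w s * Dw c s\<bar> \<le> (\<Sum>\<^sub>\<infinity>s. \<bar>w s\<bar>) * (1 / Q0)" .
qed

lemma has_sum_finite_sum:
  fixes f :: "'a \<Rightarrow> 'b \<Rightarrow> real"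
  assumes "finite D" "\<And>d. d \<in> D \<Longrightarrow> (f d has_sum s d) A"
  shows "((\<lambda>c. \<Sum>d\<in>D. f d c) has_sum (\<Sum>d\<in>D. s d)) A"
  using assms by (induction D rule: finite_induct) (auto intro: has_sum_add)

text \<open>A power \<open>q powr (- d c)\<close> in the column factor and the moment index
  \<open>j\<close> merely shift the exponent of \<open>layer_sum\<close> to
  \<open>k + d + j\<close>, and the signs multiply to \<open>\<tau> * \<epsilon>\<close>. Hence
  vanishing for all \<open>j\<close> at once reproduces itself.\<close>

lemma layer_step:
  assumes sg: "\<tau> = 1 \<or> \<tau> = -1" "\<epsilon> = 1 \<or> \<epsilon> = -1"
    and K: "K \<ge> 0" and w: "\<And>s. \<bar>w s\<bar> \<le> K * Ew e' s"
    and mom: "\<And>j :: nat. ((\<lambda>s. w s * (\<tau> * \<epsilon>) ^ s * q powr (- real j * real s)) has_sum 0) UNIV"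
    and D: "finite D" "\<And>d. d \<in> D \<Longrightarrow> e' < real (k + d)"
    and F: "\<And>c. F c = (\<Sum>d\<in>D. \<phi> d * q powr (- real d * real c))"
  shows "((\<lambda>c. (\<epsilon> ^ c * F c * Ew (real k) c * (\<Sum>s\<le>c. w s * Dw c s)) * \<tau> ^ c * q powr (- real j * real c)) has_sum 0) UNIV"
proof -
  have te: "\<tau> * \<epsilon> = 1 \<or> \<tau> * \<epsilon> = -1" using sg by auto
  let ?S = "\<lambda>c. \<Sum>s\<le>c. w s * Dw c s"
  have "((\<lambda>c. \<Sum>d\<in>D. \<phi> d * ((\<tau> * \<epsilon>) ^ c * Ew (real_of_int (int (k + d + j))) c * ?S c)) has_sum (\<Sum>d\<in>D. \<phi> d * 0)) UNIV"
  proof (rule has_sum_finite_sum[OF D(1)])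
    fix d assume d: "d \<in> D"
    show "((\<lambda>c. \<phi> d * ((\<tau> * \<epsilon>) ^ c * Ew (real_of_int (int (k + d + j))) c * ?S c)) has_sum \<phi> d * 0) UNIV"
      by (intro has_sum_cmult_right layer_sum[OF te K w _ mom]) (use D(2)[OF d] in auto)
  qed
  moreover have "(\<Sum>d\<in>D. \<phi> d * ((\<tau> * \<epsilon>) ^ c * Ew (real_of_int (int (k + d + j))) c * ?S c)) =
     (\<epsilon> ^ c * F c * Ew (real k) c * ?S c) * \<tau> ^ c * q powr (- real j * real c)" for c
  proof -
    have "Ew (real_of_int (int (k + d + j))) c = Ew (real k) c * q powr (- real d * real c) * q powr (- real j * real c)" for d
      unfolding Ew_mult by simp
    then show ?thesis by (simp add: F sum_distrib_left sum_distrib_right power_mult_distrib mult_ac)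
  qed
  ultimately show ?thesis by simp
qed

text \<open>Substituting \<open>c = a + d\<close> produces Euler's series at
  \<open>q powi (- m)\<close> with \<open>m = k + j - 1\<close>, a zero of \<open>eul\<close>. The
  alternating sign of the series is \<open>\<tau> * \<epsilon> = -1\<close>, and
  \<open>k \<ge> 1\<close> keeps \<open>m\<close> nonnegative.\<close>

lemma first_layer:
  assumes "\<tau> * \<epsilon> = -1" "k \<ge> 1"
  shows "((\<lambda>c. (\<epsilon> ^ c * Ew (real (k + a)) c * (if a \<le> c then 1 / qf (c - a) else 0)) * \<tau> ^ c * q powr (- real j * real c)) has_sum 0) UNIV"
proof -
  define m where "m = k + j - 1"
  define C where "C = (-1) ^ a * q powr (real a * (real a + 1) / 2 - real (k + a + j) * real a)"
  have e0: "eul (q powi (- int m)) = 0" by (rule eul_neg)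
  let ?f = "\<lambda>c. (\<epsilon> ^ c * Ew (real (k + a)) c * (if a \<le> c then 1 / qf (c - a) else 0)) * \<tau> ^ c * q powr (- real j * real c)"
  have "((\<lambda>d. C * (gj d * (q powi (- int m)) ^ d)) has_sum C * eul (q powi (- int m))) UNIV"
    unfolding eul_def by (intro has_sum_cmult_right has_sum_infsum gj_summable)
  then have "((\<lambda>d. C * (gj d * (q powi (- int m)) ^ d)) has_sum 0) UNIV" by (simp add: e0)
  moreover have "C * (gj d * (q powi (- int m)) ^ d) = ?f (a + d)" for d
  proof -
    have p: "(q powi (- int m)) ^ d = q powr (- real m * real d)"
    proof -
      have "q powi (- int m) = q powr (- real m)"
        using powr_real_of_int'[of q "- int m"] q_pos by simp
      then show ?thesis using q_pos by (simp add: powr_realpow[symmetric] powr_powr)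
    qed
    have cd: "q ^ (d choose 2) = q powr (real d * (real d - 1) / 2)"
      using powr_realpow[OF q_pos, of "d choose 2"] by (simp only: real_choose_2)
    have Cm: "real m = real k + real j - 1" using assms(2) by (simp add: m_def of_nat_diff)
    have ex: "real (a + d) * (real (a + d) + 1) / 2 - real (k + a) * real (a + d) + - real j * real (a + d) =
      (real a * (real a + 1) / 2 - real (k + a + j) * real a) + (real d * (real d - 1) / 2 + - real m * real d)"
      unfolding Cm by (simp add: field_simps)
    have "?f (a + d) = (\<tau> * \<epsilon>) ^ (a + d) * (q powr (real (a + d) * (real (a + d) + 1) / 2 - real (k + a) * real (a + d)) * q powr (- real j * real (a + d))) / qf d"
      by (simp add: Ew_def power_mult_distrib)
    also have "\<dots> = (-1) ^ (a + d) * (q powr (real a * (real a + 1) / 2 - real (k + a + j) * real a) * (q powr (real d * (real d - 1) / 2) * q powr (- real m * real d))) / qf d"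
      unfolding powr_add[symmetric] ex assms(1) ..
    also have "\<dots> = C * (gj d * (q powi (- int m)) ^ d)"
      unfolding C_def gj_def p cd by (simp add: power_add)
    finally show ?thesis ..
  qed
  ultimately have "((\<lambda>d. ?f (a + d)) has_sum 0) UNIV" by simp
  then have "(?f has_sum 0) (range (\<lambda>d. a + d))"
    by (subst has_sum_reindex) (auto simp: inj_on_def o_def)
  moreover have "(?f has_sum 0) (range (\<lambda>d. a + d)) \<longleftrightarrow> (?f has_sum 0) UNIV"
  proof (rule has_sum_cong_neutral)
    fix c assume "c \<in> UNIV - range (\<lambda>d. a + d)"
    then have "\<not> a \<le> c" using le_Suc_ex by blast
    then show "?f c = 0" by simp
  qed auto
  ultimately show ?thesis by blast
qed

text \<open>
  With \<open>A(x) = (-q x; q)\<close> and \<open>B(x) = (1 + x) / (x\<^sup>2; q\<^sup>2)\<close>, the functional equations of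
  \<open>A\<close> and \<open>B\<close> give \<open>(1 - x) A(x) B(x) = A(q x) B(q x)\<close>.
\<close>

lemma tail_identity: "(\<Sum>d\<le>n. q ^ (Suc d choose 2) / (Qf ((n - d) div 2) * qf d)) = 1 / qf n"
proof -
  define A where "A = Abs_fps (\<lambda>d. q ^ (Suc d choose 2) / qf d)"
  define Aq where "Aq = Abs_fps (\<lambda>d. q ^ d * (q ^ (Suc d choose 2) / qf d))"
  define B where "B = Abs_fps (\<lambda>m. 1 / Qf (m div 2))"
  define Bh where "Bh = Abs_fps (\<lambda>m. if even m then q ^ m / Qf (m div 2) else 0)"
  define Bq where "Bq = Abs_fps (\<lambda>m. q ^ m / Qf (m div 2))"
  have A: "A = Aq + fps_const q * (fps_X * Aq)"
  proof (rule fps_ext)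
    fix n show "fps_nth A n = fps_nth (Aq + fps_const q * (fps_X * Aq)) n"
    proof (cases n)
      case (Suc m)
      have nz: "1 - q ^ Suc m \<noteq> 0" using pow_less_1[of "Suc m"] by simp
      have ch: "(Suc (Suc m) choose 2) = Suc m + (Suc m choose 2)" by (simp add: numeral_2_eq_2)
      have "fps_nth A n - fps_nth Aq n = (1 - q ^ Suc m) * (q ^ (Suc (Suc m) choose 2) / qf (Suc m))"
        by (simp only: A_def Aq_def Suc fps_nth_Abs_fps left_diff_distrib mult_1)
      also have "\<dots> = q * (q ^ m * (q ^ (Suc m choose 2) / qf m))"
        unfolding qf_Suc ch power_add using nz by simp
      also have "\<dots> = fps_nth (fps_const q * (fps_X * Aq)) n" by (simp add: Aq_def Suc)
      finally show ?thesis by simp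
    qed (simp add: A_def Aq_def)
  qed
  have Qf_Suc: "Qf (Suc k) = Qf k * (1 - q ^ (2 * Suc k))" for k
    by (simp add: qpoch_Suc power_mult power2_eq_square power_mult_distrib)
  have B: "B - fps_X * B = Bh"
  proof (rule fps_ext)
    fix n show "fps_nth (B - fps_X * B) n = fps_nth Bh n"
    proof (cases n)
      case (Suc m)
      show ?thesis
      proof (cases "even n")
        case True
        then obtain k where k: "m = Suc (2 * k)" using Suc by (auto elim!: oddE)
        have nz: "1 - q ^ (2 * Suc k) \<noteq> 0" using pow_less_1[of "2 * Suc k"] by simp
        have "1 / Qf (Suc k) - 1 / Qf k = q ^ (2 * Suc k) / Qf (Suc k)"
          unfolding Qf_Suc using nz Qf_pos[of k] by (simp add: field_simps del: power_Suc mult_Suc_right)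
        then show ?thesis by (simp add: B_def Bh_def Suc k del: power_Suc)
      qed (use Suc in \<open>auto simp: B_def Bh_def\<close>)
    qed (simp add: B_def Bh_def)
  qed
  have Bq: "Bq = Bh + fps_const q * (fps_X * Bh)"
  proof (rule fps_ext)
    fix n show "fps_nth Bq n = fps_nth (Bh + fps_const q * (fps_X * Bh)) n"
      by (cases n) (auto simp: Bq_def Bh_def)
  qed
  have AB: "A * B - fps_X * (A * B) = Aq * Bq"
  proof -
    have "A * B - fps_X * (A * B) = A * (B - fps_X * B)" by (simp add: algebra_simps)
    also have "\<dots> = Aq * Bq" unfolding B by (subst A, subst Bq) (simp add: algebra_simps)
    finally show ?thesis .
  qed
  have coeff: "fps_nth (Aq * Bq) n = q ^ n * fps_nth (A * B) n" for n
    unfolding fps_mult_nth sum_distrib_left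
  proof (rule sum.cong[OF refl])
    fix i assume "i \<in> {0..n}"
    then have "q ^ n = q ^ i * q ^ (n - i)" by (simp flip: power_add)
    then show "fps_nth Aq i * fps_nth Bq (n - i) = q ^ n * (fps_nth A i * fps_nth B (n - i))"
      by (simp add: A_def Aq_def B_def Bq_def)
  qed
  have "fps_nth (A * B) n = 1 / qf n" for n
  proof (induction n)
    case 0 then show ?case by (simp add: A_def B_def numeral_2_eq_2)
  next
    case (Suc n)
    have nz: "1 - q ^ Suc n \<noteq> 0" using pow_less_1[of "Suc n"] by simp
    have "fps_nth (A * B - fps_X * (A * B)) (Suc n) = q ^ Suc n * fps_nth (A * B) (Suc n)"
      unfolding AB by (rule coeff)
    moreover have "fps_nth (P - fps_X * P) (Suc n) = fps_nth P (Suc n) - fps_nth P n" for P :: "real fps" by simp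
    ultimately have "fps_nth (A * B) (Suc n) - fps_nth (A * B) n = q ^ Suc n * fps_nth (A * B) (Suc n)" by simp
    then have "fps_nth (A * B) (Suc n) * (1 - q ^ Suc n) = 1 / qf n"
      using Suc by (simp only: right_diff_distrib mult_1_right mult.commute)
    then show ?case unfolding qf_Suc using nz qf_pos[of n] by (simp add: field_simps)
  qed
  moreover have "fps_nth (A * B) n = (\<Sum>d\<le>n. q ^ (Suc d choose 2) / (Qf ((n - d) div 2) * qf d))"
    by (simp add: fps_mult_nth A_def B_def atLeast0AtMost mult.commute)
  ultimately show ?thesis by simp
qed

end

section \<open>Sums over partitions, column by column\<close>

text \<open>From here on \<open>g\<close> lists the columns of a partition and is itself a
  partition; \<open>parts_le n\<close> contains the possible continuations after a column of length
  \<open>n\<close>.\<close>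

definition parts_le :: "nat \<Rightarrow> (nat \<Rightarrow> nat) set" where
  "parts_le n = {g \<in> partitions. g 0 \<le> n}"

abbreviation pcons :: "nat \<times> (nat \<Rightarrow> nat) \<Rightarrow> nat \<Rightarrow> nat" where
  "pcons \<equiv> (\<lambda>(d, g). case_nat d g)"

lemma pcons_partition:
  assumes "g \<in> parts_le d" shows "case_nat d g \<in> partitions"
proof -
  have g: "g \<in> partitions" "g 0 \<le> d" using assms by (auto simp: parts_le_def)
  have "case_nat d g (Suc i) \<le> case_nat d g i" for i
    using g partitions_antimono[OF g(1)] by (cases i) auto
  then have "antimono (case_nat d g)" by (simp add: antimono_iff_le_Suc)
  moreover have "{i. case_nat d g i \<noteq> 0} \<subseteq> insert 0 (Suc ` {i. g i \<noteq> 0})"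
  proof
    fix i assume "i \<in> {i. case_nat d g i \<noteq> 0}"
    then show "i \<in> insert 0 (Suc ` {i. g i \<noteq> 0})" by (cases i) auto
  qed
  then have "finite {i. case_nat d g i \<noteq> 0}"
    by (rule finite_subset) (use g(1) in \<open>simp add: partitions_def\<close>)
  ultimately show ?thesis by (simp add: partitions_def)
qed

lemma bij_pcons: "bij_betw pcons (Sigma D parts_le) {g \<in> partitions. g 0 \<in> D}"
proof (rule bij_betw_byWitness[where f' = "\<lambda>g. (g 0, \<lambda>i. g (Suc i))"])
  show "\<forall>z\<in>Sigma D parts_le. (pcons z 0, \<lambda>i. pcons z (Suc i)) = z" by auto
  show "\<forall>g\<in>{g \<in> partitions. g 0 \<in> D}. pcons (g 0, \<lambda>i. g (Suc i)) = g"
    by (auto simp: fun_eq_iff split: nat.splits)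
  show "pcons ` Sigma D parts_le \<subseteq> {g \<in> partitions. g 0 \<in> D}"
    using pcons_partition by auto
  show "(\<lambda>g. (g 0, \<lambda>i. g (Suc i))) ` {g \<in> partitions. g 0 \<in> D} \<subseteq> Sigma D parts_le"
    using part_tl_partition partitions_antimono by (auto simp: parts_le_def)
qed

context qpar
begin

definition wfac :: "(nat \<Rightarrow> nat \<Rightarrow> real) \<Rightarrow> (nat \<Rightarrow> nat) \<Rightarrow> nat \<Rightarrow> real" where
  "wfac \<phi> g i = \<phi> i (g i) / Qf ((g i - g (Suc i)) div 2)"

text \<open>A product over infinitely many columns, encoded as the finite product of the factors
  different from 1. The condition \<open>ev_one\<close> ensures that there are only finitely many of
  these for each \<open>g\<close>.\<close>

definition colweight :: "(nat \<Rightarrow> nat \<Rightarrow> real) \<Rightarrow> (nat \<Rightarrow> nat) \<Rightarrow> real" where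
  "colweight \<phi> g = prod (wfac \<phi> g) {i. wfac \<phi> g i \<noteq> 1}"

definition ev_one :: "(nat \<Rightarrow> nat \<Rightarrow> real) \<Rightarrow> bool" where
  "ev_one \<phi> \<longleftrightarrow> (\<exists>K. \<forall>i\<ge>K. \<phi> i 0 = 1)"

lemma colweight_eq:
  assumes "\<And>i. i \<ge> N \<Longrightarrow> wfac \<phi> g i = 1" shows "colweight \<phi> g = (\<Prod>i<N. wfac \<phi> g i)"
  unfolding colweight_def by (rule prod.mono_neutral_left) (use assms in \<open>auto simp: not_le[symmetric]\<close>)

lemma colweight_ev:
  assumes "ev_one \<phi>" "g \<in> partitions"
  obtains N where "\<And>i. i \<ge> N \<Longrightarrow> wfac \<phi> g i = 1"
proof -
  obtain K where K: "\<And>i. i \<ge> K \<Longrightarrow> \<phi> i 0 = 1" using assms(1) by (auto simp: ev_one_def)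
  show ?thesis
  proof (rule that[of "K + part_length g"])
    fix i assume "i \<ge> K + part_length g"
    then have "g i = 0" "g (Suc i) = 0" "\<phi> i 0 = 1"
      using part_zero_iff[OF assms(2)] K by auto
    then show "wfac \<phi> g i = 1" by (simp add: wfac_def)
  qed
qed

lemma ev_one_shift: "ev_one \<phi> \<Longrightarrow> ev_one (\<lambda>i. \<phi> (Suc i))"
  unfolding ev_one_def by (meson le_SucI)

lemma colweight_pcons:
  assumes "ev_one \<phi>" "g \<in> parts_le d"
  shows "colweight \<phi> (case_nat d g) = \<phi> 0 d * (colweight (\<lambda>i. \<phi> (Suc i)) g * Dw d (g 0))"
proof -
  let ?c = "case_nat d g"
  have gp: "g \<in> partitions" "g 0 \<le> d" using assms by (auto simp: parts_le_def)
  obtain N where N: "\<And>i. i \<ge> N \<Longrightarrow> wfac (\<lambda>i. \<phi> (Suc i)) g i = 1"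
    using colweight_ev[OF ev_one_shift[OF assms(1)] gp(1)] by blast
  have s: "wfac \<phi> ?c (Suc i) = wfac (\<lambda>i. \<phi> (Suc i)) g i" for i by (simp add: wfac_def)
  have "colweight \<phi> ?c = (\<Prod>i<Suc N. wfac \<phi> ?c i)"
  proof (rule colweight_eq)
    fix i assume "i \<ge> Suc N"
    then obtain k where "i = Suc k" "k \<ge> N" by (cases i) auto
    then show "wfac \<phi> ?c i = 1" using s N by simp
  qed
  also have "\<dots> = wfac \<phi> ?c 0 * (\<Prod>i<N. wfac (\<lambda>i. \<phi> (Suc i)) g i)"
    by (simp only: prod.lessThan_Suc_shift s)
  also have "(\<Prod>i<N. wfac (\<lambda>i. \<phi> (Suc i)) g i) = colweight (\<lambda>i. \<phi> (Suc i)) g"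
    by (rule colweight_eq[symmetric]) (rule N)
  also have "wfac \<phi> ?c 0 = \<phi> 0 d * Dw d (g 0)" using gp(2) by (simp add: wfac_def Dw_def)
  finally show ?thesis by simp
qed

lemma colweight_abs: "ev_one \<phi> \<Longrightarrow> g \<in> partitions \<Longrightarrow> \<bar>colweight \<phi> g\<bar> = colweight (\<lambda>i c. \<bar>\<phi> i c\<bar>) g"
proof -
  assume e: "ev_one \<phi>" and g: "g \<in> partitions"
  obtain N where N: "\<And>i. i \<ge> N \<Longrightarrow> wfac \<phi> g i = 1" using colweight_ev[OF e g] by blast
  have a: "wfac (\<lambda>i c. \<bar>\<phi> i c\<bar>) g i = \<bar>wfac \<phi> g i\<bar>" for i
    using Qf_pos by (simp add: wfac_def abs_of_pos)
  have "colweight (\<lambda>i c. \<bar>\<phi> i c\<bar>) g = (\<Prod>i<N. \<bar>wfac \<phi> g i\<bar>)"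
    by (subst colweight_eq[of N]) (auto simp: a N)
  moreover have "colweight \<phi> g = (\<Prod>i<N. wfac \<phi> g i)" by (rule colweight_eq) (rule N)
  ultimately show ?thesis by (simp add: abs_prod)
qed

text \<open>\<open>z n\<close> is the total weight of everything that may follow a column of length
  \<open>n\<close>, including the interaction with that column: a transfer operator applied
  repeatedly.\<close>

definition column_sums :: "(nat \<Rightarrow> nat \<Rightarrow> real) \<Rightarrow> (nat \<Rightarrow> real) \<Rightarrow> bool" where
  "column_sums \<phi> z \<longleftrightarrow> (\<forall>n. ((\<lambda>g. colweight \<phi> g * Dw n (g 0)) has_sum z n) (parts_le n))"

text \<open>\<open>za\<close> is the same sum with absolute weights. Its summability against
  \<open>h\<close> gives absolute summability of the double family, which justifies summing over the
  tail first.\<close>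

lemma column_sums_sum_pcons:
  assumes ev: "ev_one \<phi>" and z: "column_sums (\<lambda>i. \<phi> (Suc i)) z" and za: "column_sums (\<lambda>i c. \<bar>\<phi> (Suc i) c\<bar>) za"
    and h: "(\<lambda>d. \<bar>h d\<bar> * za d) summable_on D"
    and hs: "((\<lambda>d. h d * z d) has_sum S) D"
  shows "((\<lambda>(d, g). h d * (colweight (\<lambda>i. \<phi> (Suc i)) g * Dw d (g 0))) has_sum S) (Sigma D parts_le)"
proof (rule has_sum_SigmaI[OF _ hs])
  let ?F = "\<lambda>(d, g). h d * (colweight (\<lambda>i. \<phi> (Suc i)) g * Dw d (g 0))"
  show "((\<lambda>y. ?F (d, y)) has_sum h d * z d) (parts_le d)" for d
    using z by (auto simp: column_sums_def intro: has_sum_cmult_right)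
  have n: "((\<lambda>g. norm (?F (d, g))) has_sum \<bar>h d\<bar> * za d) (parts_le d)" for d
  proof -
    have "norm (?F (d, g)) = \<bar>h d\<bar> * (colweight (\<lambda>i c. \<bar>\<phi> (Suc i) c\<bar>) g * Dw d (g 0))" if "g \<in> parts_le d" for g
      using that colweight_abs[OF ev_one_shift[OF ev], of g] Dw_bounds(1)[of d "g 0"] by (simp add: abs_mult parts_le_def)
    moreover have "((\<lambda>g. \<bar>h d\<bar> * (colweight (\<lambda>i c. \<bar>\<phi> (Suc i) c\<bar>) g * Dw d (g 0))) has_sum \<bar>h d\<bar> * za d) (parts_le d)"
      using za by (auto simp: column_sums_def intro: has_sum_cmult_right)
    ultimately show ?thesis using has_sum_cong by force
  qed
  have "Infinite_Sum.abs_summable_on ?F (Sigma D parts_le)"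
    unfolding Infinite_Sum.abs_summable_on_Sigma_iff
  proof (intro conjI ballI)
    show "Infinite_Sum.abs_summable_on (\<lambda>y. ?F (d, y)) (parts_le d)" for d
      using n has_sum_imp_summable by blast
    have e: "infsum (\<lambda>y. norm (?F (d, y))) (parts_le d) = \<bar>h d\<bar> * za d" for d using n by (rule infsumI)
    have "za d \<ge> 0" for d
    proof (rule has_sum_nonneg)
      show "((\<lambda>g. colweight (\<lambda>i c. \<bar>\<phi> (Suc i) c\<bar>) g * Dw d (g 0)) has_sum za d) (parts_le d)" using za by (simp add: column_sums_def)
      fix g assume "g \<in> parts_le d"
      then show "0 \<le> colweight (\<lambda>i c. \<bar>\<phi> (Suc i) c\<bar>) g * Dw d (g 0)"
        using Dw_bounds(1) by (auto simp: parts_le_def colweight_abs[OF ev_one_shift[OF ev], symmetric])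
    qed
    then show "Infinite_Sum.abs_summable_on (\<lambda>d. infsum (\<lambda>y. norm (?F (d, y))) (parts_le d)) D"
      unfolding e using h by simp
  qed
  then show "?F summable_on Sigma D parts_le" by (rule Infinite_Sum.abs_summable_summable)
qed

lemma parts_le_pcons: "parts_le n = pcons ` Sigma {..n} parts_le"
  using bij_pcons[of "{..n}"] by (auto simp: bij_betw_def parts_le_def)

lemma partitions_pcons: "partitions = pcons ` Sigma UNIV parts_le"
  using bij_pcons[of UNIV] by (auto simp: bij_betw_def)

lemma inj_pcons: "inj_on pcons (Sigma D parts_le)"
  using bij_pcons by (auto simp: bij_betw_def)

lemma column_sums_step:
  assumes ev: "ev_one \<phi>" and z: "column_sums (\<lambda>i. \<phi> (Suc i)) z" and za: "column_sums (\<lambda>i c. \<bar>\<phi> (Suc i) c\<bar>) za"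
  shows "column_sums \<phi> (\<lambda>n. \<Sum>d\<le>n. (\<phi> 0 d * z d) * Dw n d)"
  unfolding column_sums_def
proof
  fix n
  have "((\<lambda>(d, g). (\<phi> 0 d * Dw n d) * (colweight (\<lambda>i. \<phi> (Suc i)) g * Dw d (g 0))) has_sum (\<Sum>d\<le>n. (\<phi> 0 d * z d) * Dw n d)) (Sigma {..n} parts_le)"
    by (rule column_sums_sum_pcons[OF ev z za]) (auto simp: mult_ac intro!: has_sum_finiteI)
  moreover have "(\<phi> 0 d * Dw n d) * (colweight (\<lambda>i. \<phi> (Suc i)) g * Dw d (g 0)) = colweight \<phi> (case_nat d g) * Dw n (case_nat d g 0)"
    if "g \<in> parts_le d" for d g
    using colweight_pcons[OF ev that] by simp
  ultimately have "((\<lambda>(d, g). colweight \<phi> (case_nat d g) * Dw n (case_nat d g 0)) has_sum (\<Sum>d\<le>n. (\<phi> 0 d * z d) * Dw n d)) (Sigma {..n} parts_le)"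
    by (subst (asm) has_sum_cong[where g = "\<lambda>(d, g). colweight \<phi> (case_nat d g) * Dw n (case_nat d g 0)"]) auto
  then show "((\<lambda>g. colweight \<phi> g * Dw n (g 0)) has_sum (\<Sum>d\<le>n. (\<phi> 0 d * z d) * Dw n d)) (parts_le n)"
    by (subst parts_le_pcons, subst has_sum_reindex[OF inj_pcons]) (simp only: comp_def case_prod_unfold)
qed

lemma column_sums_top:
  assumes ev: "ev_one \<phi>" and z: "column_sums (\<lambda>i. \<phi> (Suc i)) z" and za: "column_sums (\<lambda>i c. \<bar>\<phi> (Suc i) c\<bar>) za"
    and h: "(\<lambda>d. \<bar>\<phi> 0 d\<bar> * za d) summable_on UNIV" and hs: "((\<lambda>d. \<phi> 0 d * z d) has_sum S) UNIV"
  shows "(colweight \<phi> has_sum S) partitions"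
proof -
  have "((\<lambda>(d, g). \<phi> 0 d * (colweight (\<lambda>i. \<phi> (Suc i)) g * Dw d (g 0))) has_sum S) (Sigma UNIV parts_le)"
    by (rule column_sums_sum_pcons[OF ev z za h hs])
  then have "((\<lambda>(d, g). colweight \<phi> (case_nat d g)) has_sum S) (Sigma UNIV parts_le)"
    by (subst (asm) has_sum_cong[where g = "\<lambda>(d, g). colweight \<phi> (case_nat d g)"]) (auto simp: colweight_pcons[OF ev])
  then show ?thesis
    unfolding partitions_pcons has_sum_reindex[OF inj_pcons] comp_def by (simp only: case_prod_unfold)
qed

section \<open>The columns without sign, surjection factor and power of \<open>p\<close>\<close>

definition base_weight :: "nat \<Rightarrow> nat \<Rightarrow> real" where "base_weight i c = q ^ (Suc c choose 2)"

lemma base_weight_ev_one: "ev_one base_weight" and base_weight_abs: "(\<lambda>i c. \<bar>base_weight (Suc i) c\<bar>) = base_weight" "(\<lambda>i. base_weight (Suc i)) = base_weight"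
  using q_pos by (auto simp: ev_one_def base_weight_def numeral_2_eq_2 fun_eq_iff)

lemma colweight_base_weight_nonneg: "g \<in> partitions \<Longrightarrow> colweight base_weight g \<ge> 0"
  unfolding colweight_def by (rule prod_nonneg) (use q_pos Qf_pos in \<open>auto simp: wfac_def base_weight_def less_imp_le\<close>)

lemma tail_identity': "(\<Sum>d\<le>n. base_weight 0 d * (1 / qf d) * Dw n d) = 1 / qf n"
proof -
  have "(\<Sum>d\<le>n. base_weight 0 d * (1 / qf d) * Dw n d) = (\<Sum>d\<le>n. q ^ (Suc d choose 2) / (Qf ((n - d) div 2) * qf d))"
    by (rule sum.cong) (simp_all add: base_weight_def Dw_def mult.commute)
  then show ?thesis by (simp only: tail_identity)
qed

text \<open>By \<open>tail_identity'\<close> the function \<open>1 / qf\<close> is fixed by the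
  transfer recursion. The sums over at most \<open>N\<close> columns start below it, as one term of
  that identity, and stay below it.\<close>

lemma base_weight_finite_bound:
  "finite {g \<in> parts_le n. part_length g \<le> N} \<and> (\<Sum>g\<in>{g \<in> parts_le n. part_length g \<le> N}. colweight base_weight g * Dw n (g 0)) \<le> 1 / qf n"
proof (induction N arbitrary: n)
  case 0
  have e: "{g \<in> parts_le n. part_length g \<le> 0} = {\<lambda>_. 0}"
    using part_zero_iff by (auto simp: parts_le_def fun_eq_iff)
  have "colweight base_weight (\<lambda>_. 0) = 1"
    by (subst colweight_eq[of 0]) (auto simp: wfac_def base_weight_def numeral_2_eq_2)
  moreover have "base_weight 0 0 * (1 / qf 0) * Dw n 0 \<le> (\<Sum>d\<le>n. base_weight 0 d * (1 / qf d) * Dw n d)"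
    by (rule member_le_sum[where f = "\<lambda>d. base_weight 0 d * (1 / qf d) * Dw n d"])
      (use q_pos qf_pos Dw_bounds in \<open>auto simp: base_weight_def less_imp_le\<close>)
  moreover have "base_weight 0 0 = 1" by (simp add: base_weight_def numeral_2_eq_2)
  ultimately show ?case unfolding e tail_identity' by simp
next
  case (Suc N)
  let ?Y = "\<lambda>d. {g \<in> parts_le d. part_length g \<le> N}"
  have img: "{g \<in> parts_le n. part_length g \<le> Suc N} = pcons ` Sigma {..n} ?Y"
  proof
    show "{g \<in> parts_le n. part_length g \<le> Suc N} \<subseteq> pcons ` Sigma {..n} ?Y"
    proof
      fix g assume g: "g \<in> {g \<in> parts_le n. part_length g \<le> Suc N}"
      then have "g = pcons (g 0, \<lambda>i. g (Suc i))" by (auto simp: fun_eq_iff split: nat.splits)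
      moreover have "(g 0, \<lambda>i. g (Suc i)) \<in> Sigma {..n} ?Y"
        using g part_tl_partition[of g] part_tl_length[of g] partitions_antimono[of g 0 1] by (auto simp: parts_le_def)
      ultimately show "g \<in> pcons ` Sigma {..n} ?Y" by blast
    qed
    show "pcons ` Sigma {..n} ?Y \<subseteq> {g \<in> parts_le n. part_length g \<le> Suc N}"
    proof clarsimp
      fix d g assume d: "d \<le> n" "g \<in> parts_le d" "part_length g \<le> N"
      have p: "case_nat d g \<in> partitions" by (rule pcons_partition[OF d(2)])
      have "part_length (case_nat d g) \<le> Suc N" using part_tl_length[OF p] d(3) by simp
      then show "case_nat d g \<in> parts_le n \<and> part_length (case_nat d g) \<le> Suc N" using p d(1) by (simp add: parts_le_def)
    qed
  qed
  have inj: "inj_on pcons (Sigma {..n} ?Y)" by (rule inj_on_subset[OF inj_pcons[of "{..n}"]]) auto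
  have fin: "finite (Sigma {..n} ?Y)" using Suc by (intro finite_SigmaI) auto
  have "(\<Sum>g\<in>pcons ` Sigma {..n} ?Y. colweight base_weight g * Dw n (g 0)) =
      (\<Sum>(d, g)\<in>Sigma {..n} ?Y. base_weight 0 d * Dw n d * (colweight base_weight g * Dw d (g 0)))"
    by (subst sum.reindex[OF inj]) (auto simp: colweight_pcons[OF base_weight_ev_one] base_weight_abs intro!: sum.cong)
  also have "\<dots> = (\<Sum>d\<le>n. base_weight 0 d * Dw n d * (\<Sum>g\<in>?Y d. colweight base_weight g * Dw d (g 0)))"
    using Suc by (subst sum.Sigma[symmetric]) (auto simp: sum_distrib_left)
  also have "\<dots> \<le> (\<Sum>d\<le>n. base_weight 0 d * Dw n d * (1 / qf d))"
  proof (rule sum_mono, rule mult_left_mono)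
    show "(\<Sum>g\<in>?Y d. colweight base_weight g * Dw d (g 0)) \<le> 1 / qf d" for d using Suc[of d] by blast
    show "0 \<le> base_weight 0 d * Dw n d" for d using q_pos Dw_bounds(1) by (simp add: base_weight_def)
  qed
  also have "\<dots> = (\<Sum>d\<le>n. base_weight 0 d * (1 / qf d) * Dw n d)" by (rule sum.cong) simp_all
  also have "\<dots> = 1 / qf n" by (rule tail_identity')
  finally show ?case unfolding img using fin by simp
qed

text \<open>The finite bounds give convergence, and the limit obeys the recursion. There
  \<open>z n\<close> reappears on the right with the coefficient \<open>base_weight 0 n < 1\<close>
  for \<open>n > 0\<close>, so the recursion and the value at 0 determine \<open>z\<close>, and
  \<open>1 / qf\<close> is the solution.\<close>

lemma column_sums_base_weight: "column_sums base_weight (\<lambda>n. 1 / qf n)"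
proof -
  have summ: "(\<lambda>g. colweight base_weight g * Dw n (g 0)) summable_on parts_le n" for n
  proof (rule nonneg_bdd_above_summable_on)
    show "0 \<le> colweight base_weight g * Dw n (g 0)" if "g \<in> parts_le n" for g
      using colweight_base_weight_nonneg Dw_bounds(1) that by (auto simp: parts_le_def)
    show "bdd_above (sum (\<lambda>g. colweight base_weight g * Dw n (g 0)) ` {F. F \<subseteq> parts_le n \<and> finite F})"
    proof (rule bdd_aboveI2)
      fix F assume "F \<in> {F. F \<subseteq> parts_le n \<and> finite F}"
      then have F: "F \<subseteq> parts_le n" "finite F" by auto
      define N where "N = Max (insert 0 (part_length ` F))"
      have "part_length g \<le> N" if "g \<in> F" for g using F that by (simp add: N_def)
      then have "F \<subseteq> {g \<in> parts_le n. part_length g \<le> N}" using F by auto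
      then have "sum (\<lambda>g. colweight base_weight g * Dw n (g 0)) F \<le> (\<Sum>g\<in>{g \<in> parts_le n. part_length g \<le> N}. colweight base_weight g * Dw n (g 0))"
        using base_weight_finite_bound[of n N] colweight_base_weight_nonneg Dw_bounds(1) by (intro sum_mono2) (auto simp: parts_le_def)
      then show "sum (\<lambda>g. colweight base_weight g * Dw n (g 0)) F \<le> 1 / qf n" using base_weight_finite_bound[of n N] by linarith
    qed
  qed
  define z where "z n = infsum (\<lambda>g. colweight base_weight g * Dw n (g 0)) (parts_le n)" for n
  have z: "column_sums base_weight z" using summ by (simp add: column_sums_def z_def)
  have "column_sums base_weight (\<lambda>n. \<Sum>d\<le>n. (base_weight 0 d * z d) * Dw n d)"
    using column_sums_step[OF base_weight_ev_one, of z z] z by (simp add: base_weight_abs)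
  then have rec: "z n = (\<Sum>d\<le>n. (base_weight 0 d * z d) * Dw n d)" for n
    using z unfolding column_sums_def by (blast intro: has_sum_unique)
  have "z n = 1 / qf n" for n
  proof (induction n rule: less_induct)
    case (less n)
    show ?case
    proof (cases "n = 0")
      case True
      have "parts_le 0 = {\<lambda>_. 0}"
      proof
        show "parts_le 0 \<subseteq> {\<lambda>_. 0}"
        proof
          fix g assume "g \<in> parts_le 0"
          then have "g i = 0" for i using partitions_antimono[of g 0 i] by (auto simp: parts_le_def)
          then show "g \<in> {\<lambda>_. 0}" by auto
        qed
      qed (auto simp: parts_le_def)
      moreover have "colweight base_weight (\<lambda>_. 0) = 1"
        by (subst colweight_eq[of 0]) (auto simp: wfac_def base_weight_def numeral_2_eq_2)
      ultimately show ?thesis using True by (simp add: z_def Dw_def)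
    next
      case False
      have lt: "base_weight 0 n < 1"
      proof -
        have "0 < (Suc n choose 2)" using False by (simp add: numeral_2_eq_2)
        then show ?thesis unfolding base_weight_def by (rule pow_less_1)
      qed
      have Dnn: "Dw n n = 1" by (simp add: Dw_def)
      have "z n = (\<Sum>d<n. (base_weight 0 d * z d) * Dw n d) + base_weight 0 n * z n"
        by (subst rec) (simp add: lessThan_Suc_atMost[symmetric] Dnn)
      also have "(\<Sum>d<n. (base_weight 0 d * z d) * Dw n d) = (\<Sum>d<n. base_weight 0 d * (1 / qf d) * Dw n d)"
        by (rule sum.cong) (auto simp: less)
      also have "\<dots> = 1 / qf n - base_weight 0 n * (1 / qf n)"
        using tail_identity'[of n] by (simp add: lessThan_Suc_atMost[symmetric] Dnn)
      finally have "z n = 1 / qf n - base_weight 0 n * (1 / qf n) + base_weight 0 n * z n" .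
      moreover have "(x - v) * (1 - b) = 0" if "x = v - b * v + b * x" for x v b :: real
        using that by (simp add: algebra_simps)
      ultimately have "(z n - 1 / qf n) * (1 - base_weight 0 n) = 0" by blast
      then show ?thesis using lt by simp
    qed
  qed
  then show ?thesis using z by (simp add: column_sums_def)
qed

lemma base_weight_Ew: "q ^ (Suc c choose 2) = Ew 0 c"
proof -
  have "q ^ (Suc c choose 2) = q powr real (Suc c choose 2)" using q_pos by (simp add: powr_realpow)
  also have "real (Suc c choose 2) = real c * (real c + 1) / 2 - 0 * real c" by (simp only: real_choose_2) simp
  finally show ?thesis by (simp only: Ew_def)
qed

text \<open>From column \<open>K\<close> on, the weights are the base weights with their known
  bounded sum. Each of the finitely many columns in front has a Gaussian bound, so one more transfer
  step preserves boundedness by \<open>column_bounded\<close>.\<close>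

lemma column_sums_abs_bounded:
  assumes "\<And>i c. i \<ge> K \<Longrightarrow> \<phi> i c = q ^ (Suc c choose 2)"
    and "\<And>i. \<exists>B\<ge>0. \<exists>e. \<forall>c. \<bar>\<phi> i c\<bar> \<le> B * Ew e c"
  shows "\<exists>z B. column_sums (\<lambda>i c. \<bar>\<phi> i c\<bar>) z \<and> B \<ge> 0 \<and> (\<forall>n. 0 \<le> z n \<and> z n \<le> B)"
  using assms
proof (induction K arbitrary: \<phi>)
  case 0
  then have "(\<lambda>i c. \<bar>\<phi> i c\<bar>) = base_weight" using q_pos by (simp add: base_weight_def fun_eq_iff)
  then have "column_sums (\<lambda>i c. \<bar>\<phi> i c\<bar>) (\<lambda>n. 1 / qf n)" using column_sums_base_weight by simp
  moreover have "0 \<le> 1 / qf n \<and> 1 / qf n \<le> 1 / q0" for n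
    using qf_pos[of n] q0_pos q0_le[of n] by (simp add: frac_le)
  ultimately show ?case using q0_pos by (intro exI[of _ "\<lambda>n. 1 / qf n"] exI[of _ "1 / q0"]) auto
next
  case (Suc K)
  let ?a = "\<lambda>i c. \<bar>\<phi> i c\<bar>"
  have "\<exists>z B. column_sums (\<lambda>i c. \<bar>\<phi> (Suc i) c\<bar>) z \<and> B \<ge> 0 \<and> (\<forall>n. 0 \<le> z n \<and> z n \<le> B)"
    by (rule Suc.IH[of "\<lambda>i. \<phi> (Suc i)"]) (use Suc.prems in auto)
  then obtain z B where z: "column_sums (\<lambda>i. ?a (Suc i)) z" "B \<ge> 0" "\<And>n. 0 \<le> z n" "\<And>n. z n \<le> B" by blast
  obtain C e where C: "C \<ge> 0" "\<And>c. \<bar>\<phi> 0 c\<bar> \<le> C * Ew e c" using Suc.prems(2)[of 0] by blast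
  have ev: "ev_one ?a"
    unfolding ev_one_def by (rule exI[of _ "Suc K"]) (use Suc.prems(1) in \<open>auto simp: numeral_2_eq_2\<close>)
  have g: "column_sums ?a (\<lambda>n. \<Sum>d\<le>n. (\<bar>\<phi> 0 d\<bar> * z d) * Dw n d)"
    by (rule column_sums_step[OF ev z(1)]) (use z(1) in simp)
  have wb: "\<bar>\<bar>\<phi> 0 d\<bar> * z d\<bar> \<le> (C * B) * Ew e d" for d
  proof -
    have "\<bar>\<phi> 0 d\<bar> * z d \<le> (C * Ew e d) * B"
      using C z Ew_pos[of e d] by (intro mult_mono) auto
    then show ?thesis using z(3)[of d] by (simp add: mult_ac)
  qed
  obtain B' where B': "B' \<ge> 0" "\<And>c. \<bar>\<Sum>s\<le>c. (\<bar>\<phi> 0 s\<bar> * z s) * Dw c s\<bar> \<le> B'"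
    using column_bounded[OF _ wb] C(1) z(2) by (metis mult_nonneg_nonneg)
  have "0 \<le> (\<Sum>s\<le>n. (\<bar>\<phi> 0 s\<bar> * z s) * Dw n s)" for n
    by (intro sum_nonneg mult_nonneg_nonneg) (use z(3) Dw_bounds(1) in auto)
  then show ?case using g B' by (meson abs_le_iff)
qed

text \<open>The product in \<open>sur_factor\<close> is the quotient of the two q-factorials. It
  moves the offset from \<open>b\<close> to \<open>a\<close>, and its zeros at
  \<open>b \<le> d < a\<close> shrink the support accordingly.\<close>

lemma sur_factor_Dw_tail:
  assumes "b \<le> a"
  shows "sur_factor a b d * (if b \<le> d then 1 / qf (d - b) else 0) = (if a \<le> d then (1 / q) ^ (a * d) / qf (d - a) else 0)"
proof (cases "a \<le> d")
  case True
  have "qf (d - b) = qf (d - a) * (\<Prod>j<a - b. 1 - q ^ (d - b - j))"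
    using qf_ratio[of "d - a" "d - b"] True assms by simp
  also have "(\<Prod>j<a - b. 1 - q ^ (d - b - j)) = (\<Prod>j=b..<a. 1 - (1 / q) ^ j * q ^ d)"
  proof (rule prod.reindex_bij_witness[where i = "\<lambda>j. j - b" and j = "\<lambda>j. j + b"])
    fix j assume "j \<in> {..<a - b}"
    then have "(d - b - j) + (j + b) = d" using True assms by simp
    then have "q ^ d = q ^ (d - b - j) * q ^ (j + b)" by (simp only: power_add[symmetric])
    then show "1 - (1 / q) ^ (j + b) * q ^ d = 1 - q ^ (d - b - j)" using q_pos by (simp add: power_one_over)
  qed auto
  finally have P: "qf (d - b) = qf (d - a) * (\<Prod>j=b..<a. 1 - (1 / q) ^ j * q ^ d)" .
  have nz: "(\<Prod>j=b..<a. 1 - (1 / q) ^ j * q ^ d) \<noteq> 0"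
  proof
    assume "(\<Prod>j=b..<a. 1 - (1 / q) ^ j * q ^ d) = 0"
    then have "qf (d - b) = 0" unfolding P by (simp only: mult_zero_right)
    then show False by simp
  qed
  have "b \<le> d" using True assms by simp
  moreover have "x * y * (1 / (z * y)) = x / z" if "y \<noteq> 0" for x y z :: real using that by simp
  ultimately show ?thesis using True nz by (simp only: sur_factor_def P if_True)
next
  case False
  show ?thesis
  proof (cases "b \<le> d")
    case True
    have "(\<Prod>j=b..<a. 1 - (1 / q) ^ j * q ^ d) = 0"
      by (rule prod_zero) (use True False q_pos in \<open>auto intro!: bexI[of _ d] simp: power_one_over\<close>)
    then show ?thesis using False by (simp add: sur_factor_def)
  qed (use False in simp)
qed

text \<open>For \<open>b \<le> a\<close> the exponents run from \<open>b\<close> to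
  \<open>a\<close>. The form \<open>a - (a - b)\<close> also covers \<open>b > a\<close>, where the
  product is empty and the single exponent is \<open>a\<close>.\<close>

lemma sur_factor_powers:
  obtains f where "\<And>c. sur_factor a b c = (\<Sum>d\<in>{a - (a - b)..a}. f d * q powr (- real d * real c))"
proof -
  have "\<exists>f. \<forall>c. (\<Prod>j=b..<b + m. 1 - (1 / q) ^ j * q ^ c) = (\<Sum>d\<le>m. f d * q powr (real d * real c))" for m
  proof (induction m)
    case 0 then show ?case using q_pos by (intro exI[of _ "\<lambda>_. 1"]) simp
  next
    case (Suc m)
    then obtain f where f: "\<And>c. (\<Prod>j=b..<b + m. 1 - (1 / q) ^ j * q ^ c) = (\<Sum>d\<le>m. f d * q powr (real d * real c))" by blast
    define u where "u = (1 / q) ^ (b + m)"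
    define f' where "f' d = (if d \<le> m then f d else 0) - (if d = 0 then 0 else u * f (d - 1))" for d
    have "(\<Prod>j=b..<b + Suc m. 1 - (1 / q) ^ j * q ^ c) = (\<Sum>d\<le>Suc m. f' d * q powr (real d * real c))" for c
    proof -
      have "(\<Prod>j=b..<b + Suc m. 1 - (1 / q) ^ j * q ^ c) = (\<Sum>d\<le>m. f d * q powr (real d * real c)) * (1 - u * q ^ c)"
        using f by (simp add: u_def)
      also have "\<dots> = (\<Sum>d\<le>m. f d * q powr (real d * real c)) - (\<Sum>d\<le>m. u * f d * q powr (real (Suc d) * real c))"
      proof -
        have "q powr (real (Suc d) * real c) = q powr (real d * real c) * q ^ c" for d
        proof -
          have "q powr (real (Suc d) * real c) = q powr (real d * real c + real c)" by (simp add: algebra_simps)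
          then show ?thesis using q_pos by (simp add: powr_add powr_realpow)
        qed
        then have "(\<Sum>d\<le>m. u * f d * q powr (real (Suc d) * real c)) = (\<Sum>d\<le>m. (f d * q powr (real d * real c)) * (u * q ^ c))"
          by (intro sum.cong refl) (simp only: mult_ac)
        also have "\<dots> = (\<Sum>d\<le>m. f d * q powr (real d * real c)) * (u * q ^ c)" by (rule sum_distrib_right[symmetric])
        finally show ?thesis by (simp only: right_diff_distrib mult_1_right)
      qed
      also have "(\<Sum>d\<le>m. f d * q powr (real d * real c)) = (\<Sum>d\<le>Suc m. (if d \<le> m then f d else 0) * q powr (real d * real c))"
        by simp
      also have "(\<Sum>d\<le>m. u * f d * q powr (real (Suc d) * real c)) =
          (\<Sum>d\<le>Suc m. (if d = 0 then 0 else u * f (d - 1)) * q powr (real d * real c))"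
        by (subst sum.atMost_Suc_shift) simp
      also have "(\<Sum>d\<le>Suc m. (if d \<le> m then f d else 0) * q powr (real d * real c)) - \<dots> =
          (\<Sum>d\<le>Suc m. f' d * q powr (real d * real c))"
        unfolding sum_subtractf[symmetric] f'_def by (simp only: left_diff_distrib)
      finally show ?thesis .
    qed
    then show ?case by blast
  qed
  then obtain f where f: "\<And>c. (\<Prod>j=b..<b + (a - b). 1 - (1 / q) ^ j * q ^ c) = (\<Sum>d\<le>a - b. f d * q powr (real d * real c))" by blast
  have e: "{b..<b + (a - b)} = {b..<a}" by auto
  have p: "(1 / q) ^ (a * c) = q powr (- real a * real c)" for c
  proof -
    have "(1 / q) ^ (a * c) = inverse (q powr real (a * c))"
      using q_pos by (simp only: powr_realpow) (simp add: divide_inverse power_inverse)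
    then show ?thesis by (simp add: powr_minus)
  qed
  have "sur_factor a b c = (\<Sum>d\<in>{a - (a - b)..a}. f (a - d) * q powr (- real d * real c))" for c
  proof -
    have "sur_factor a b c = (\<Sum>d\<le>a - b. f d * (q powr (- real a * real c) * q powr (real d * real c)))"
      unfolding sur_factor_def f[unfolded e] p sum_distrib_left by (rule sum.cong) (simp_all add: mult_ac)
    also have "\<dots> = (\<Sum>d\<in>{a - (a - b)..a}. f (a - d) * q powr (- real d * real c))"
    proof (rule sum.reindex_bij_witness[where i = "\<lambda>d. a - d" and j = "\<lambda>d. a - d"])
      fix d assume d: "d \<in> {..a - b}"
      then have "d \<le> a" by auto
      then have ex: "- real (a - d) * real c = - real a * real c + real d * real c" by (simp add: of_nat_diff algebra_simps)
      show "f (a - (a - d)) * q powr (- real (a - d) * real c) = f d * (q powr (- real a * real c) * q powr (real d * real c))"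
        unfolding ex powr_add using \<open>d \<le> a\<close> by simp
    qed auto
    finally show ?thesis .
  qed
  then show ?thesis by (rule that)
qed

section \<open>Vanishing of the signed moments\<close>

definition layer_weight :: "(nat \<Rightarrow> real) \<Rightarrow> (nat \<Rightarrow> nat) \<Rightarrow> (nat \<Rightarrow> nat) \<Rightarrow> nat \<Rightarrow> nat \<Rightarrow> real" where
  "layer_weight \<epsilon> k a i c = \<epsilon> i ^ c * sur_factor (a i) (a (Suc i)) c * Ew (real (k i)) c"

lemma layer_weight_shift: "(\<lambda>i. layer_weight \<epsilon> k a (Suc i)) = layer_weight (\<lambda>i. \<epsilon> (Suc i)) (\<lambda>i. k (Suc i)) (\<lambda>i. a (Suc i))"
  by (simp add: layer_weight_def fun_eq_iff)

lemma layer_weight_trivial: "\<epsilon> i = 1 \<Longrightarrow> k i = 0 \<Longrightarrow> a i = 0 \<Longrightarrow> layer_weight \<epsilon> k a i c = q ^ (Suc c choose 2)"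
  by (simp only: layer_weight_def sur_factor_def base_weight_Ew) simp

lemma sur_factor_bound: "\<exists>B\<ge>0. \<forall>c. \<bar>sur_factor a b c\<bar> \<le> B * q powr (- real a * real c)"
proof -
  obtain f where f: "\<And>c. sur_factor a b c = (\<Sum>d\<in>{a - (a - b)..a}. f d * q powr (- real d * real c))"
    using sur_factor_powers[of a b] by blast
  have "\<bar>sur_factor a b c\<bar> \<le> (\<Sum>d\<in>{a - (a - b)..a}. \<bar>f d\<bar>) * q powr (- real a * real c)" for c
    unfolding f sum_distrib_right
  proof (rule order_trans[OF sum_abs], rule sum_mono)
    fix d assume "d \<in> {a - (a - b)..a}"
    then have "q powr (- real d * real c) \<le> q powr (- real a * real c)"
      using q_pos q_less_1 by (intro powr_mono') (auto intro: mult_right_mono)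
    then show "\<bar>f d * q powr (- real d * real c)\<bar> \<le> \<bar>f d\<bar> * q powr (- real a * real c)"
      by (simp add: abs_mult mult_left_mono)
  qed
  then show ?thesis by (intro exI[of _ "\<Sum>d\<in>{a - (a - b)..a}. \<bar>f d\<bar>"]) (auto intro: sum_nonneg)
qed

lemma layer_weight_bound:
  assumes "\<epsilon> i = 1 \<or> \<epsilon> i = -1"
  shows "\<exists>B\<ge>0. \<forall>c. \<bar>layer_weight \<epsilon> k a i c\<bar> \<le> B * Ew (real (k i + a i)) c"
proof -
  obtain B where B: "B \<ge> 0" "\<And>c. \<bar>sur_factor (a i) (a (Suc i)) c\<bar> \<le> B * q powr (- real (a i) * real c)"
    using sur_factor_bound[of "a i" "a (Suc i)"] by blast
  have "\<bar>layer_weight \<epsilon> k a i c\<bar> \<le> B * Ew (real (k i + a i)) c" for c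
  proof -
    have "\<bar>\<epsilon> i ^ c\<bar> = 1" using assms by (auto simp: power_abs)
    then have "\<bar>layer_weight \<epsilon> k a i c\<bar> = \<bar>sur_factor (a i) (a (Suc i)) c\<bar> * Ew (real (k i)) c"
      using Ew_pos[of "real (k i)" c] by (simp add: layer_weight_def abs_mult)
    also have "\<dots> \<le> B * q powr (- real (a i) * real c) * Ew (real (k i)) c"
      using B Ew_pos[of "real (k i)" c] by (intro mult_right_mono) auto
    also have "\<dots> = B * (Ew (real (k i)) c * q powr (- real (a i) * real c))" by simp
    also have "\<dots> = B * Ew (real (k i + a i)) c" unfolding Ew_mult by simp
    finally show ?thesis .
  qed
  then show ?thesis using B(1) by blast
qed

lemma layer_weight_ev_one:
  assumes "\<And>i. i \<ge> K \<Longrightarrow> \<epsilon> i = 1 \<and> k i = 0 \<and> a i = 0" shows "ev_one (layer_weight \<epsilon> k a)"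
  unfolding ev_one_def
  by (rule exI[of _ K]) (use assms in \<open>auto simp: layer_weight_trivial numeral_2_eq_2\<close>)

lemma layer_weight_abs_bounded:
  assumes "\<And>i. i \<ge> K \<Longrightarrow> \<epsilon> i = 1 \<and> k i = 0 \<and> a i = 0" and "\<And>i. \<epsilon> i = 1 \<or> \<epsilon> i = -1"
  shows "\<exists>z B. column_sums (\<lambda>i c. \<bar>layer_weight \<epsilon> k a (Suc i) c\<bar>) z \<and> B \<ge> 0 \<and> (\<forall>n. 0 \<le> z n \<and> z n \<le> B)"
proof (rule column_sums_abs_bounded[of K])
  show "layer_weight \<epsilon> k a (Suc i) c = q ^ (Suc c choose 2)" if "K \<le> i" for i c
    using assms(1)[of "Suc i"] that by (simp add: layer_weight_trivial)
  show "\<exists>B\<ge>0. \<exists>e. \<forall>c. \<bar>layer_weight \<epsilon> k a (Suc i) c\<bar> \<le> B * Ew e c" for i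
    using layer_weight_bound[of \<epsilon> "Suc i" k a] assms(2)[of "Suc i"] by blast
qed

lemma Ew_shift: "Ew (real a) (a + c) = Ew (real a) a * Ew 0 c"
  unfolding Ew_def powr_add[symmetric]
  by (rule arg_cong[where f = "(powr) q"]) (simp add: field_simps)

lemma Ew_sur_factor_tail:
  assumes "b \<le> a"
  shows "sur_factor a b d * Ew x d * (if b \<le> d then C / qf (d - b) else 0) = C * (Ew (x + real a) d * (if a \<le> d then 1 / qf (d - a) else 0))"
proof -
  have p: "(1 / q) ^ (a * d) = q powr (- real a * real d)"
  proof -
    have "(1 / q) ^ (a * d) = inverse (q powr real (a * d))"
      using q_pos by (simp only: powr_realpow) (simp add: divide_inverse power_inverse)
    then show ?thesis by (simp add: powr_minus)
  qed
  have "sur_factor a b d * Ew x d * (if b \<le> d then C / qf (d - b) else 0) = C * Ew x d * (sur_factor a b d * (if b \<le> d then 1 / qf (d - b) else 0))"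
    by simp
  also have "\<dots> = C * ((Ew x d * q powr (- real a * real d)) * (if a \<le> d then 1 / qf (d - a) else 0))"
    unfolding sur_factor_Dw_tail[OF assms] p by simp
  finally show ?thesis unfolding Ew_mult .
qed

text \<open>The form \<open>C / qf (n - a 0)\<close> survives another column in front: the
  surjection factor changes the offset from \<open>a (Suc 0)\<close> to \<open>a 0\<close>, and once
  the lengths are shifted by \<open>a 0\<close> the remaining sum is \<open>tail_identity'\<close>.
  The induction is on the bound \<open>K\<close> beyond which \<open>a\<close> vanishes.\<close>

lemma tail_column_sums:
  assumes "\<And>i. a (Suc i) \<le> a i" "\<And>i. i \<ge> K \<Longrightarrow> a i = 0" "\<And>i. \<epsilon> i = 1" "\<And>i. k i = 0"
  shows "\<exists>C. column_sums (layer_weight \<epsilon> k a) (\<lambda>n. if a 0 \<le> n then C / qf (n - a 0) else 0)"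
  using assms
proof (induction K arbitrary: a \<epsilon> k)
  case 0
  have e: "layer_weight \<epsilon> k a = base_weight" using 0 by (simp add: fun_eq_iff layer_weight_trivial base_weight_def)
  have "(\<lambda>n. if a 0 \<le> n then 1 / qf (n - a 0) else 0) = (\<lambda>n. 1 / qf n)" using 0 by simp
  then have "column_sums (layer_weight \<epsilon> k a) (\<lambda>n. if a 0 \<le> n then 1 / qf (n - a 0) else 0)" unfolding e using column_sums_base_weight by simp
  then show ?case by blast
next
  case (Suc K)
  have "\<exists>C. column_sums (layer_weight (\<lambda>i. \<epsilon> (Suc i)) (\<lambda>i. k (Suc i)) (\<lambda>i. a (Suc i))) (\<lambda>n. if a (Suc 0) \<le> n then C / qf (n - a (Suc 0)) else 0)"
    by (rule Suc.IH) (use Suc.prems in auto)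
  then obtain C where C: "column_sums (\<lambda>i. layer_weight \<epsilon> k a (Suc i)) (\<lambda>n. if a (Suc 0) \<le> n then C / qf (n - a (Suc 0)) else 0)"
    unfolding layer_weight_shift by blast
  obtain za where za': "column_sums (\<lambda>i c. \<bar>layer_weight \<epsilon> k a (Suc i) c\<bar>) za"
    using layer_weight_abs_bounded[of "Suc K" \<epsilon> k a] Suc.prems by blast
  have ev: "ev_one (layer_weight \<epsilon> k a)" by (rule layer_weight_ev_one[of "Suc K"]) (use Suc.prems in auto)
  let ?z = "\<lambda>n. if a (Suc 0) \<le> n then C / qf (n - a (Suc 0)) else 0"
  have "(\<Sum>d\<le>n. (layer_weight \<epsilon> k a 0 d * ?z d) * Dw n d) = (if a 0 \<le> n then C * Ew (real (a 0)) (a 0) / qf (n - a 0) else 0)" for n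
  proof -
    have t: "layer_weight \<epsilon> k a 0 d * ?z d = C * (Ew (real (a 0)) d * (if a 0 \<le> d then 1 / qf (d - a 0) else 0))" for d
      using Ew_sur_factor_tail[OF Suc.prems(1)[of 0], of d 0 C] Suc.prems(3,4) by (simp add: layer_weight_def)
    show ?thesis
    proof (cases "a 0 \<le> n")
      case False
      then show ?thesis unfolding t by (simp add: Dw_def)
    next
      case True
      have "(\<Sum>d\<le>n. (layer_weight \<epsilon> k a 0 d * ?z d) * Dw n d) =
          (\<Sum>d\<in>{a 0..n}. C * (Ew (real (a 0)) d * (1 / qf (d - a 0))) * Dw n d)"
        unfolding t by (rule sum.mono_neutral_cong_right) auto
      also have "\<dots> = (\<Sum>m\<le>n - a 0. C * Ew (real (a 0)) (a 0) * (base_weight 0 m * (1 / qf m) * Dw (n - a 0) m))"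
      proof (rule sum.reindex_bij_witness[where i = "\<lambda>m. a 0 + m" and j = "\<lambda>d. d - a 0"])
        fix d assume d: "d \<in> {a 0..n}"
        then obtain m where m: "d = a 0 + m" by (auto dest: le_Suc_ex)
        have "Dw n d = Dw (n - a 0) m" using d m by (auto simp: Dw_def)
        then show "C * Ew (real (a 0)) (a 0) * (base_weight 0 (d - a 0) * (1 / qf (d - a 0)) * Dw (n - a 0) (d - a 0)) =
           C * (Ew (real (a 0)) d * (1 / qf (d - a 0))) * Dw n d"
          unfolding m by (simp add: Ew_shift base_weight_def base_weight_Ew del: binomial_Suc_n)
      qed (use True in auto)
      also have "\<dots> = C * Ew (real (a 0)) (a 0) * (1 / qf (n - a 0))"
        unfolding sum_distrib_left[symmetric] tail_identity' ..
      finally show ?thesis using True by simp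
    qed
  qed
  then show ?case using column_sums_step[OF ev C za'] by (intro exI[of _ "C * Ew (real (a 0)) (a 0)"]) simp
qed

text \<open>The sign \<open>\<tau>\<close> represents what the columns further out contribute; each
  step inwards multiplies it by the sign of the column passed. The growth bound and the vanishing
  for every \<open>j\<close> are carried along because \<open>layer_step\<close> consumes
  both.\<close>

lemma signed_column_sums_vanish:
  assumes "\<And>i. a (Suc i) \<le> a i" "\<And>i. i \<ge> K \<Longrightarrow> a i = 0"
    and "\<And>i. Suc i < Suc m \<Longrightarrow> k (Suc i) < k i" "k m \<ge> 1" "\<And>i. i \<ge> Suc m \<Longrightarrow> k i = 0"
    and "\<And>i. i \<ge> Suc m \<Longrightarrow> \<epsilon> i = 1" "\<And>i. \<epsilon> i = 1 \<or> \<epsilon> i = -1"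
    and "\<tau> = 1 \<or> \<tau> = -1" "\<tau> * (\<Prod>i<Suc m. \<epsilon> i) = -1"
  shows "\<exists>z B. column_sums (\<lambda>i. layer_weight \<epsilon> k a (Suc i)) z \<and> B \<ge> 0 \<and>
    (\<forall>c. \<bar>layer_weight \<epsilon> k a 0 c * z c\<bar> \<le> B * Ew (real (k 0 + a 0)) c) \<and>
    (\<forall>j :: nat. ((\<lambda>c. layer_weight \<epsilon> k a 0 c * z c * \<tau> ^ c * q powr (- real j * real c)) has_sum 0) UNIV)"
  using assms
proof (induction m arbitrary: a k \<epsilon> \<tau>)
  case 0
  have "\<exists>C. column_sums (layer_weight (\<lambda>i. \<epsilon> (Suc i)) (\<lambda>i. k (Suc i)) (\<lambda>i. a (Suc i))) (\<lambda>n. if a (Suc 0) \<le> n then C / qf (n - a (Suc 0)) else 0)"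
    by (rule tail_column_sums[of _ K]) (use 0 in auto)
  then obtain C where C: "column_sums (\<lambda>i. layer_weight \<epsilon> k a (Suc i)) (\<lambda>n. if a (Suc 0) \<le> n then C / qf (n - a (Suc 0)) else 0)"
    unfolding layer_weight_shift by blast
  let ?z = "\<lambda>n. if a (Suc 0) \<le> n then C / qf (n - a (Suc 0)) else 0"
  let ?h = "\<lambda>c. \<epsilon> 0 ^ c * Ew (real (k 0 + a 0)) c * (if a 0 \<le> c then 1 / qf (c - a 0) else 0)"
  have t: "layer_weight \<epsilon> k a 0 c * ?z c = C * ?h c" for c
    using Ew_sur_factor_tail[OF 0(1)[of 0], of c "real (k 0)" C] by (simp add: layer_weight_def mult_ac)
  have bound: "\<bar>layer_weight \<epsilon> k a 0 c * ?z c\<bar> \<le> \<bar>C\<bar> / q0 * Ew (real (k 0 + a 0)) c" for c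
  proof -
    have "\<bar>\<epsilon> 0 ^ c\<bar> = 1" using 0(7)[of 0] by (auto simp: power_abs)
    moreover have "\<bar>if a 0 \<le> c then 1 / qf (c - a 0) else 0\<bar> \<le> 1 / q0"
      using q0_pos q0_le[of "c - a 0"] qf_pos[of "c - a 0"] by (auto simp: frac_le)
    ultimately have "\<bar>?h c\<bar> \<le> Ew (real (k 0 + a 0)) c * (1 / q0)"
      unfolding abs_mult using Ew_pos[of "real (k 0 + a 0)" c] by (simp only: mult_1) (intro mult_mono, auto)
    then have "\<bar>C\<bar> * \<bar>?h c\<bar> \<le> \<bar>C\<bar> * (Ew (real (k 0 + a 0)) c * (1 / q0))" by (rule mult_left_mono) simp
    then show ?thesis unfolding t abs_mult[of C] by (simp add: mult_ac)
  qed
  have "\<tau> * \<epsilon> 0 = -1" "k 0 \<ge> 1" using 0 by auto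
  then have hs: "((\<lambda>c. C * (?h c * \<tau> ^ c * q powr (- real j * real c))) has_sum C * 0) UNIV" for j
    by (intro has_sum_cmult_right first_layer)
  have "((\<lambda>c. layer_weight \<epsilon> k a 0 c * ?z c * \<tau> ^ c * q powr (- real j * real c)) has_sum 0) UNIV" for j
    unfolding t using hs[of j] by (simp only: mult.assoc mult_zero_right)
  then show ?case using C bound q0_pos by (intro exI[of _ ?z] exI[of _ "\<bar>C\<bar> / q0"] conjI) auto
next
  case (Suc m)
  let ?e = "\<lambda>i. \<epsilon> (Suc i)" and ?k = "\<lambda>i. k (Suc i)" and ?a = "\<lambda>i. a (Suc i)"
  have sgn: "\<tau> * \<epsilon> 0 = 1 \<or> \<tau> * \<epsilon> 0 = -1" using Suc.prems(7)[of 0] Suc.prems(8) by auto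
  have "\<tau> * \<epsilon> 0 * (\<Prod>i<Suc m. ?e i) = -1"
    using Suc.prems(9) by (simp only: prod.lessThan_Suc_shift[of _ "Suc m"] mult.assoc)
  then have "\<exists>z B. column_sums (\<lambda>i. layer_weight ?e ?k ?a (Suc i)) z \<and> B \<ge> 0 \<and>
    (\<forall>c. \<bar>layer_weight ?e ?k ?a 0 c * z c\<bar> \<le> B * Ew (real (?k 0 + ?a 0)) c) \<and>
    (\<forall>j :: nat. ((\<lambda>c. layer_weight ?e ?k ?a 0 c * z c * (\<tau> * \<epsilon> 0) ^ c * q powr (- real j * real c)) has_sum 0) UNIV)"
    using Suc.prems sgn by (intro Suc.IH) auto
  then obtain z1 B1 where z1: "column_sums (\<lambda>i. layer_weight ?e ?k ?a (Suc i)) z1" "B1 \<ge> 0"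
    "\<And>c. \<bar>layer_weight ?e ?k ?a 0 c * z1 c\<bar> \<le> B1 * Ew (real (?k 0 + ?a 0)) c"
    "\<And>j :: nat. ((\<lambda>c. layer_weight ?e ?k ?a 0 c * z1 c * (\<tau> * \<epsilon> 0) ^ c * q powr (- real j * real c)) has_sum 0) UNIV"
    by blast
  define w where "w s = layer_weight ?e ?k ?a 0 s * z1 s" for s
  define z where "z n = (\<Sum>s\<le>n. w s * Dw n s)" for n
  have triv: "\<And>i. i \<ge> K + Suc m \<Longrightarrow> ?e i = 1 \<and> ?k i = 0 \<and> ?a i = 0" using Suc.prems by auto
  obtain za where za: "column_sums (\<lambda>i c. \<bar>layer_weight ?e ?k ?a (Suc i) c\<bar>) za"
    using layer_weight_abs_bounded[of "K + Suc m" ?e ?k ?a] triv Suc.prems(7) by blast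
  have ev: "ev_one (layer_weight ?e ?k ?a)" by (rule layer_weight_ev_one[of "K + Suc m"]) (use Suc.prems in auto)
  have gz: "column_sums (\<lambda>i. layer_weight \<epsilon> k a (Suc i)) z"
    unfolding layer_weight_shift z_def w_def by (rule column_sums_step[OF ev z1(1) za])
  have wb: "\<bar>w s\<bar> \<le> B1 * Ew (real (?k 0 + ?a 0)) s" for s unfolding w_def by (rule z1(3))
  obtain B2 where B2: "B2 \<ge> 0" "\<And>c. \<bar>z c\<bar> \<le> B2" unfolding z_def using column_bounded[OF z1(2) wb] by blast
  obtain B3 where B3: "B3 \<ge> 0" "\<And>c. \<bar>layer_weight \<epsilon> k a 0 c\<bar> \<le> B3 * Ew (real (k 0 + a 0)) c"
    using layer_weight_bound[of \<epsilon> 0 k a] Suc.prems(7)[of 0] by blast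
  have bound: "\<bar>layer_weight \<epsilon> k a 0 c * z c\<bar> \<le> (B3 * B2) * Ew (real (k 0 + a 0)) c" for c
  proof -
    have "\<bar>layer_weight \<epsilon> k a 0 c * z c\<bar> \<le> (B3 * Ew (real (k 0 + a 0)) c) * B2"
      unfolding abs_mult using B2 B3 Ew_pos[of "real (k 0 + a 0)" c] by (intro mult_mono) auto
    then show ?thesis by (simp add: mult_ac)
  qed
  obtain f where f: "\<And>c. sur_factor (a 0) (a (Suc 0)) c = (\<Sum>d\<in>{a 0 - (a 0 - a (Suc 0))..a 0}. f d * q powr (- real d * real c))"
    using sur_factor_powers[of "a 0" "a (Suc 0)"] by blast
  have "((\<lambda>c. (\<epsilon> 0 ^ c * sur_factor (a 0) (a (Suc 0)) c * Ew (real (k 0)) c * (\<Sum>s\<le>c. w s * Dw c s)) * \<tau> ^ c * q powr (- real j * real c)) has_sum 0) UNIV" for j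
  proof (rule layer_step[OF Suc.prems(8) Suc.prems(7)[of 0] z1(2) wb _ _ _ f])
    show "((\<lambda>s. w s * (\<tau> * \<epsilon> 0) ^ s * q powr (- real j * real s)) has_sum 0) UNIV" for j unfolding w_def by (rule z1(4))
    fix d assume "d \<in> {a 0 - (a 0 - a (Suc 0))..a 0}"
    \<comment> \<open>The smallest power in the surjection factor is \<open>a (Suc 0)\<close>,
      exactly the growth that the inner weight inherits from \<open>mu\<close>; the strict decrease
      of \<open>k\<close> then makes the difference positive.\<close>
    then have "a (Suc 0) \<le> d" using Suc.prems(1)[of 0] by auto
    moreover have "k (Suc 0) < k 0" by (rule Suc.prems(3)) simp
    ultimately show "real (k (Suc 0) + a (Suc 0)) < real (k 0 + d)" by simp
  qed simp
  then have "\<forall>j. ((\<lambda>c. layer_weight \<epsilon> k a 0 c * z c * \<tau> ^ c * q powr (- real j * real c)) has_sum 0) UNIV"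
    by (simp add: layer_weight_def z_def)
  then show ?case using gz bound B2(1) B3(1) by (intro exI[of _ z] exI[of _ "B3 * B2"] conjI) auto
qed

lemma colweight_summable:
  assumes "\<And>i. i \<ge> K \<Longrightarrow> \<epsilon> i = 1 \<and> k i = 0 \<and> a i = 0" and "\<And>i. \<epsilon> i = 1 \<or> \<epsilon> i = -1"
  shows "colweight (layer_weight \<epsilon> k a) summable_on partitions"
proof -
  have ev: "ev_one (layer_weight \<epsilon> k a)" by (rule layer_weight_ev_one[OF assms(1)])
  have eva: "ev_one (\<lambda>i c. \<bar>layer_weight \<epsilon> k a i c\<bar>)"
    using ev unfolding ev_one_def by (metis abs_one)
  obtain z B where g: "column_sums (\<lambda>i c. \<bar>layer_weight \<epsilon> k a (Suc i) c\<bar>) z" and z: "B \<ge> 0" "\<And>n. 0 \<le> z n" "\<And>n. z n \<le> B"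
    using layer_weight_abs_bounded[of K \<epsilon> k a] assms by blast
  obtain B3 where B3: "B3 \<ge> 0" "\<And>c. \<bar>layer_weight \<epsilon> k a 0 c\<bar> \<le> B3 * Ew (real (k 0 + a 0)) c"
    using layer_weight_bound[of \<epsilon> 0 k a] assms(2)[of 0] by blast
  have "\<bar>\<bar>layer_weight \<epsilon> k a 0 c\<bar> * z c\<bar> \<le> (B3 * B) * Ew (real (k 0 + a 0)) c" for c
  proof -
    have "\<bar>layer_weight \<epsilon> k a 0 c\<bar> * z c \<le> (B3 * Ew (real (k 0 + a 0)) c) * B"
      using z B3 Ew_pos[of "real (k 0 + a 0)" c] by (intro mult_mono) auto
    then show ?thesis using z(2)[of c] by (simp add: mult_ac)
  qed
  then have s: "(\<lambda>c. \<bar>layer_weight \<epsilon> k a 0 c\<bar> * z c) summable_on UNIV"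
    by (rule summable_bounded_Ew(1)) (use z B3 in simp)
  have "(colweight (\<lambda>i c. \<bar>layer_weight \<epsilon> k a i c\<bar>) has_sum (\<Sum>\<^sub>\<infinity>c. \<bar>layer_weight \<epsilon> k a 0 c\<bar> * z c)) partitions"
  proof (rule column_sums_top[OF eva g])
    show "column_sums (\<lambda>i c. \<bar>\<bar>layer_weight \<epsilon> k a (Suc i) c\<bar>\<bar>) z" using g by simp
    show "(\<lambda>d. \<bar>\<bar>layer_weight \<epsilon> k a 0 d\<bar>\<bar> * z d) summable_on UNIV" using s by simp
    show "((\<lambda>d. \<bar>layer_weight \<epsilon> k a 0 d\<bar> * z d) has_sum (\<Sum>\<^sub>\<infinity>c. \<bar>layer_weight \<epsilon> k a 0 c\<bar> * z c)) UNIV"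
      by (rule has_sum_infsum[OF s])
  qed
  then have "colweight (\<lambda>i c. \<bar>layer_weight \<epsilon> k a i c\<bar>) summable_on partitions" by (rule has_sum_imp_summable)
  then have "(\<lambda>g. norm (colweight (layer_weight \<epsilon> k a) g)) summable_on partitions"
    by (rule summable_on_cong[THEN iffD1, rotated]) (simp add: colweight_abs[OF ev])
  then show ?thesis by (rule Infinite_Sum.abs_summable_summable)
qed

lemma colweight_sum_zero:
  assumes "\<And>i. a (Suc i) \<le> a i" "\<And>i. i \<ge> K \<Longrightarrow> a i = 0"
    and "\<And>i. Suc i < Suc m \<Longrightarrow> k (Suc i) < k i" "k m \<ge> 1" "\<And>i. i \<ge> Suc m \<Longrightarrow> k i = 0"
    and "\<And>i. i \<ge> Suc m \<Longrightarrow> \<epsilon> i = 1" "\<And>i. \<epsilon> i = 1 \<or> \<epsilon> i = -1"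
    and "(\<Prod>i<Suc m. \<epsilon> i) = -1"
  shows "(colweight (layer_weight \<epsilon> k a) has_sum 0) partitions"
proof -
  have "\<exists>z B. column_sums (\<lambda>i. layer_weight \<epsilon> k a (Suc i)) z \<and> B \<ge> 0 \<and>
    (\<forall>c. \<bar>layer_weight \<epsilon> k a 0 c * z c\<bar> \<le> B * Ew (real (k 0 + a 0)) c) \<and>
    (\<forall>j :: nat. ((\<lambda>c. layer_weight \<epsilon> k a 0 c * z c * 1 ^ c * q powr (- real j * real c)) has_sum 0) UNIV)"
    by (rule signed_column_sums_vanish[of a K m k \<epsilon> 1]) (use assms in auto)
  then obtain z where z: "column_sums (\<lambda>i. layer_weight \<epsilon> k a (Suc i)) z"
    "\<And>j :: nat. ((\<lambda>c. layer_weight \<epsilon> k a 0 c * z c * 1 ^ c * q powr (- real j * real c)) has_sum 0) UNIV" by blast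
  \<comment> \<open>No column lies further out, so the additional sign is 1, and the moment with
    \<open>j = 0\<close> is the plain sum.\<close>
  have hs: "((\<lambda>c. layer_weight \<epsilon> k a 0 c * z c) has_sum 0) UNIV" using z(2)[of 0] q_pos by simp
  have ev: "ev_one (layer_weight \<epsilon> k a)" by (rule layer_weight_ev_one[of "K + Suc m"]) (use assms in auto)
  have triv: "\<And>i. i \<ge> K + Suc m \<Longrightarrow> \<epsilon> i = 1 \<and> k i = 0 \<and> a i = 0" using assms by auto
  obtain za B where g: "column_sums (\<lambda>i c. \<bar>layer_weight \<epsilon> k a (Suc i) c\<bar>) za" and za: "B \<ge> 0" "\<And>n. 0 \<le> za n" "\<And>n. za n \<le> B"
    using layer_weight_abs_bounded[of "K + Suc m" \<epsilon> k a] triv assms(7) by blast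
  obtain B3 where B3: "B3 \<ge> 0" "\<And>c. \<bar>layer_weight \<epsilon> k a 0 c\<bar> \<le> B3 * Ew (real (k 0 + a 0)) c"
    using layer_weight_bound[of \<epsilon> 0 k a] assms(7)[of 0] by blast
  have "\<bar>\<bar>layer_weight \<epsilon> k a 0 c\<bar> * za c\<bar> \<le> (B3 * B) * Ew (real (k 0 + a 0)) c" for c
  proof -
    have "\<bar>layer_weight \<epsilon> k a 0 c\<bar> * za c \<le> (B3 * Ew (real (k 0 + a 0)) c) * B"
      using za B3 Ew_pos[of "real (k 0 + a 0)" c] by (intro mult_mono) auto
    then show ?thesis using za(2)[of c] by (simp add: mult_ac)
  qed
  then have s: "(\<lambda>c. \<bar>layer_weight \<epsilon> k a 0 c\<bar> * za c) summable_on UNIV"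
    by (rule summable_bounded_Ew(1)) (use za B3 in simp)
  show ?thesis by (rule column_sums_top[OF ev z(1) g s hs])
qed

end

section \<open>The polytope and the moments\<close>

lemma strict_partition_less:
  assumes "k \<in> partitions" "strict_partition k" "Suc i < part_length k"
  shows "k (Suc i) < k i"
proof (rule ccontr)
  assume "\<not> k (Suc i) < k i"
  then have e: "k (Suc i) = k i" using partitions_antimono[OF assms(1), of i "Suc i"] by simp
  have pos: "k i \<noteq> 0" using part_nonzero_iff[OF assms(1), of i] assms(3) by simp
  have "finite {j. k j = k i}"
    by (rule finite_subset[of _ "{j. k j \<noteq> 0}"]) (use pos assms(1) in \<open>auto simp: partitions_def\<close>)
  then have "card {i, Suc i} \<le> card {j. k j = k i}" by (rule card_mono) (use e in auto)
  then have "2 \<le> part_mult k (k i)" by (simp add: part_mult_def)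
  moreover have "part_mult k (k i) \<le> 1" using assms(2) pos by (simp add: strict_partition_def)
  ultimately show False by simp
qed

lemma sign_prod: "finite S \<Longrightarrow> (-1 :: real) ^ card (S \<inter> U) = (\<Prod>i\<in>S. if i \<in> U then -1 else 1)"
  by (simp add: prod.If_cases Int_def)

text \<open>Orthogonality of the characters of the group of subsets: the sum over \<open>U\<close>
  of a product of two characters factors into \<open>g S x + 1\<close> over the points
  \<open>x\<close>, and a factor vanishes as soon as \<open>S\<close> and \<open>S0\<close> differ
  at \<open>x\<close>.\<close>

lemma odd_character_sum:
  fixes \<delta> :: "nat set \<Rightarrow> real"
  assumes "\<And>U. U \<subseteq> {1..r} \<Longrightarrow> (\<Sum>S\<in>odd_subsets r. \<delta> S * (-1) ^ card (S \<inter> U)) = 0"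
    and S0: "S0 \<in> odd_subsets r"
  shows "\<delta> S0 = 0"
proof -
  let ?A = "{1..r}"
  have fin: "finite (odd_subsets r)" by (rule finite_subset[of _ "Pow ?A"]) (auto simp: odd_subsets_def)
  define g where "g S x = (if x \<in> S then -1 else 1) * (if x \<in> S0 then -1 else (1 :: real))" for S x
  have sg: "(-1 :: real) ^ card (S \<inter> U) * (-1) ^ card (S0 \<inter> U) = (\<Prod>x\<in>U. g S x)" if "U \<subseteq> ?A" for S U
  proof -
    have "finite U" using that finite_subset by blast
    then show ?thesis
      unfolding g_def prod.distrib Int_commute[of _ U] by (simp only: sign_prod)
  qed
  have orth: "(\<Sum>U\<in>Pow ?A. \<Prod>x\<in>U. g S x) = (if S = S0 then 2 ^ r else 0)" if "S \<in> odd_subsets r" for S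
  proof -
    have "(\<Sum>U\<in>Pow ?A. \<Prod>x\<in>U. g S x) = (\<Prod>x\<in>?A. g S x + 1)"
      by (subst prod_add) auto
    also have "\<dots> = (if S = S0 then 2 ^ r else 0)"
    proof (cases "S = S0")
      case True
      have "(\<Prod>x\<in>?A. g S x + 1) = (\<Prod>x\<in>?A. 2)" by (rule prod.cong) (auto simp: g_def True)
      then show ?thesis using True by simp
    next
      case False
      then obtain x where x: "(x \<in> S) \<noteq> (x \<in> S0)" by blast
      then have "x \<in> ?A" using that S0 unfolding odd_subsets_def by blast
      with x have "(\<Prod>x\<in>?A. g S x + 1) = 0" by (intro prod_zero bexI[of _ x]) (auto simp: g_def)
      then show ?thesis using False by simp
    qed
    finally show ?thesis .
  qed
  have "0 = (\<Sum>U\<in>Pow ?A. (\<Sum>S\<in>odd_subsets r. \<delta> S * (-1) ^ card (S \<inter> U)) * (-1) ^ card (S0 \<inter> U))"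
    by (rule sum.neutral[symmetric]) (use assms(1) in auto)
  also have "\<dots> = (\<Sum>U\<in>Pow ?A. \<Sum>S\<in>odd_subsets r. \<delta> S * (\<Prod>x\<in>U. g S x))"
    unfolding sum_distrib_right by (intro sum.cong refl) (simp add: sg[symmetric] mult.assoc)
  also have "\<dots> = (\<Sum>S\<in>odd_subsets r. \<delta> S * (\<Sum>U\<in>Pow ?A. \<Prod>x\<in>U. g S x))"
    by (subst sum.swap) (simp add: sum_distrib_left)
  also have "\<dots> = (\<Sum>S\<in>odd_subsets r. if S = S0 then \<delta> S * 2 ^ r else 0)"
    by (rule sum.cong[OF refl]) (subst orth, simp_all)
  also have "\<dots> = \<delta> S0 * 2 ^ r" using S0 fin by simp
  finally show ?thesis by simp
qed

text \<open>The constant terms \<open>\<alpha> S\<close> cancel against the last summand of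
  \<open>P_Sym_alpha\<close>. What remains is \<open>P_Sym\<close> times a function of the parities
  of the columns; positivity, moments and uniqueness all start from this form.\<close>

lemma P_Sym_alpha_eq:
  "P_Sym_alpha p r k \<alpha> lam = P_Sym p k lam * (1 + (\<Sum>S\<in>odd_subsets r. \<alpha> S * (-1) ^ (\<Sum>i\<in>S. conj_part lam i)))"
proof -
  have "(\<Sum>S\<in>odd_subsets r. \<alpha> S * P_Sym_S p k S lam) =
      (\<Sum>S\<in>odd_subsets r. \<alpha> S) * P_Sym p k lam +
      (\<Sum>S\<in>odd_subsets r. \<alpha> S * (-1) ^ (\<Sum>i\<in>S. conj_part lam i)) * P_Sym p k lam"
    unfolding P_Sym_S_def sum_distrib_right sum.distrib[symmetric] by (rule sum.cong) (simp_all add: algebra_simps)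
  then show ?thesis unfolding P_Sym_alpha_def by (simp add: algebra_simps)
qed

lemma sign_conj_part:
  assumes "finite S"
  shows "(-1 :: real) ^ (\<Sum>i\<in>S. conj_part lam i) = (\<Prod>i\<in>S. if odd (conj_part lam i) then -1 else 1)"
  unfolding power_sum by (rule prod.cong) (auto simp: minus_one_power_iff)

text \<open>Apply the defining inequality of the polytope to the set of even columns.\<close>

lemma polytope_nonneg:
  assumes "\<alpha> \<in> polytope_A r"
  shows "1 + (\<Sum>S\<in>odd_subsets r. \<alpha> S * (-1) ^ (\<Sum>i\<in>S. conj_part lam i)) \<ge> 0"
proof -
  define T where "T = {i\<in>{1..r}. even (conj_part lam i)}"
  \<comment> \<open>Exchanging even and odd columns multiplies the sign by
    \<open>(-1) ^ card S\<close>, which is -1 on \<open>odd_subsets r\<close>.\<close>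
  have "(-1 :: real) ^ card (S \<inter> T) * \<alpha> S = - (\<alpha> S * (-1) ^ (\<Sum>i\<in>S. conj_part lam i))" if S: "S \<in> odd_subsets r" for S
  proof -
    have S': "S \<subseteq> {1..r}" "odd (card S)" "finite S" using S finite_subset by (auto simp: odd_subsets_def)
    have "(-1 :: real) ^ card (S \<inter> T) = (\<Prod>i\<in>S. - (if odd (conj_part lam i) then -1 else 1))"
      unfolding sign_prod[OF S'(3)] by (rule prod.cong) (use S'(1) in \<open>auto simp: T_def\<close>)
    also have "\<dots> = (\<Prod>i\<in>S. (-1) * (if odd (conj_part lam i) then -1 else 1))" by (rule prod.cong) auto
    also have "\<dots> = (-1) ^ card S * (-1) ^ (\<Sum>i\<in>S. conj_part lam i)"
      unfolding sign_conj_part[OF S'(3)] prod.distrib by simp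
    finally show ?thesis using S'(2) by simp
  qed
  then have "(\<Sum>S\<in>odd_subsets r. (-1) ^ card (S \<inter> T) * \<alpha> S) =
      - (\<Sum>S\<in>odd_subsets r. \<alpha> S * (-1) ^ (\<Sum>i\<in>S. conj_part lam i))"
    by (simp add: sum_negf[symmetric])
  moreover have "T \<subseteq> {1..r}" by (auto simp: T_def)
  then have "(\<Sum>S\<in>odd_subsets r. (-1) ^ card (S \<inter> T) * \<alpha> S) \<le> 1" using assms by (auto simp: polytope_A_def)
  ultimately show ?thesis by simp
qed

lemma ex_partition_odd_columns:
  assumes "U \<subseteq> {1..r}"
  obtains lam where "lam \<in> partitions" "\<And>i. i \<in> {1..r} \<Longrightarrow> odd (conj_part lam i) \<longleftrightarrow> i \<in> U"
proof -
  \<comment> \<open>Steps of 2 leave room for an arbitrary parity bit in every column without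
    breaking monotonicity.\<close>
  define c where "c i = (if i < r then 2 * (r - i) + (if Suc i \<in> U then 1 else 0) else 0)" for i :: nat
  have "c (Suc i) \<le> c i" for i by (auto simp: c_def)
  then have "antimono c" by (simp add: antimono_iff_le_Suc)
  moreover have "{i. c i \<noteq> 0} \<subseteq> {..<r}" by (auto simp: c_def split: if_splits)
  then have "finite {i. c i \<noteq> 0}" by (rule finite_subset) simp
  ultimately have c: "c \<in> partitions" by (simp add: partitions_def)
  show ?thesis
  proof (rule that[of "cj c"])
    show "cj c \<in> partitions" by (rule cj_partitions[OF c])
    fix i assume i: "i \<in> {1..r}"
    then obtain j where j: "i = Suc j" "j < r" by (cases i) auto
    have "conj_part (cj c) i = c j" using cj_cj[OF c] by (simp add: j cj_def[symmetric, of "cj c"])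
    then show "odd (conj_part (cj c) i) \<longleftrightarrow> i \<in> U" using j by (simp add: c_def)
  qed
qed

section \<open>From column weights back to the moments\<close>

context qpar
begin

lemma Ew_eq: "(1 / q) ^ (k * c) * q ^ (Suc c choose 2) = Ew (real k) c"
proof -
  have "(1 / q) ^ (k * c) = inverse (q powr real (k * c))"
    using q_pos by (simp only: powr_realpow) (simp add: divide_inverse power_inverse)
  then have "(1 / q) ^ (k * c) = q powr (- real k * real c)" by (simp add: powr_minus)
  then show ?thesis using Ew_mult[of 0 c "real k"] by (simp only: base_weight_Ew mult.commute add_0)
qed

lemma P_Sym_eq:
  assumes lam: "lam \<in> partitions" and N: "lam 0 \<le> N"
  shows "P_Sym (1 / q) k lam = qpoch_inf q (q\<^sup>2) *
    (\<Prod>i<N. Ew (real (k i)) (cj lam i) / Qf ((cj lam i - cj lam (Suc i)) div 2))"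
proof -
  have z: "cj lam i = 0" if "lam 0 \<le> i" for i using cj_zero_iff[OF lam] that by simp
  have 1: "(\<Sum>i=1..lam 0. k (i - 1) * conj_part lam i) = (\<Sum>i<N. k i * cj lam i)"
  proof -
    have "(\<Sum>i=1..lam 0. k (i - 1) * conj_part lam i) = (\<Sum>i<lam 0. k i * cj lam i)"
      by (rule sum.reindex_bij_witness[where j = "\<lambda>i. i - 1" and i = Suc]) (auto simp: cj_def)
    also have "\<dots> = (\<Sum>i<N. k i * cj lam i)"
      by (rule sum.mono_neutral_left) (use N z in auto)
    finally show ?thesis .
  qed
  have 2: "part_n lam + part_size lam = (\<Sum>i<N. Suc (cj lam i) choose 2)"
    unfolding part_n_eq[OF lam N] part_size_eq_cj[OF lam N] sum.distrib[symmetric]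
    by (rule sum.cong) (auto simp: numeral_2_eq_2)
  have 3: "(\<Prod>i=1..lam 0. Qf (part_mult lam i div 2)) = (\<Prod>i<N. Qf ((cj lam i - cj lam (Suc i)) div 2))"
  proof -
    have "(\<Prod>i=1..lam 0. Qf (part_mult lam i div 2)) = (\<Prod>i<lam 0. Qf ((cj lam i - cj lam (Suc i)) div 2))"
      by (rule prod.reindex_bij_witness[where j = "\<lambda>i. i - 1" and i = Suc])
        (auto simp: part_mult_eq[OF lam] Suc_le_eq gr0_conv_Suc)
    also have "\<dots> = (\<Prod>i<N. Qf ((cj lam i - cj lam (Suc i)) div 2))"
      by (rule prod.mono_neutral_left) (use N z in auto)
    finally show ?thesis .
  qed
  have 4: "1 / (1 / q) = q" by simp
  have "P_Sym (1 / q) k lam = (\<Prod>i<N. (1 / q) ^ (k i * cj lam i)) *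
     ((\<Prod>i<N. q ^ (Suc (cj lam i) choose 2)) * qpoch_inf q (q\<^sup>2) / (\<Prod>i<N. Qf ((cj lam i - cj lam (Suc i)) div 2)))"
    unfolding P_Sym_def P_Sym_inf_def Let_def 4 1 2 3 power_sum ..
  also have "\<dots> = qpoch_inf q (q\<^sup>2) * ((\<Prod>i<N. (1 / q) ^ (k i * cj lam i) * q ^ (Suc (cj lam i) choose 2)) /
      (\<Prod>i<N. Qf ((cj lam i - cj lam (Suc i)) div 2)))"
    unfolding prod.distrib by (simp del: binomial_Suc_n)
  finally show ?thesis unfolding Ew_eq prod_dividef .
qed

lemma P_Sym_pos: "lam \<in> partitions \<Longrightarrow> P_Sym (1 / q) k lam > 0"
  unfolding P_Sym_eq[OF _ order_refl]
  by (intro mult_pos_pos prod_pos ballI divide_pos_pos Ew_pos Qf_pos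
      qpar.qpoch_inf_pos[OF qpar_sq q_pos q_less_1])

text \<open>\<open>K\<close> collects everything independent of \<open>lam\<close>: the constant of
  \<open>sur_eq\<close> and the infinite product. The rest splits over the columns, including the
  sign, to which column \<open>i\<close> contributes \<open>(-1) ^ cj lam i\<close> when
  \<open>Suc i \<in> S\<close>.\<close>

lemma signed_term:
  assumes mu: "mu \<in> partitions" and S: "S \<subseteq> {1..r}"
  obtains K where "\<And>lam. lam \<in> partitions \<Longrightarrow>
    (-1) ^ (\<Sum>i\<in>S. conj_part lam i) * (P_Sym (1 / q) k lam * sur (1 / q) lam mu) =
      K * colweight (layer_weight (\<lambda>i. if Suc i \<in> S then -1 else 1) k (cj mu)) (cj lam)"
proof -
  let ?e = "\<lambda>i. if Suc i \<in> S then -1 else (1 :: real)"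
  obtain K where K: "\<And>lam. lam \<in> partitions \<Longrightarrow>
    sur (1 / q) lam mu = K * (\<Prod>i<mu 0. sur_factor (cj mu i) (cj mu (Suc i)) (cj lam i))"
    using sur_eq[OF mu] by blast
  show ?thesis
  proof (rule that[of "K * qpoch_inf q (q\<^sup>2)"])
    fix lam assume lam: "lam \<in> partitions"
    define N where "N = lam 0 + mu 0 + r"
    have zl: "cj lam i = 0" if "lam 0 \<le> i" for i using cj_zero_iff[OF lam] that by simp
    have zm: "cj mu i = 0" if "mu 0 \<le> i" for i using cj_zero_iff[OF mu] that by simp
    have s: "sur (1 / q) lam mu = K * (\<Prod>i<N. sur_factor (cj mu i) (cj mu (Suc i)) (cj lam i))"
    proof -
      have "(\<Prod>i<mu 0. sur_factor (cj mu i) (cj mu (Suc i)) (cj lam i)) = (\<Prod>i<N. sur_factor (cj mu i) (cj mu (Suc i)) (cj lam i))"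
        by (rule prod.mono_neutral_left) (use zm in \<open>auto simp: N_def sur_factor_def\<close>)
      then show ?thesis by (simp only: K[OF lam])
    qed
    have sg: "(-1) ^ (\<Sum>i\<in>S. conj_part lam i) = (\<Prod>i<N. ?e i ^ cj lam i)"
    proof -
      have "(-1 :: real) ^ (\<Sum>i\<in>S. conj_part lam i) = (\<Prod>j\<in>S. (-1) ^ conj_part lam j)" by (rule power_sum)
      also have "\<dots> = (\<Prod>j\<in>{1..N}. if j \<in> S then (-1) ^ conj_part lam j else 1)"
        by (rule prod.mono_neutral_cong_left) (use S in \<open>auto simp: N_def\<close>)
      also have "\<dots> = (\<Prod>i<N. ?e i ^ cj lam i)"
        by (rule prod.reindex_bij_witness[where j = "\<lambda>i. i - 1" and i = Suc]) (auto simp: cj_def)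
      finally show ?thesis .
    qed
    have "colweight (layer_weight ?e k (cj mu)) (cj lam) = (\<Prod>i<N. wfac (layer_weight ?e k (cj mu)) (cj lam) i)"
    proof (rule colweight_eq)
      fix i assume i: "N \<le> i"
      then have "cj lam i = 0" "cj lam (Suc i) = 0" "cj mu i = 0" using zl zm by (auto simp: N_def)
      then show "wfac (layer_weight ?e k (cj mu)) (cj lam) i = 1"
        using q_pos by (simp add: wfac_def layer_weight_def sur_factor_def Ew_def)
    qed
    also have "\<dots> = (\<Prod>i<N. ?e i ^ cj lam i) * (\<Prod>i<N. sur_factor (cj mu i) (cj mu (Suc i)) (cj lam i)) *
        (\<Prod>i<N. Ew (real (k i)) (cj lam i) / Qf ((cj lam i - cj lam (Suc i)) div 2))"
      unfolding prod.distrib[symmetric] by (rule prod.cong) (simp_all add: wfac_def layer_weight_def)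
    finally have w: "colweight (layer_weight ?e k (cj mu)) (cj lam) = (\<Prod>i<N. ?e i ^ cj lam i) * (\<Prod>i<N. sur_factor (cj mu i) (cj mu (Suc i)) (cj lam i)) *
        (\<Prod>i<N. Ew (real (k i)) (cj lam i) / Qf ((cj lam i - cj lam (Suc i)) div 2))" .
    have "lam 0 \<le> N" by (simp add: N_def)
    show "(-1) ^ (\<Sum>i\<in>S. conj_part lam i) * (P_Sym (1 / q) k lam * sur (1 / q) lam mu) =
      K * qpoch_inf q (q\<^sup>2) * colweight (layer_weight ?e k (cj mu)) (cj lam)"
      unfolding w sg s P_Sym_eq[OF lam \<open>lam 0 \<le> N\<close>] by (simp only: mult_ac)
  qed
qed

lemma signed_moment:
  assumes mu: "mu \<in> partitions" and k: "k \<in> partitions" "strict_partition k" "part_length k = r"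
    and S: "S \<in> odd_subsets r"
  shows "((\<lambda>lam. (-1) ^ (\<Sum>i\<in>S. conj_part lam i) * (P_Sym (1 / q) k lam * sur (1 / q) lam mu)) has_sum 0) partitions"
proof -
  let ?e = "\<lambda>i. if Suc i \<in> S then -1 else (1 :: real)"
  have S': "S \<subseteq> {1..r}" "odd (card S)" using S by (auto simp: odd_subsets_def)
  have "r \<noteq> 0"
  proof
    assume "r = 0"
    then have "S = {}" using S'(1) by simp
    then show False using S'(2) by simp
  qed
  then obtain m where m: "r = Suc m" by (cases r) auto
  have "(\<Prod>i<r. ?e i) = (\<Prod>j\<in>{1..r}. if j \<in> S then -1 else 1)"
    by (rule prod.reindex_bij_witness[where j = Suc and i = "\<lambda>i. i - 1"]) auto
  also have "\<dots> = (\<Prod>j\<in>S. -1)" by (rule prod.mono_neutral_cong_right) (use S' in auto)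
  also have "\<dots> = -1" using S'(2) by simp
  finally have e: "(\<Prod>i<Suc m. ?e i) = -1" unfolding m .
  have W0: "(colweight (layer_weight ?e k (cj mu)) has_sum 0) partitions"
  proof (rule colweight_sum_zero[of _ "mu 0" m])
    show "cj mu (Suc i) \<le> cj mu i" for i by (rule cj_antimono[OF mu]) simp
    show "cj mu i = 0" if "mu 0 \<le> i" for i using cj_zero_iff[OF mu] that by simp
    show "k (Suc i) < k i" if "Suc i < Suc m" for i
      by (rule strict_partition_less[OF k(1,2)]) (use that m k(3) in simp)
    show "1 \<le> k m" using part_nonzero_iff[OF k(1), of m] m k(3) by simp
    show "k i = 0" if "Suc m \<le> i" for i using part_zero_iff[OF k(1), of i] that m k(3) by simp
    show "?e i = 1" if "Suc m \<le> i" for i using S'(1) that m by auto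
    show "(\<Prod>i<Suc m. ?e i) = -1" by (rule e)
  qed auto
  have W1: "((\<lambda>lam. colweight (layer_weight ?e k (cj mu)) (cj lam)) has_sum 0) partitions"
    using has_sum_reindex_bij_betw[OF bij_betw_cj] W0 by blast
  obtain K where K: "\<And>lam. lam \<in> partitions \<Longrightarrow>
    (-1) ^ (\<Sum>i\<in>S. conj_part lam i) * (P_Sym (1 / q) k lam * sur (1 / q) lam mu) = K * colweight (layer_weight ?e k (cj mu)) (cj lam)"
    using signed_term[OF mu S'(1)] by blast
  have "((\<lambda>lam. K * colweight (layer_weight ?e k (cj mu)) (cj lam)) has_sum K * 0) partitions"
    by (rule has_sum_cmult_right[OF W1])
  then show ?thesis
    by (subst has_sum_cong[where g = "\<lambda>lam. K * colweight (layer_weight ?e k (cj mu)) (cj lam)"]) (use K in auto)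
qed

lemma moment_summable:
  assumes mu: "mu \<in> partitions" and k: "k \<in> partitions"
  shows "(\<lambda>lam. P_Sym (1 / q) k lam * sur (1 / q) lam mu) summable_on partitions"
proof -
  let ?e = "\<lambda>i. if Suc i \<in> {} then -1 else (1 :: real)"
  have W0: "colweight (layer_weight ?e k (cj mu)) summable_on partitions"
  proof (rule colweight_summable[of "mu 0 + part_length k"])
    show "?e i = 1 \<and> k i = 0 \<and> cj mu i = 0" if "mu 0 + part_length k \<le> i" for i
      using that cj_zero_iff[OF mu, of i] part_zero_iff[OF k, of i] by simp
  qed auto
  have W1: "(\<lambda>lam. colweight (layer_weight ?e k (cj mu)) (cj lam)) summable_on partitions"
    using summable_on_reindex_bij_betw[OF bij_betw_cj] W0 by blast
  obtain K where K: "\<And>lam. lam \<in> partitions \<Longrightarrow>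
    (-1) ^ (\<Sum>i\<in>{}. conj_part lam i) * (P_Sym (1 / q) k lam * sur (1 / q) lam mu) = K * colweight (layer_weight ?e k (cj mu)) (cj lam)"
    using signed_term[OF mu empty_subsetI, of k] by blast
  have "(\<lambda>lam. K * colweight (layer_weight ?e k (cj mu)) (cj lam)) summable_on partitions"
    by (rule summable_on_cmult_right[OF W1])
  then show ?thesis
    by (subst summable_on_cong[where g = "\<lambda>lam. K * colweight (layer_weight ?e k (cj mu)) (cj lam)"]) (use K in auto)
qed

lemma alpha_moment:
  assumes "mu \<in> partitions" "k \<in> partitions" "strict_partition k" "part_length k = r"
  shows "((\<lambda>lam. P_Sym_alpha (1 / q) r k \<alpha> lam * sur (1 / q) lam mu) has_sum moment (1 / q) mu (P_Sym (1 / q) k)) partitions"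
proof -
  have fin: "finite (odd_subsets r)" by (rule finite_subset[of _ "Pow {1..r}"]) (auto simp: odd_subsets_def)
  have 1: "((\<lambda>lam. P_Sym (1 / q) k lam * sur (1 / q) lam mu) has_sum moment (1 / q) mu (P_Sym (1 / q) k)) partitions"
    unfolding moment_def by (rule has_sum_infsum[OF moment_summable[OF assms(1,2)]])
  have 2: "((\<lambda>lam. \<Sum>S\<in>odd_subsets r. \<alpha> S * ((-1) ^ (\<Sum>i\<in>S. conj_part lam i) * (P_Sym (1 / q) k lam * sur (1 / q) lam mu)))
      has_sum (\<Sum>S\<in>odd_subsets r. \<alpha> S * 0)) partitions"
    by (rule has_sum_finite_sum[OF fin], rule has_sum_cmult_right, rule signed_moment[OF assms])
  have e: "P_Sym_alpha (1 / q) r k \<alpha> lam * sur (1 / q) lam mu = P_Sym (1 / q) k lam * sur (1 / q) lam mu +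
      (\<Sum>S\<in>odd_subsets r. \<alpha> S * ((-1) ^ (\<Sum>i\<in>S. conj_part lam i) * (P_Sym (1 / q) k lam * sur (1 / q) lam mu)))" for lam
    unfolding P_Sym_alpha_eq by (simp add: distrib_left distrib_right sum_distrib_left sum_distrib_right mult_ac)
  show ?thesis using has_sum_add[OF 1 2] unfolding e by simp
qed

end

theorem theorem1p9:
  fixes p :: real and \<mu> \<kappa> :: "nat \<Rightarrow> nat" and r :: nat
  assumes "p > 1"
    and "\<mu> \<in> partitions"
    and "\<kappa> \<in> partitions"
    and "strict_partition \<kappa>"
    and "part_length \<kappa> = r"
  shows "(\<forall>\<alpha>\<in>polytope_A r.
            (\<forall>lam\<in>partitions. P_Sym_alpha p r \<kappa> \<alpha> lam \<ge> 0) \<and>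
            has_moment p \<mu> (P_Sym_alpha p r \<kappa> \<alpha>) \<and>
            has_moment p \<mu> (P_Sym p \<kappa>) \<and>
            moment p \<mu> (P_Sym_alpha p r \<kappa> \<alpha>) = moment p \<mu> (P_Sym p \<kappa>)) \<and>
         (\<forall>\<alpha>\<in>polytope_A r. \<forall>\<beta>\<in>polytope_A r.
            (\<forall>lam\<in>partitions. P_Sym_alpha p r \<kappa> \<alpha> lam = P_Sym_alpha p r \<kappa> \<beta> lam)
              \<longrightarrow> \<alpha> = \<beta>)"
proof -
  have qp: "qpar (1 / p)" by (rule qpar.intro) (use assms(1) in auto)
  have pp: "1 / (1 / p) = p" by simp
  note pos = qpar.P_Sym_pos[OF qp, unfolded pp]
  note alpha = qpar.alpha_moment[OF qp assms(2-5), unfolded pp]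
  note summ = qpar.moment_summable[OF qp assms(2,3), unfolded pp]
  have "\<alpha> = \<beta>"
    if A: "\<alpha> \<in> polytope_A r" "\<beta> \<in> polytope_A r"
      and eq: "\<And>lam. lam \<in> partitions \<Longrightarrow> P_Sym_alpha p r \<kappa> \<alpha> lam = P_Sym_alpha p r \<kappa> \<beta> lam"
    for \<alpha> \<beta>
  \<comment> \<open>Members of \<open>polytope_A r\<close> are \<open>undefined\<close> off
    \<open>odd_subsets r\<close>, so that equality as functions reduces to equality on that
    set.\<close>
  proof (rule extensionalityI)
    show "\<alpha> \<in> extensional (odd_subsets r)" "\<beta> \<in> extensional (odd_subsets r)"
      using A by (auto simp: polytope_A_def)
    fix S0 assume S0: "S0 \<in> odd_subsets r"
    have "(\<Sum>S\<in>odd_subsets r. (\<alpha> S - \<beta> S) * (-1) ^ card (S \<inter> U)) = 0" if U: "U \<subseteq> {1..r}" for U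
    proof -
      obtain lam where lam: "lam \<in> partitions" "\<And>i. i \<in> {1..r} \<Longrightarrow> odd (conj_part lam i) \<longleftrightarrow> i \<in> U"
        using ex_partition_odd_columns[OF U] by blast
      have s: "(-1 :: real) ^ (\<Sum>i\<in>S. conj_part lam i) = (-1) ^ card (S \<inter> U)" if "S \<in> odd_subsets r" for S
      proof -
        have "S \<subseteq> {1..r}" "finite S" using that finite_subset by (auto simp: odd_subsets_def)
        then show ?thesis
          unfolding sign_prod[OF \<open>finite S\<close>] sign_conj_part[OF \<open>finite S\<close>]
        proof (intro prod.cong refl)
          fix i assume "i \<in> S"
          then have "i \<in> {1..r}" using \<open>S \<subseteq> {1..r}\<close> by blast
          then show "(if odd (conj_part lam i) then -1 else 1 :: real) = (if i \<in> U then -1 else 1)"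
            using lam(2)[of i] by simp
        qed
      qed
      have "P_Sym p \<kappa> lam * (1 + (\<Sum>S\<in>odd_subsets r. \<alpha> S * (-1) ^ (\<Sum>i\<in>S. conj_part lam i))) =
          P_Sym p \<kappa> lam * (1 + (\<Sum>S\<in>odd_subsets r. \<beta> S * (-1) ^ (\<Sum>i\<in>S. conj_part lam i)))"
        using eq[OF lam(1)] unfolding P_Sym_alpha_eq .
      then have "(\<Sum>S\<in>odd_subsets r. \<alpha> S * (-1) ^ (\<Sum>i\<in>S. conj_part lam i)) =
          (\<Sum>S\<in>odd_subsets r. \<beta> S * (-1) ^ (\<Sum>i\<in>S. conj_part lam i))"
        using pos[OF lam(1), of \<kappa>] by simp
      then show ?thesis by (simp add: s left_diff_distrib sum_subtractf)
    qed
    then have "\<alpha> S0 - \<beta> S0 = 0" by (rule odd_character_sum[where \<delta> = "\<lambda>S. \<alpha> S - \<beta> S"]) (use S0 in auto)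
    then show "\<alpha> S0 = \<beta> S0" by simp
  qed
  moreover have "P_Sym_alpha p r \<kappa> \<alpha> lam \<ge> 0" if "\<alpha> \<in> polytope_A r" "lam \<in> partitions" for \<alpha> lam
    unfolding P_Sym_alpha_eq using polytope_nonneg[OF that(1)] pos[OF that(2), of \<kappa>] by simp
  moreover have "has_moment p \<mu> (P_Sym_alpha p r \<kappa> \<alpha>)" for \<alpha>
    unfolding has_moment_def using alpha by (rule has_sum_imp_summable)
  moreover have "has_moment p \<mu> (P_Sym p \<kappa>)" unfolding has_moment_def by (rule summ)
  moreover have "moment p \<mu> (P_Sym_alpha p r \<kappa> \<alpha>) = moment p \<mu> (P_Sym p \<kappa>)" for \<alpha>
    unfolding moment_def[of _ _ "P_Sym_alpha p r \<kappa> \<alpha>"] using alpha by (rule infsumI)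
  ultimately show ?thesis by blast
qed

end
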